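(* Let $L>0$, $M\in\mathbb{R}$ and $f(u)=u-u^3$, and consider, with bifurcation parameter $\lambda\in(0,\infty)$, the problem $$\left(\frac{u_x}{\sqrt{1+u_x^2}}\right)_x+\lambda f(u)-\frac{\lambda}{L}\int_0^L f(u(x))\,dx=0,\quad x\in(0,L),\qquad u_x(0)=u_x(L)=0,\qquad \frac1L\int_0^L u(x)\,dx=M,$$ which has the trivial (constant) solution $u(x)=M$ for every $\lambda$. Let $k\in\mathbb{N}$, $k\ge 1$. When $|M|<\frac{1}{\sqrt3}$, the $k$-th bifurcation from the trivial solution is the one at $\lambda=\lambda_k:=\frac{k^2\pi^2}{L^2f'(M)}$. When $|M|<\frac1{\sqrt5}$ set $$L^*:=\frac{k\pi}{\sqrt2}\,\frac{1-3M^2}{\sqrt{1-5M^2}}.$$ Then: (i) For $0\le|M|<\frac1{\sqrt5}$, the $k$-th bifurcation from the trivial solution is a supercritical pitchfork if $L>L^*$ and a subcritical pitchfork if $L<L^*$. (ii) For $\frac1{\sqrt5}<|M|<\frac1{\sqrt3}$, the $k$-th bifurcation from $u(x)=M$ is a subcritical pitchfork for all $L>0$ (and every $k\geq 1$). (iii) For $|M|\ge\frac1{\sqrt3}$, there are no bifurcations from the constant solution $u(x)=M$ for any $L>0$ (at any $\lambda\in(0,\infty)$).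
   Context: Solutions are classical solutions, i.e. $u\in C^2((0,L))\cap C^1([0,L])$; closeness of solutions to the constant $M$ may be measured in the $C^2([0,L])$ norm. A bifurcation from the trivial solution at $\lambda_0$ means that every neighbourhood of $(\lambda_0,M)$ contains a pair $(\lambda,u)$ with $u$ a non-constant solution for the parameter value $\lambda$. The bifurcation at $\lambda_k$ is a pitchfork if, near $(\lambda_k,M)$, the solution set consists of the trivial branch $\{(\lambda,M)\}$ together with a smooth curve $y\mapsto(\lambda(y),u(y))$, $|y|$ small, with $\lambda(0)=\lambda_k$, $\lambda'(0)=0$, $u(0)=M$, tangent at $y=0$ to the kernel direction $\cos(k\pi x/L)$, with $u(y)$ non-constant for $y\ne0$. It is supercritical if $\lambda(y)>\lambda_k$ for all small $y\neq0$, and subcritical if $\lambda(y)<\lambda_k$ for all small $y\ne0$. *)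

theory Defs
  imports "HOL-Analysis.Analysis"
begin

text \<open>
  Functions on \<open>[0,L]\<close> are represented by functions on all reals of which only the values on
  \<open>{0..L}\<close> matter; all derivatives are taken within the respective set, so they are one-sided
  at the endpoints of \<open>{0..L}\<close>.
\<close>

definition Dw :: "real set \<Rightarrow> (real \<Rightarrow> real) \<Rightarrow> real \<Rightarrow> real" where
  "Dw S u x = vector_derivative u (at x within S)"

definition Ck_on :: "nat \<Rightarrow> real set \<Rightarrow> (real \<Rightarrow> real) \<Rightarrow> bool" where
  "Ck_on n S u \<longleftrightarrow>
     (\<forall>j<n. \<forall>x\<in>S. ((Dw S ^^ j) u) differentiable (at x within S)) \<and>
     (\<forall>j\<le>n. continuous_on S ((Dw S ^^ j) u))"

text \<open>The norm of \<open>C\<^sup>2([0,L])\<close>; it is only meaningful for \<open>u\<close> with \<open>Ck_on 2 {0..L} u\<close>.\<close>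

definition C2_norm :: "real \<Rightarrow> (real \<Rightarrow> real) \<Rightarrow> real" where
  "C2_norm L u = (\<Sum>j\<le>2. SUP x\<in>{0..L}. \<bar>(Dw {0..L} ^^ j) u x\<bar>)"

definition cubic_f :: "real \<Rightarrow> real" where
  "cubic_f u = u - u ^ 3"

definition flux :: "real \<Rightarrow> (real \<Rightarrow> real) \<Rightarrow> real \<Rightarrow> real" where
  "flux L u x = Dw {0..L} u x / sqrt (1 + (Dw {0..L} u x)\<^sup>2)"

definition is_solution :: "real \<Rightarrow> real \<Rightarrow> real \<Rightarrow> (real \<Rightarrow> real) \<Rightarrow> bool" where
  "is_solution L M lam u \<longleftrightarrow>
     0 < lam \<and> Ck_on 2 {0<..<L} u \<and> Ck_on 1 {0..L} u \<and>
     (\<forall>x\<in>{0<..<L}. deriv (flux L u) x + lam * cubic_f (u x)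
                      - lam / L * integral {0..L} (\<lambda>s. cubic_f (u s)) = 0) \<and>
     Dw {0..L} u 0 = 0 \<and> Dw {0..L} u L = 0 \<and>
     1 / L * integral {0..L} u = M"

text \<open>
  The \<open>\<epsilon>\<close>-neighbourhood of \<open>(lam0, M)\<close> in \<open>\<real> \<times> C\<^sup>2([0,L])\<close>. Requiring \<open>C\<^sup>2\<close> up to the boundary
  excludes no solution: by the equation, \<open>u''\<close> extends continuously to \<open>[0,L]\<close>.
\<close>

definition near :: "real \<Rightarrow> real \<Rightarrow> real \<Rightarrow> real \<Rightarrow> real \<Rightarrow> (real \<Rightarrow> real) \<Rightarrow> bool" where
  "near L M lam0 \<epsilon> lam u \<longleftrightarrow>
     \<bar>lam - lam0\<bar> < \<epsilon> \<and> Ck_on 2 {0..L} u \<and> C2_norm L (\<lambda>x. u x - M) < \<epsilon>"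

definition bifurcation_at :: "real \<Rightarrow> real \<Rightarrow> real \<Rightarrow> bool" where
  "bifurcation_at L M lam0 \<longleftrightarrow>
     (\<forall>\<epsilon>>0. \<exists>lam u. near L M lam0 \<epsilon> lam u \<and> is_solution L M lam u \<and> \<not> u constant_on {0..L})"

text \<open>Derivative at \<open>y\<close> of a curve \<open>U\<close> (curve parameter first) in the normed space \<open>C\<^sup>2([0,L])\<close>.\<close>

definition has_C2_derivative ::
    "real \<Rightarrow> (real \<Rightarrow> real \<Rightarrow> real) \<Rightarrow> (real \<Rightarrow> real) \<Rightarrow> real \<Rightarrow> bool" where
  "has_C2_derivative L U W y \<longleftrightarrow>
     Ck_on 2 {0..L} W \<and>
     ((\<lambda>h. C2_norm L (\<lambda>x. (U (y + h) x - U y x) / h - W x)) \<longlongrightarrow> 0) (at 0)"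

text \<open>\<open>U\<close> is infinitely differentiable from \<open>(-\<delta>,\<delta>)\<close> to \<open>C\<^sup>2([0,L])\<close>; \<open>V n\<close> is its \<open>n\<close>-th derivative.\<close>

definition smooth_C2_curve :: "real \<Rightarrow> real \<Rightarrow> (real \<Rightarrow> real \<Rightarrow> real) \<Rightarrow> bool" where
  "smooth_C2_curve L \<delta> U \<longleftrightarrow>
     (\<exists>V :: nat \<Rightarrow> real \<Rightarrow> real \<Rightarrow> real.
        V 0 = U \<and>
        (\<forall>n. \<forall>y\<in>{-\<delta><..<\<delta>}. Ck_on 2 {0..L} (V n y) \<and> has_C2_derivative L (V n) (V (Suc n) y) y))"

text \<open>
  The tangent vector of the curve at \<open>0\<close> is \<open>(0, c cos(k\<pi>x/L))\<close> with \<open>c \<noteq> 0\<close>. The last conjunct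
  says that in a neighbourhood of \<open>(lam0, M)\<close> the solutions are exactly the points of the trivial
  branch and of the curve.
\<close>

definition pitchfork_curve ::
    "real \<Rightarrow> real \<Rightarrow> nat \<Rightarrow> real \<Rightarrow> real \<Rightarrow> (real \<Rightarrow> real) \<Rightarrow> (real \<Rightarrow> real \<Rightarrow> real) \<Rightarrow> bool" where
  "pitchfork_curve L M k lam0 \<delta> \<Lambda> U \<longleftrightarrow>
     0 < \<delta> \<and>
     (\<forall>n. Ck_on n {-\<delta><..<\<delta>} \<Lambda>) \<and> smooth_C2_curve L \<delta> U \<and>
     \<Lambda> 0 = lam0 \<and> deriv \<Lambda> 0 = 0 \<and> (\<forall>x\<in>{0..L}. U 0 x = M) \<and>
     (\<exists>c. c \<noteq> 0 \<and> has_C2_derivative L U (\<lambda>x. c * cos (real k * pi * x / L)) 0) \<and>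
     (\<forall>y\<in>{-\<delta><..<\<delta>}. is_solution L M (\<Lambda> y) (U y)) \<and>
     (\<forall>y\<in>{-\<delta><..<\<delta>}. y \<noteq> 0 \<longrightarrow> \<not> U y constant_on {0..L}) \<and>
     (\<exists>\<epsilon>>0. \<forall>lam u. near L M lam0 \<epsilon> lam u \<longrightarrow>
        (is_solution L M lam u \<longleftrightarrow>
           (\<forall>x\<in>{0..L}. u x = M) \<or>
           (\<exists>y\<in>{-\<delta><..<\<delta>}. lam = \<Lambda> y \<and> (\<forall>x\<in>{0..L}. u x = U y x))))"

definition supercritical_pitchfork :: "real \<Rightarrow> real \<Rightarrow> nat \<Rightarrow> real \<Rightarrow> bool" where
  "supercritical_pitchfork L M k lam0 \<longleftrightarrow>
     (\<exists>\<delta> \<Lambda> U. pitchfork_curve L M k lam0 \<delta> \<Lambda> U \<and> (\<forall>\<^sub>F y in at 0. \<Lambda> y > lam0))"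

definition subcritical_pitchfork :: "real \<Rightarrow> real \<Rightarrow> nat \<Rightarrow> real \<Rightarrow> bool" where
  "subcritical_pitchfork L M k lam0 \<longleftrightarrow>
     (\<exists>\<delta> \<Lambda> U. pitchfork_curve L M k lam0 \<delta> \<Lambda> U \<and> (\<forall>\<^sub>F y in at 0. \<Lambda> y < lam0))"

definition lambda_k :: "real \<Rightarrow> real \<Rightarrow> nat \<Rightarrow> real" where
  "lambda_k L M k = (real k)\<^sup>2 * pi\<^sup>2 / (L\<^sup>2 * deriv cubic_f M)"

definition L_star :: "real \<Rightarrow> nat \<Rightarrow> real" where
  "L_star M k = real k * pi / sqrt 2 * ((1 - 3 * M\<^sup>2) / sqrt (1 - 5 * M\<^sup>2))"

end

theory Submission
  imports Defs
begin

text \<open>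
  The equation has the first integral \<open>1 / sqrt (1 + u'\<^sup>2) - \<lambda> F(u) + \<mu> u\<close>. A small solution with
  \<open>u'(0) = 0\<close> oscillates between \<open>m - r\<close> and \<open>m + r\<close>, and the substitution \<open>u = m - r cos \<theta>\<close> turns the
  first integral into \<open>dx/d\<theta> = g(\<theta>; m, r, \<lambda>)\<close> with \<open>g\<close> smooth and positive up to \<open>r = 0\<close>, also for
  negative \<open>r\<close>. The Neumann condition at \<open>L\<close> and the mean value constraint thus become two scalar
  equations for the half period and the first moment of \<open>g\<close>. Solving them for \<open>m\<close> and \<open>\<lambda>\<close> by the
  implicit function theorem gives the branch, parametrized by \<open>r\<close>; the reflection
  \<open>\<theta> \<mapsto> \<pi> - \<theta>\<close> makes \<open>m\<close> and \<open>\<lambda>\<close> even in \<open>r\<close>, and the second derivative of the half period at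
  \<open>r = 0\<close> decides the direction. By uniqueness for the initial value problem every solution near
  the constant is of this form. If \<open>f'(M) \<le> 0\<close>, testing the equation with \<open>u - M\<close> and Poincare's
  inequality force \<open>u = M\<close>.
\<close>

section \<open>Smooth functions\<close>

text \<open>The nonlocal term never has to be solved for. If the turning values are m - r and m + r,
  the constant in the equation must be the chord slope m - m^3 - m r^2 of the potential F over
  [m - r, m + r]. Then F minus its chord carries the factor (r sin \<theta>)^2, which cancels
  against u'^2 and leaves a speed that is regular at the turning points and at r = 0. The unknowns
  are eliminated one at a time, so an implicit function theorem for one scalar unknown, proved from
  monotonicity and the intermediate value theorem, is enough. Smoothness of the branch as a curve in
  C^2 follows from joint smoothness in (x, r). For local exactness, a nearby solution supplies only
  u(0) and the mean of f(u). Since f'(M) > 0, the chord relation can be solved for m, and r = m -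
  u(0). Nothing so far fixes the number of half periods in [0, L]; it is pinned to k by the open
  condition |L - kT| < T on the half period T, which holds at the bifurcation point because L = kT
  there.\<close>

fun ckd :: "nat \<Rightarrow> 'a::real_normed_vector set \<Rightarrow> ('a \<Rightarrow> 'b::real_normed_vector) \<Rightarrow> bool" where
  "ckd 0 S f \<longleftrightarrow> continuous_on S f"
| "ckd (Suc n) S f \<longleftrightarrow>
     (\<exists>f'. (\<forall>x\<in>S. (f has_derivative f' x) (at x)) \<and> (\<forall>v. ckd n S (\<lambda>x. f' x v)))"

lemma ckd_SucD: "ckd (Suc n) S f \<Longrightarrow> ckd n S f"
proof (induction n arbitrary: f)
  case 0
  then show ?case
    by (auto intro!: continuous_at_imp_continuous_on dest: has_derivative_continuous)
next
  case (Suc n)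
  then obtain f' where f': "\<forall>x\<in>S. (f has_derivative f' x) (at x)"
    "\<And>v. ckd (Suc n) S (\<lambda>x. f' x v)" by (metis ckd.simps(2))
  then show ?case using Suc.IH by (metis ckd.simps(2))
qed

lemma ckd_cong:
  assumes "open S" "\<And>x. x \<in> S \<Longrightarrow> f x = g x" "ckd n S f"
  shows "ckd n S g"
proof (cases n)
  case 0
  then show ?thesis using assms by (auto cong: continuous_on_cong)
next
  case (Suc k)
  then obtain f' where f': "\<forall>x\<in>S. (f has_derivative f' x) (at x)"
    "\<And>v. ckd k S (\<lambda>x. f' x v)" using assms by auto
  have "\<forall>x\<in>S. (g has_derivative f' x) (at x)"
    using f'(1) assms(1,2) by (metis has_derivative_transform_within_open)
  then show ?thesis using f' Suc by auto
qed

lemma ckd_subset: "ckd n S f \<Longrightarrow> T \<subseteq> S \<Longrightarrow> ckd n T f"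
proof (induction n arbitrary: f)
  case 0
  then show ?case by (auto intro: continuous_on_subset)
next
  case (Suc n)
  then show ?case by (auto, meson subsetD)
qed

lemma ckd_const: "ckd n S (\<lambda>x. c)"
proof (induction n arbitrary: c)
  case (Suc n)
  show ?case by (auto intro!: exI[of _ "\<lambda>x v. 0"] Suc)
qed auto

lemma ckd_linear:
  assumes "bounded_linear f" shows "ckd n S f"
proof (cases n)
  case 0
  then show ?thesis using assms by (simp add: linear_continuous_on)
next
  case (Suc k)
  have "\<forall>x\<in>S. (f has_derivative f) (at x)"
    using assms bounded_linear_imp_has_derivative by blast
  then show ?thesis using Suc by (auto intro!: exI[of _ "\<lambda>x. f"] ckd_const)
qed

lemma ckd_add: "ckd n S f \<Longrightarrow> ckd n S g \<Longrightarrow> ckd n S (\<lambda>x. f x + g x)"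
proof (induction n arbitrary: f g)
  case 0
  then show ?case by (auto intro: continuous_intros)
next
  case (Suc n)
  obtain f' where f': "\<forall>x\<in>S. (f has_derivative f' x) (at x)" "\<And>v. ckd n S (\<lambda>x. f' x v)"
    using Suc.prems by auto
  obtain g' where g': "\<forall>x\<in>S. (g has_derivative g' x) (at x)" "\<And>v. ckd n S (\<lambda>x. g' x v)"
    using Suc.prems by auto
  show ?case unfolding ckd.simps
    by (rule exI[of _ "\<lambda>x v. f' x v + g' x v"])
       (use f' g' in \<open>auto intro!: has_derivative_add Suc.IH\<close>)
qed

lemma ckd_bilinear:
  assumes "bounded_bilinear bl"
  shows "ckd n S f \<Longrightarrow> ckd n S g \<Longrightarrow> ckd n S (\<lambda>x. bl (f x) (g x))"
proof (induction n arbitrary: f g)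
  case 0
  then show ?case by (simp add: bounded_bilinear.continuous_on[OF assms])
next
  case (Suc n)
  obtain f' where f': "\<forall>x\<in>S. (f has_derivative f' x) (at x)" "\<And>v. ckd n S (\<lambda>x. f' x v)"
    using Suc.prems by auto
  obtain g' where g': "\<forall>x\<in>S. (g has_derivative g' x) (at x)" "\<And>v. ckd n S (\<lambda>x. g' x v)"
    using Suc.prems by auto
  have "ckd n S f" "ckd n S g" using Suc.prems ckd_SucD by blast+
  then show ?case unfolding ckd.simps
    by (intro exI[of _ "\<lambda>x v. bl (f x) (g' x v) + bl (f' x v) (g x)"])
       (use f' g' in \<open>auto intro!: bounded_bilinear.FDERIV[OF assms] ckd_add Suc.IH\<close>)
qed

lemma ckd_sum: "(\<And>i. i \<in> I \<Longrightarrow> ckd n S (f i)) \<Longrightarrow> ckd n S (\<lambda>x. \<Sum>i\<in>I. f i x)"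
  by (induction I rule: infinite_finite_induct) (auto intro: ckd_const ckd_add)

lemma ckd_bounded_linear_comp:
  assumes "bounded_linear g" shows "ckd n S f \<Longrightarrow> ckd n S (\<lambda>x. g (f x))"
proof (induction n arbitrary: f)
  case 0
  then show ?case by (simp add: bounded_linear.continuous_on[OF assms])
next
  case (Suc n)
  obtain f' where f': "\<forall>x\<in>S. (f has_derivative f' x) (at x)" "\<And>v. ckd n S (\<lambda>x. f' x v)"
    using Suc.prems by auto
  then show ?case unfolding ckd.simps
    by (intro exI[of _ "\<lambda>x v. g (f' x v)"])
       (auto intro!: bounded_linear.has_derivative[OF assms] Suc.IH)
qed

lemma ckd_Pair: "ckd n S f \<Longrightarrow> ckd n S g \<Longrightarrow> ckd n S (\<lambda>x. (f x, g x))"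
proof (induction n arbitrary: f g)
  case 0
  then show ?case by (auto intro: continuous_intros)
next
  case (Suc n)
  obtain f' where f': "\<forall>x\<in>S. (f has_derivative f' x) (at x)" "\<And>v. ckd n S (\<lambda>x. f' x v)"
    using Suc.prems by auto
  obtain g' where g': "\<forall>x\<in>S. (g has_derivative g' x) (at x)" "\<And>v. ckd n S (\<lambda>x. g' x v)"
    using Suc.prems by auto
  show ?case unfolding ckd.simps
    by (rule exI[of _ "\<lambda>x v. (f' x v, g' x v)"])
       (use f' g' in \<open>auto intro!: has_derivative_Pair Suc.IH\<close>)
qed

text \<open>The induction hypothesis covers derivatives of \<open>g\<close> in fixed directions
  only, while the chain rule applies \<open>g' (f x)\<close> to the moving vector
  \<open>f' x v\<close>. Expanding that vector in \<open>Basis\<close> bridges the gap; hence the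
  Euclidean domain of \<open>g\<close>.\<close>

lemma ckd_compose:
  fixes g :: "'b::euclidean_space \<Rightarrow> 'c::real_normed_vector"
  shows "ckd n T g \<Longrightarrow> ckd n S f \<Longrightarrow> f ` S \<subseteq> T \<Longrightarrow> ckd n S (\<lambda>x. g (f x))"
proof (induction n arbitrary: g)
  case 0
  then show ?case using continuous_on_compose2 by fastforce
next
  case (Suc n)
  obtain f' where f': "\<forall>x\<in>S. (f has_derivative f' x) (at x)" "\<And>v. ckd n S (\<lambda>x. f' x v)"
    using Suc.prems by auto
  obtain g' where g': "\<forall>x\<in>T. (g has_derivative g' x) (at x)" "\<And>v. ckd n T (\<lambda>x. g' x v)"
    using Suc.prems by auto
  have fn: "ckd n S f" using Suc.prems ckd_SucD by blast
  define h where "h = (\<lambda>x v. \<Sum>b\<in>Basis. (f' x v \<bullet> b) *\<^sub>R g' (f x) b)"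
  have "(g \<circ> f has_derivative h x) (at x)" if "x \<in> S" for x
  proof -
    have lin: "linear (g' (f x))"
      using g'(1) Suc.prems(3) that has_derivative_linear by blast
    have "g' (f x) (f' x v) = h x v" for v
      unfolding h_def
      by (subst (1) euclidean_representation[symmetric, of "f' x v"])
         (simp add: linear_sum[OF lin] linear_cmul[OF lin])
    then have eq: "g' (f x) \<circ> f' x = h x" by auto
    show ?thesis
      using diff_chain_at[of f "f' x" x g "g' (f x)"] f'(1) g'(1) Suc.prems(3) that eq by auto
  qed
  moreover have "ckd n S (\<lambda>x. h x v)" for v
    unfolding h_def
    by (intro ckd_sum ckd_bilinear[OF bounded_bilinear_scaleR]
          ckd_bounded_linear_comp[OF bounded_linear_inner_left] f'(2) Suc.IH g'(2) fn Suc.prems(3))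
  ultimately show ?case by (auto simp: o_def)
qed

lemma ckd_Suc_realI:
  fixes f :: "real \<Rightarrow> real"
  assumes "\<And>x. x \<in> S \<Longrightarrow> (f has_real_derivative h x) (at x)" "ckd n S h"
  shows "ckd (Suc n) S f"
  unfolding ckd.simps
  using assms
  by (intro exI[of _ "\<lambda>x v. h x * v"])
     (auto simp: has_field_derivative_def intro!: ckd_bilinear[OF bounded_bilinear_mult] ckd_const)

text \<open>In \<open>ckd\<close> only derivatives in fixed directions are iterated. All orders thus
  stay within functions into the same space, and no operator-valued derivative has to be
  differentiated.\<close>

definition smooth :: "'a::real_normed_vector set \<Rightarrow> ('a \<Rightarrow> 'b::real_normed_vector) \<Rightarrow> bool" where
  "smooth S f \<longleftrightarrow> (\<forall>n. ckd n S f)"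

named_theorems smooth_intros

lemma smooth_subset: "smooth S f \<Longrightarrow> T \<subseteq> S \<Longrightarrow> smooth T f"
  unfolding smooth_def using ckd_subset by blast

lemma smooth_continuous_on: "smooth S f \<Longrightarrow> continuous_on S f"
  unfolding smooth_def using ckd.simps(1) by blast

lemma smooth_const [smooth_intros]: "smooth S (\<lambda>x. c)"
  by (simp add: smooth_def ckd_const)

lemma smooth_ident [smooth_intros]: "smooth S (\<lambda>x. x)"
  by (simp add: smooth_def ckd_linear)

lemma smooth_fst [smooth_intros]: "smooth S f \<Longrightarrow> smooth S (\<lambda>x. fst (f x))"
  by (simp add: smooth_def ckd_bounded_linear_comp[OF bounded_linear_fst])

lemma smooth_snd [smooth_intros]: "smooth S f \<Longrightarrow> smooth S (\<lambda>x. snd (f x))"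
  by (simp add: smooth_def ckd_bounded_linear_comp[OF bounded_linear_snd])

lemma smooth_Pair [smooth_intros]: "smooth S f \<Longrightarrow> smooth S g \<Longrightarrow> smooth S (\<lambda>x. (f x, g x))"
  by (simp add: smooth_def ckd_Pair)

lemma smooth_add [smooth_intros]: "smooth S f \<Longrightarrow> smooth S g \<Longrightarrow> smooth S (\<lambda>x. f x + g x)"
  by (simp add: smooth_def ckd_add)

lemma smooth_mult [smooth_intros]:
  fixes f g :: "_ \<Rightarrow> real"
  shows "smooth S f \<Longrightarrow> smooth S g \<Longrightarrow> smooth S (\<lambda>x. f x * g x)"
  by (simp add: smooth_def ckd_bilinear[OF bounded_bilinear_mult])

lemma smooth_minus [smooth_intros]: "smooth S f \<Longrightarrow> smooth S (\<lambda>x. - f x)"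
  by (simp add: smooth_def ckd_bounded_linear_comp[OF bounded_linear_minus[OF bounded_linear_ident]])

lemma smooth_diff [smooth_intros]: "smooth S f \<Longrightarrow> smooth S g \<Longrightarrow> smooth S (\<lambda>x. f x - g x)"
  using smooth_add[OF _ smooth_minus, of S f g] by simp

lemma smooth_power [smooth_intros]:
  fixes f :: "_ \<Rightarrow> real" shows "smooth S f \<Longrightarrow> smooth S (\<lambda>x. f x ^ n)"
  by (induction n) (auto intro: smooth_intros)

lemma smooth_compose:
  fixes g :: "'b::euclidean_space \<Rightarrow> 'c::real_normed_vector"
  shows "smooth T g \<Longrightarrow> smooth S f \<Longrightarrow> (\<And>x. x \<in> S \<Longrightarrow> f x \<in> T) \<Longrightarrow> smooth S (\<lambda>x. g (f x))"
  unfolding smooth_def using ckd_compose by blast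

lemma ckd_sin_cos: "ckd n UNIV (sin :: real \<Rightarrow> real) \<and> ckd n UNIV (cos :: real \<Rightarrow> real)"
proof (induction n)
  case (Suc n)
  have "ckd n UNIV (\<lambda>x::real. - sin x)"
    using Suc ckd_bounded_linear_comp[OF bounded_linear_minus[OF bounded_linear_ident]] by blast
  then show ?case
    using Suc by (auto intro!: ckd_Suc_realI derivative_eq_intros simp del: ckd.simps)
qed (auto intro: continuous_intros)

lemma smooth_sin [smooth_intros]: "smooth S f \<Longrightarrow> smooth S (\<lambda>x. sin (f x :: real))"
  by (rule smooth_compose[of UNIV sin]) (auto simp: smooth_def ckd_sin_cos)

lemma smooth_cos [smooth_intros]: "smooth S f \<Longrightarrow> smooth S (\<lambda>x. cos (f x :: real))"
  by (rule smooth_compose[of UNIV cos]) (auto simp: smooth_def ckd_sin_cos)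

text \<open>The derivative is a polynomial in \<open>inverse\<close> itself, so each order of
  differentiability yields the next.\<close>

lemma ckd_inverse: "ckd n (- {0}) (inverse :: real \<Rightarrow> real)"
proof (induction n)
  case 0
  then show ?case by (auto intro: continuous_intros)
next
  case (Suc n)
  have "ckd n (- {0}) (\<lambda>x::real. - (inverse x * inverse x))"
    by (intro ckd_bounded_linear_comp[OF bounded_linear_minus[OF bounded_linear_ident]]
        ckd_bilinear[OF bounded_bilinear_mult] Suc)
  then show ?case
    by (intro ckd_Suc_realI[where h="\<lambda>x. - (inverse x * inverse x)"])
       (auto intro!: derivative_eq_intros simp del: ckd.simps)
qed

lemma smooth_inverse [smooth_intros]:
  "smooth S f \<Longrightarrow> (\<And>x. x \<in> S \<Longrightarrow> f x \<noteq> 0) \<Longrightarrow> smooth S (\<lambda>x. inverse (f x :: real))"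
  by (rule smooth_compose[of "-{0}" inverse]) (auto simp: smooth_def ckd_inverse)

lemma smooth_divide [smooth_intros]:
  fixes f g :: "_ \<Rightarrow> real"
  shows "smooth S f \<Longrightarrow> smooth S g \<Longrightarrow> (\<And>x. x \<in> S \<Longrightarrow> g x \<noteq> 0) \<Longrightarrow> smooth S (\<lambda>x. f x / g x)"
  unfolding divide_inverse by (intro smooth_intros) auto

lemma ckd_sqrt: "ckd n {0<..} sqrt"
proof (induction n)
  case 0
  then show ?case by (auto intro: continuous_intros)
next
  case (Suc n)
  have "ckd n {0<..} (\<lambda>x::real. inverse (sqrt x) / 2)"
  proof -
    have "sqrt ` {0<..} \<subseteq> - {0}" by auto
    from ckd_bilinear[OF bounded_bilinear_mult ckd_compose[OF ckd_inverse Suc this]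
        ckd_const[of n _ "1/2"]]
    show ?thesis by simp
  qed
  then show ?case
    by (intro ckd_Suc_realI[where h="\<lambda>x. inverse (sqrt x) / 2"])
       (auto intro!: derivative_eq_intros simp del: ckd.simps simp: DERIV_real_sqrt)
qed

lemma smooth_sqrt [smooth_intros]:
  "smooth S f \<Longrightarrow> (\<And>x. x \<in> S \<Longrightarrow> 0 < f x) \<Longrightarrow> smooth S (\<lambda>x. sqrt (f x))"
  by (rule smooth_compose[of "{0<..}" sqrt]) (auto simp: smooth_def ckd_sqrt)

section \<open>Total derivatives of smooth maps, and integrals depending on a parameter\<close>

abbreviation fderiv :: "('a::real_normed_vector \<Rightarrow> 'b::real_normed_vector) \<Rightarrow> 'a \<Rightarrow> 'a \<Rightarrow> 'b" where
  "fderiv f x \<equiv> frechet_derivative f (at x)"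

lemma smooth_has_derivative:
  assumes "smooth S f" "x \<in> S"
  shows "(f has_derivative fderiv f x) (at x)"
proof -
  have "ckd (Suc 0) S f" using assms smooth_def by blast
  then show ?thesis using assms(2)
    by (auto simp: frechet_derivative_at[symmetric])
qed

lemma smooth_fderiv [smooth_intros]:
  assumes "open S" "smooth S f"
  shows "smooth S (\<lambda>x. fderiv f x v)"
  unfolding smooth_def
proof
  fix n
  have "ckd (Suc n) S f" using assms smooth_def by blast
  then obtain f' where f': "\<forall>x\<in>S. (f has_derivative f' x) (at x)" "ckd n S (\<lambda>x. f' x v)"
    by auto
  show "ckd n S (\<lambda>x. fderiv f x v)"
    by (rule ckd_cong[OF assms(1) _ f'(2)]) (use f' in \<open>auto simp: frechet_derivative_at[symmetric]\<close>)
qed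

lemma ckd_SucI:
  assumes "\<And>x. x \<in> S \<Longrightarrow> (f has_derivative f' x) (at x)" "\<And>v. ckd n S (\<lambda>x. f' x v)"
  shows "ckd (Suc n) S f"
  using assms by auto

lemma has_derivative_Pair_right:
  assumes "(F has_derivative F') (at (x, y))"
  shows "((\<lambda>y. F (x, y)) has_derivative (\<lambda>v. F' (0, v))) (at y)"
  by (rule has_derivative_compose[OF has_derivative_Pair[OF has_derivative_const has_derivative_ident] assms])

lemma has_derivative_Pair_left:
  assumes "(F has_derivative F') (at (x, y))"
  shows "((\<lambda>x. F (x, y)) has_derivative (\<lambda>v. F' (v, 0))) (at x)"
  by (rule has_derivative_compose[OF has_derivative_Pair[OF has_derivative_ident has_derivative_const] assms])

text \<open>The Leibniz rule asks for a continuous field of bounded linear maps, whereas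
  \<open>smooth\<close> speaks of fixed directions. \<open>D\<close> packages the partial
  derivatives as such maps, and its continuity is checked on basis vectors.\<close>

lemma has_derivative_param_integral:
  fixes G :: "real \<times> 'a::euclidean_space \<Rightarrow> real"
  assumes S: "open S" and G: "smooth (UNIV \<times> S) G" and p: "p \<in> S"
  shows "((\<lambda>p. integral {a..b} (\<lambda>s. G (s, p))) has_derivative
           (\<lambda>v. integral {a..b} (\<lambda>s. fderiv G (s, p) (0, v)))) (at p)"
proof -
  obtain e where e: "e > 0" "ball p e \<subseteq> S" using S p openE by blast
  have op: "open (UNIV \<times> S :: (real \<times> 'a) set)" using S by (intro open_Times) auto
  define D where "D = (\<lambda>p s. Blinfun (\<lambda>v. fderiv G (s, p) (0, v)))"
  have der: "((\<lambda>p. G (s, p)) has_derivative (\<lambda>v. fderiv G (s, p) (0, v))) (at p)"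
    if "p \<in> S" for p s
  proof -
    have "(G has_derivative fderiv G (s, p)) (at (s, p))"
      using smooth_has_derivative[OF G, of "(s, p)"] that by auto
    then show ?thesis by (rule has_derivative_Pair_right)
  qed
  have D: "blinfun_apply (D p s) = (\<lambda>v. fderiv G (s, p) (0, v))" if "p \<in> S" for p s
    unfolding D_def using der[OF that, of s]
    by (intro bounded_linear_Blinfun_apply has_derivative_bounded_linear)
  have cont: "continuous_on (S \<times> {a..b}) (\<lambda>(p, s). D p s)"
  proof (rule continuous_on_blinfun_componentwise)
    fix i :: 'a assume "i \<in> Basis"
    have "continuous_on (UNIV \<times> S) (\<lambda>q. fderiv G q (0, i))"
      by (intro smooth_continuous_on smooth_intros op G)
    then have "continuous_on (S \<times> {a..b}) (\<lambda>x. fderiv G (snd x, fst x) (0, i))"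
      by (rule continuous_on_compose2) (auto intro!: continuous_intros)
    then show "continuous_on (S \<times> {a..b}) (\<lambda>x. blinfun_apply (case x of (p, s) \<Rightarrow> D p s) i)"
      by (rule continuous_on_eq) (auto simp: D)
  qed
  have contG: "continuous_on {a..b} (\<lambda>s. G (s, p))" if "p \<in> S" for p
    by (rule continuous_on_compose2[OF smooth_continuous_on[OF G]])
       (use that in \<open>auto intro!: continuous_intros\<close>)
  have "((\<lambda>p. integral (cbox a b) (\<lambda>s. G (s, p))) has_derivative
          blinfun_apply (integral (cbox a b) (D p))) (at p within ball p e)"
  proof (rule leibniz_rule[where fx=D])
    show "((\<lambda>p. G (s, p)) has_derivative blinfun_apply (D x s)) (at x within ball p e)"
      if "x \<in> ball p e" "s \<in> cbox a b" for x s
    proof -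
      have "x \<in> S" using that e by auto
      then show ?thesis using der[of x s] D[of x s] by (simp add: has_derivative_at_withinI)
    qed
    show "(\<lambda>s. G (s, x)) integrable_on cbox a b" if "x \<in> ball p e" for x
      using contG[of x] that e by (auto intro!: integrable_continuous_interval)
    show "continuous_on (ball p e \<times> cbox a b) (\<lambda>(x, t). D x t)"
      by (rule continuous_on_subset[OF cont]) (use e in auto)
  qed (use e in auto)
  moreover have "blinfun_apply (integral (cbox a b) (D p)) =
      (\<lambda>v. integral {a..b} (\<lambda>s. fderiv G (s, p) (0, v)))"
  proof
    fix v
    have "continuous_on {a..b} (D p)"
      using continuous_on_compose2[OF cont
          continuous_on_Pair[where f="\<lambda>s. p" and s="{a..b}", OF continuous_on_const continuous_on_id]] p
      by auto
    then have "D p integrable_on cbox a b" by (auto intro: integrable_continuous_interval)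
    then have "blinfun_apply (integral (cbox a b) (D p)) v = integral (cbox a b) (\<lambda>s. blinfun_apply (D p s) v)"
      by (rule blinfun_apply_integral)
    then show "blinfun_apply (integral (cbox a b) (D p)) v = integral {a..b} (\<lambda>s. fderiv G (s, p) (0, v))"
      using D[OF p] by simp
  qed
  ultimately show ?thesis
    using e by (simp add: at_within_ball)
qed

lemma ckd_param_integral:
  fixes G :: "real \<times> 'a::euclidean_space \<Rightarrow> real"
  assumes "open S"
  shows "smooth (UNIV \<times> S) G \<Longrightarrow> ckd n S (\<lambda>p. integral {a..b} (\<lambda>s. G (s, p)))"
proof (induction n arbitrary: G)
  case 0
  then show ?case
    using has_derivative_param_integral[OF assms 0]
    by (auto intro!: continuous_at_imp_continuous_on has_derivative_continuous)
next
  case (Suc n)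
  have op: "open (UNIV \<times> S :: (real \<times> 'a) set)" using assms by (intro open_Times) auto
  show ?case
    by (rule ckd_SucI[OF has_derivative_param_integral[OF assms Suc.prems]])
       (auto intro!: Suc.IH smooth_intros op Suc.prems)
qed

lemma smooth_param_integral:
  fixes G :: "real \<times> 'a::euclidean_space \<Rightarrow> real"
  assumes "open S" "smooth (UNIV \<times> S) G"
  shows "smooth S (\<lambda>p. integral {a..b} (\<lambda>s. G (s, p)))"
  using ckd_param_integral[OF assms] smooth_def by blast

section \<open>Scalar implicit functions\<close>

lemma has_integral_real_derivative:
  fixes F f :: "real \<Rightarrow> real"
  assumes "a \<le> b" "\<And>x. (F has_real_derivative f x) (at x)"
  shows "(f has_integral F b - F a) {a..b}"
  using assms by (intro fundamental_theorem_of_calculus)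
    (auto simp: has_real_derivative_iff_has_vector_derivative[symmetric] intro: has_field_derivative_at_within)

lemma mvt_between:
  fixes f :: "real \<Rightarrow> real"
  assumes "\<And>x. min a b \<le> x \<Longrightarrow> x \<le> max a b \<Longrightarrow> (f has_real_derivative f' x) (at x)"
  shows "\<exists>\<xi>. min a b \<le> \<xi> \<and> \<xi> \<le> max a b \<and> f b - f a = (b - a) * f' \<xi>"
proof -
  consider "a = b" | "a < b" | "b < a" by linarith
  then show ?thesis
  proof cases
    case 2
    have "\<exists>z>a. z < b \<and> f b - f a = (b - a) * f' z" by (rule MVT2[OF 2]) (use assms 2 in auto)
    then obtain z where "z > a" "z < b" "f b - f a = (b - a) * f' z" by blast
    then show ?thesis using 2 by (intro exI[of _ z]) auto
  next
    case 3
    have "\<exists>z>b. z < a \<and> f a - f b = (a - b) * f' z" by (rule MVT2[OF 3]) (use assms 3 in auto)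
    then obtain z where "z > b" "z < a" "f a - f b = (a - b) * f' z" by blast
    then show ?thesis using 3 by (intro exI[of _ z]) (auto simp: algebra_simps)
  qed auto
qed

lemma has_derivative_imp_real: "(f has_derivative D) (at x) \<Longrightarrow> (f has_real_derivative D 1) (at x)"
proof -
  assume D: "(f has_derivative D) (at x)"
  have "D v = D 1 * v" for v using linear_cmul[OF has_derivative_linear[OF D], of v 1] by simp
  then have "D = (*) (D 1)" by blast
  then show ?thesis using D by (simp add: has_field_derivative_def)
qed

lemma has_real_derivative_Pair_left:
  fixes F :: "real \<times> 'a::real_normed_vector \<Rightarrow> real"
  assumes "(F has_derivative F') (at (x, y))"
  shows "((\<lambda>x. F (x, y)) has_real_derivative F' (1, 0)) (at x)"
proof -
  have "F' (v, 0) = F' (1, 0) * v" for v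
    using linear_cmul[OF has_derivative_linear[OF assms], of v "(1, 0)"] by (simp add: mult.commute)
  then have "(\<lambda>v. F' (v, 0)) = (*) (F' (1, 0))" by blast
  then show ?thesis
    using has_derivative_Pair_left[OF assms] by (simp only: has_field_derivative_def)
qed

lemma has_real_derivative_Pair_right:
  fixes F :: "'a::real_normed_vector \<times> real \<Rightarrow> real"
  assumes "(F has_derivative F') (at (x, y))"
  shows "((\<lambda>y. F (x, y)) has_real_derivative F' (0, 1)) (at y)"
proof -
  have "F' (0, v) = F' (0, 1) * v" for v
    using linear_cmul[OF has_derivative_linear[OF assms], of v "(0, 1)"] by (simp add: mult.commute)
  then have "(\<lambda>v. F' (0, v)) = (*) (F' (0, 1))" by blast
  then show ?thesis
    using has_derivative_Pair_right[OF assms] by (simp only: has_field_derivative_def)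
qed

text \<open>A product rule in which \<open>q\<close> only has a limit at \<open>e\<close>: because
  \<open>N e = 0\<close>, the variation of \<open>q\<close> enters as a term of smaller order. It
  serves quotients whose denominator is a derivative at an intermediate point, of which only
  convergence is known.\<close>

lemma has_derivative_mult_vanishing:
  fixes N q :: "'a::real_normed_vector \<Rightarrow> real"
  assumes N: "(N has_derivative D) (at e)" "N e = 0" and q: "(q \<longlongrightarrow> q0) (at e)"
  shows "((\<lambda>x. N x * q x) has_derivative (\<lambda>v. D v * q0)) (at e)"
  unfolding has_derivative_at_within
proof
  have bl: "bounded_linear D" using N has_derivative_bounded_linear by blast
  then show "bounded_linear (\<lambda>v. D v * q0)" by (rule bounded_linear_mult_const)
  obtain K where K: "\<And>v. norm (D v) \<le> norm v * K" using bl bounded_linear.bounded by blast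
  have 1: "((\<lambda>y. q y * (((N y - N e) - D (y - e)) /\<^sub>R norm (y - e))) \<longlongrightarrow> q0 * 0) (at e)"
    using N(1) unfolding has_derivative_at_within by (intro tendsto_mult q) auto
  have 2: "((\<lambda>y. (q y - q0) * (D (y - e) / norm (y - e))) \<longlongrightarrow> 0) (at e)"
  proof (rule Lim_null_comparison)
    have "norm ((q y - q0) * (D (y - e) / norm (y - e))) \<le> \<bar>q y - q0\<bar> * \<bar>K\<bar>" if "y \<noteq> e" for y
    proof -
      have "norm (y - e) > 0" using that by simp
      moreover have "\<bar>D (y - e)\<bar> \<le> norm (y - e) * \<bar>K\<bar>"
        using K[of "y - e"] by (smt (verit) mult_left_mono norm_ge_zero real_norm_def)
      ultimately have "\<bar>D (y - e) / norm (y - e)\<bar> \<le> \<bar>K\<bar>"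
        by (simp add: field_simps)
      then show ?thesis unfolding real_norm_def abs_mult by (rule mult_left_mono) auto
    qed
    then show "\<forall>\<^sub>F y in at e. norm ((q y - q0) * (D (y - e) / norm (y - e))) \<le> \<bar>q y - q0\<bar> * \<bar>K\<bar>"
      by (auto simp: eventually_at_filter)
    have "((\<lambda>y. \<bar>q y - q0\<bar> * \<bar>K\<bar>) \<longlongrightarrow> \<bar>q0 - q0\<bar> * \<bar>K\<bar>) (at e)"
      by (intro tendsto_intros q)
    then show "((\<lambda>y. \<bar>q y - q0\<bar> * \<bar>K\<bar>) \<longlongrightarrow> 0) (at e)" by simp
  qed
  show "((\<lambda>y. (N y * q y - N e * q e - D (y - e) * q0) /\<^sub>R norm (y - e)) \<longlongrightarrow> 0) (at e)"
  proof -
    have "(N y * q y - N e * q e - D (y - e) * q0) /\<^sub>R norm (y - e) =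
        q y * (((N y - N e) - D (y - e)) /\<^sub>R norm (y - e)) + (q y - q0) * (D (y - e) / norm (y - e))" for y
      using N(2) by (simp add: divide_inverse algebra_simps)
    then show ?thesis using tendsto_add[OF 1 2] by simp
  qed
qed

text \<open>Positive slope in the single unknown \<open>t\<close> on the whole of
  \<open>J \<times> T\<close> makes \<open>F\<close> strictly increasing in \<open>t\<close>, so
  zeros are unique and comparison with a zero is decided by a sign. \<open>J\<close> is the whole
  line when the position is inverted, and a small interval in the local theorem.\<close>

locale implicit =
  fixes F :: "real \<times> 'a::euclidean_space \<Rightarrow> real" and J T
  assumes J: "open J" "convex J" and T: "open T"
    and smooth_Phi: "smooth (J \<times> T) F"
    and pos: "\<And>t e. t \<in> J \<Longrightarrow> e \<in> T \<Longrightarrow> fderiv F (t, e) (1, 0) > 0"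
begin

lemma open_JT: "open (J \<times> T)"
  using J T by (intro open_Times)

lemma has_real_derivative_fst:
  assumes "t \<in> J" "e \<in> T"
  shows "((\<lambda>t. F (t, e)) has_real_derivative fderiv F (t, e) (1, 0)) (at t)"
  using assms by (intro has_real_derivative_Pair_left smooth_has_derivative[OF smooth_Phi]) auto

lemma strict_mono:
  assumes "t \<in> J" "t' \<in> J" "e \<in> T" "t < t'"
  shows "F (t, e) < F (t', e)"
proof (rule DERIV_pos_imp_increasing[OF assms(4)])
  fix x assume "t \<le> x" "x \<le> t'"
  then have "x \<in> J" using J(2) assms
    by (auto intro: mem_is_interval_1_I[OF J(2)[folded is_interval_convex_1]])
  then show "\<exists>y. ((\<lambda>t. F (t, e)) has_real_derivative y) (at x) \<and> 0 < y"
    using has_real_derivative_fst pos assms by blast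
qed

lemma less_iff:
  assumes "t \<in> J" "t' \<in> J" "e \<in> T" shows "F (t, e) < F (t', e) \<longleftrightarrow> t < t'"
  using strict_mono assms by (metis less_asym less_linear)

text \<open>No regularity of \<open>h\<close> is assumed. A choice of zeros inside \<open>J\<close>
  is continuous by comparing signs, differentiable by the mean value theorem, and then smooth
  because its derivative is a smooth expression in \<open>h\<close> itself.\<close>

lemma smooth_solution:
  assumes h: "\<And>e. e \<in> T \<Longrightarrow> h e \<in> J" "\<And>e. e \<in> T \<Longrightarrow> F (h e, e) = 0"
  shows "smooth T h"
proof -
  have evT: "\<forall>\<^sub>F e' in at e. e' \<in> T" if "e \<in> T" for e
    using T that by (simp add: eventually_at_in_open')
  have contPhi: "((\<lambda>e'. F (t, e')) \<longlongrightarrow> F (t, e)) (at e)" if "t \<in> J" "e \<in> T" for t e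
  proof -
    have "isCont F (t, e)"
      using smooth_continuous_on[OF smooth_Phi] open_JT that by (simp add: continuous_on_eq_continuous_at)
    then show ?thesis by (rule isCont_tendsto_compose) (intro tendsto_intros)
  qed
  have cont: "(h \<longlongrightarrow> h e) (at e)" if e: "e \<in> T" for e
  proof (rule tendstoI)
    fix \<epsilon> :: real assume "\<epsilon> > 0"
    obtain d where d: "d > 0" "cball (h e) d \<subseteq> J" using J(1) h(1)[OF e] open_contains_cball by blast
    define \<epsilon>' where "\<epsilon>' = min \<epsilon> d / 2"
    have e': "\<epsilon>' > 0" "\<epsilon>' < \<epsilon>" "\<epsilon>' < d" using \<open>\<epsilon> > 0\<close> d by (auto simp: \<epsilon>'_def)
    have in_J: "h e - \<epsilon>' \<in> J" "h e + \<epsilon>' \<in> J" using d e' by (auto simp: subset_iff dist_real_def)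
    have "F (h e - \<epsilon>', e) < 0" "F (h e + \<epsilon>', e) > 0"
      using strict_mono[OF in_J(1) h(1)[OF e] e] strict_mono[OF h(1)[OF e] in_J(2) e] e' h(2)[OF e] by auto
    then have "\<forall>\<^sub>F e' in at e. F (h e - \<epsilon>', e') < 0" "\<forall>\<^sub>F e' in at e. F (h e + \<epsilon>', e') > 0"
      using order_tendstoD[OF contPhi] in_J e by blast+
    then show "\<forall>\<^sub>F e' in at e. dist (h e') (h e) < \<epsilon>"
      using evT[OF e]
    proof eventually_elim
      case (elim x)
      have "h e - \<epsilon>' < h x" "h x < h e + \<epsilon>'"
        using less_iff[OF in_J(1) h(1)[OF elim(3)] elim(3)] less_iff[OF h(1)[OF elim(3)] in_J(2) elim(3)]
          elim h(2)[OF elim(3)] by auto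
      then show ?case using e' by (auto simp: dist_real_def)
    qed
  qed
  \<comment> \<open>Implicit differentiation predicts this derivative. It is kept as a function of
    both variables so that the regularity of \<open>h\<close> passes to its derivative by
    composition.\<close>
  define d where "d = (\<lambda>v q. - fderiv F q (0, v) / fderiv F q (1, 0))"
  have der: "(h has_derivative (\<lambda>v. d v (h e, e))) (at e)" if e: "e \<in> T" for e
  proof -
    have "\<exists>\<xi>. \<bar>\<xi> - h e\<bar> \<le> \<bar>h e' - h e\<bar> \<and> \<xi> \<in> J \<and>
        F (h e', e') - F (h e, e') = (h e' - h e) * fderiv F (\<xi>, e') (1, 0)" if e': "e' \<in> T" for e'
    proof -
      have m: "min (h e) (h e') \<in> J" "max (h e) (h e') \<in> J"
        using h(1)[OF e] h(1)[OF e'] by (simp_all add: min_def max_def)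
      have seg: "x \<in> J" if "min (h e) (h e') \<le> x" "x \<le> max (h e) (h e')" for x
        using mem_is_interval_1_I[OF J(2)[folded is_interval_convex_1] m that] .
      have "\<exists>z. min (h e) (h e') \<le> z \<and> z \<le> max (h e) (h e') \<and>
          F (h e', e') - F (h e, e') = (h e' - h e) * fderiv F (z, e') (1, 0)"
        by (rule mvt_between, rule has_real_derivative_fst[OF seg e'])
      then obtain z where z: "min (h e) (h e') \<le> z" "z \<le> max (h e) (h e')"
          "F (h e', e') - F (h e, e') = (h e' - h e) * fderiv F (z, e') (1, 0)" by blast
      then have "\<bar>z - h e\<bar> \<le> \<bar>h e' - h e\<bar>" by (auto simp: min_def max_def split: if_splits)
      then show ?thesis using z(3) seg[OF z(1,2)] by blast
    qed
    \<comment> \<open>The intermediate points are chosen without any continuity. They are squeezed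
      towards \<open>h e\<close> by \<open>h e'\<close>, which is enough for the limit of the
      quotient.\<close>
    then obtain \<xi> where \<xi>: "\<And>e'. e' \<in> T \<Longrightarrow> \<bar>\<xi> e' - h e\<bar> \<le> \<bar>h e' - h e\<bar> \<and> \<xi> e' \<in> J \<and>
        F (h e', e') - F (h e, e') = (h e' - h e) * fderiv F (\<xi> e', e') (1, 0)" by metis
    have "((\<lambda>e'. \<xi> e' - h e) \<longlongrightarrow> 0) (at e)"
    proof (rule Lim_null_comparison)
      show "\<forall>\<^sub>F e' in at e. norm (\<xi> e' - h e) \<le> \<bar>h e' - h e\<bar>"
        using evT[OF e] by eventually_elim (use \<xi> in auto)
      have "((\<lambda>e'. \<bar>h e' - h e\<bar>) \<longlongrightarrow> \<bar>h e - h e\<bar>) (at e)"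
        by (intro tendsto_intros cont e)
      then show "((\<lambda>e'. \<bar>h e' - h e\<bar>) \<longlongrightarrow> 0) (at e)" by simp
    qed
    then have \<xi>lim: "(\<xi> \<longlongrightarrow> h e) (at e)" by (simp add: LIM_zero_iff)
    have "isCont (\<lambda>q. fderiv F q (1, 0)) (h e, e)"
    proof -
      have "continuous_on (J \<times> T) (\<lambda>q. fderiv F q (1, 0))"
        by (intro smooth_continuous_on smooth_intros smooth_Phi open_JT)
      then show ?thesis using open_JT h(1)[OF e] e by (simp add: continuous_on_eq_continuous_at)
    qed
    then have "((\<lambda>e'. fderiv F (\<xi> e', e') (1, 0)) \<longlongrightarrow> fderiv F (h e, e) (1, 0)) (at e)"
      by (rule isCont_tendsto_compose) (intro tendsto_intros \<xi>lim)
    then have qlim: "((\<lambda>e'. 1 / fderiv F (\<xi> e', e') (1, 0)) \<longlongrightarrow> 1 / fderiv F (h e, e) (1, 0)) (at e)"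
      using pos[OF h(1)[OF e] e] by (intro tendsto_intros) auto
    have "(F has_derivative fderiv F (h e, e)) (at (h e, e))"
      using smooth_has_derivative[OF smooth_Phi, of "(h e, e)"] e h(1)[OF e] by auto
    then have "((\<lambda>e'. F (h e, e')) has_derivative (\<lambda>v. fderiv F (h e, e) (0, v))) (at e)"
      by (rule has_derivative_Pair_right)
    then have "((\<lambda>e'. - F (h e, e')) has_derivative (\<lambda>v. - fderiv F (h e, e) (0, v))) (at e)"
      by (rule has_derivative_minus)
    from has_derivative_mult_vanishing[OF this _ qlim]
    have "((\<lambda>e'. - F (h e, e') * (1 / fderiv F (\<xi> e', e') (1, 0))) has_derivative (\<lambda>v. d v (h e, e))) (at e)"
      using h(2)[OF e] by (simp add: d_def)
    from has_derivative_add[OF has_derivative_const this, of "h e"]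
    have "((\<lambda>e'. h e + (- F (h e, e') * (1 / fderiv F (\<xi> e', e') (1, 0)))) has_derivative (\<lambda>v. d v (h e, e))) (at e)"
      by simp
    then show ?thesis
    proof (rule has_derivative_transform_within_open[OF _ T e])
      fix e' assume e': "e' \<in> T"
      have "- F (h e, e') = (h e' - h e) * fderiv F (\<xi> e', e') (1, 0)" "fderiv F (\<xi> e', e') (1, 0) > 0"
        using \<xi>[OF e'] pos[of "\<xi> e'" e'] e' h(2)[OF e'] by auto
      then have "h e' - h e = - F (h e, e') / fderiv F (\<xi> e', e') (1, 0)"
        by (simp add: eq_divide_eq)
      then show "h e + - F (h e, e') * (1 / fderiv F (\<xi> e', e') (1, 0)) = h e'" by simp
    qed
  qed
  have sd: "smooth (J \<times> T) (d v)" for v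
  proof -
    have "fderiv F q (1, 0) \<noteq> 0" if "q \<in> J \<times> T" for q
      using pos[of "fst q" "snd q"] that by auto
    then show ?thesis unfolding d_def by (intro smooth_intros open_JT smooth_Phi)
  qed
  have "ckd n T h" for n
  proof (induction n)
    case 0
    show ?case by (auto intro!: continuous_at_imp_continuous_on has_derivative_continuous[OF der])
  next
    case (Suc n)
    have "ckd n T (\<lambda>e. d v (h e, e))" for v
      by (rule ckd_compose[of n "J \<times> T"])
         (use sd h(1) ckd_Pair[OF Suc ckd_linear[OF bounded_linear_ident]] in \<open>auto simp: smooth_def\<close>)
    then show ?case using der by (intro ckd_SucI[where f'="\<lambda>e v. d v (h e, e)"]) auto
  qed
  then show ?thesis by (simp add: smooth_def)
qed

end

text \<open>The last conclusion, on signs, is what later decides the direction of the bifurcation: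
  the sign of the equation at the fixed value \<open>lam0\<close> tells on which side the solution
  lies.\<close>

lemma implicit_function:
  fixes F :: "real \<times> 'a::euclidean_space \<Rightarrow> real"
  assumes S: "open S" and F: "smooth S F" and in_S: "(t0, e0) \<in> S"
    and zero: "F (t0, e0) = 0" and pos: "fderiv F (t0, e0) (1, 0) > 0"
  obtains \<eta> \<rho> h where "0 < \<eta>" "0 < \<rho>" "{t0-\<eta><..<t0+\<eta>} \<times> ball e0 \<rho> \<subseteq> S"
    "smooth (ball e0 \<rho>) h" "h e0 = t0"
    "\<And>e. e \<in> ball e0 \<rho> \<Longrightarrow> h e \<in> {t0-\<eta><..<t0+\<eta>}"
    "\<And>t e. t \<in> {t0-\<eta><..<t0+\<eta>} \<Longrightarrow> e \<in> ball e0 \<rho> \<Longrightarrow> F (t, e) = 0 \<longleftrightarrow> t = h e"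
    "\<And>t e. t \<in> {t0-\<eta><..<t0+\<eta>} \<Longrightarrow> e \<in> ball e0 \<rho> \<Longrightarrow> F (t, e) < 0 \<longleftrightarrow> t < h e"
proof -
  define S' where "S' = S \<inter> (\<lambda>q. fderiv F q (1, 0)) -` {0<..}"
  have "open S'" unfolding S'_def
    by (rule continuous_open_preimage) (auto intro!: smooth_continuous_on smooth_intros S F)
  moreover have "(t0, e0) \<in> S'" using in_S pos by (simp add: S'_def)
  ultimately obtain A B where AB: "open A" "open B" "t0 \<in> A" "e0 \<in> B" "A \<times> B \<subseteq> S'"
    using open_prod_elim by (metis SigmaE2)
  then obtain d where d: "d > 0" "ball t0 d \<subseteq> A" using openE by blast
  \<comment> \<open>Halving keeps the closed interval within distance \<open>\<eta>\<close> of
    \<open>t0\<close> inside the region of positive slope, so that its endpoints may be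
    used.\<close>
  define \<eta> where "\<eta> = d / 2"
  have \<eta>: "\<eta> > 0" "\<eta> < d" using d by (auto simp: \<eta>_def)
  interpret I: implicit F "ball t0 d" B
  proof
    show "smooth (ball t0 d \<times> B) F"
      by (rule smooth_subset[OF F]) (use AB d in \<open>auto simp: S'_def\<close>)
    show "fderiv F (t, e) (1, 0) > 0" if "t \<in> ball t0 d" "e \<in> B" for t e
    proof -
      have "(t, e) \<in> S'" using that AB(5) d(2) by blast
      then show ?thesis by (simp add: S'_def)
    qed
  qed (use AB in auto)
  have inJ: "t0 - \<eta> \<in> ball t0 d" "t0 + \<eta> \<in> ball t0 d" "t0 \<in> ball t0 d" using \<eta> by (auto simp: dist_real_def)
  have sgn: "F (t0 - \<eta>, e0) < 0" "F (t0 + \<eta>, e0) > 0"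
    using I.strict_mono[OF inJ(1,3) AB(4)] I.strict_mono[OF inJ(3,2) AB(4)] \<eta> zero by auto
  have cont2: "continuous_on B (\<lambda>e. F (t, e))" if "t \<in> ball t0 d" for t
    by (rule continuous_on_compose2[OF smooth_continuous_on[OF I.smooth_Phi]])
       (use that in \<open>auto intro!: continuous_intros\<close>)
  \<comment> \<open>The parameters for which \<open>F\<close> still has opposite signs at the two
    ends, so that a zero lies between them.\<close>
  define B' where "B' = (B \<inter> (\<lambda>e. F (t0 - \<eta>, e)) -` {..<0}) \<inter> (B \<inter> (\<lambda>e. F (t0 + \<eta>, e)) -` {0<..})"
  have "open B'" unfolding B'_def
    by (intro open_Int continuous_open_preimage cont2 inJ AB) auto
  moreover have "e0 \<in> B'" using sgn AB by (simp add: B'_def)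
  ultimately obtain \<rho> where \<rho>: "\<rho> > 0" "ball e0 \<rho> \<subseteq> B'" using openE by blast
  have J: "{t0-\<eta><..<t0+\<eta>} \<subseteq> ball t0 d" using \<eta> by (auto simp: dist_real_def)
  have ex: "\<exists>t\<in>{t0-\<eta><..<t0+\<eta>}. F (t, e) = 0" if "e \<in> ball e0 \<rho>" for e
  proof -
    have e: "e \<in> B" "F (t0 - \<eta>, e) < 0" "F (t0 + \<eta>, e) > 0" using that \<rho> by (auto simp: B'_def)
    have "\<exists>x\<ge>t0 - \<eta>. x \<le> t0 + \<eta> \<and> F (x, e) = 0"
      using \<eta> e by (intro IVT)
        (auto intro!: DERIV_isCont[OF I.has_real_derivative_fst] simp: dist_real_def)
    then obtain x where "t0 - \<eta> \<le> x" "x \<le> t0 + \<eta>" "F (x, e) = 0" by blast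
    then show ?thesis using e by (intro bexI[of _ x]) (auto simp: less_le)
  qed
  define h where "h = (\<lambda>e. SOME t. t \<in> {t0-\<eta><..<t0+\<eta>} \<and> F (t, e) = 0)"
  have h: "h e \<in> {t0-\<eta><..<t0+\<eta>} \<and> F (h e, e) = 0" if "e \<in> ball e0 \<rho>" for e
    unfolding h_def by (rule someI_ex) (use ex[OF that] in blast)
  interpret I2: implicit F "{t0-\<eta><..<t0+\<eta>}" "ball e0 \<rho>"
  proof
    have "ball e0 \<rho> \<subseteq> B" using \<rho> by (auto simp: B'_def)
    then show "smooth ({t0-\<eta><..<t0+\<eta>} \<times> ball e0 \<rho>) F"
      by (intro smooth_subset[OF I.smooth_Phi] Sigma_mono J)
    show "fderiv F (t, e) (1, 0) > 0" if "t \<in> {t0-\<eta><..<t0+\<eta>}" "e \<in> ball e0 \<rho>" for t e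
      using I.pos that J \<open>ball e0 \<rho> \<subseteq> B\<close> by blast
  qed auto
  have less: "F (t, e) < 0 \<longleftrightarrow> t < h e" if "t \<in> {t0-\<eta><..<t0+\<eta>}" "e \<in> ball e0 \<rho>" for t e
    using I2.less_iff[OF that(1) _ that(2), of "h e"] h[OF that(2)] by auto
  have gr: "F (t, e) > 0 \<longleftrightarrow> t > h e" if "t \<in> {t0-\<eta><..<t0+\<eta>}" "e \<in> ball e0 \<rho>" for t e
    using I2.less_iff[OF _ that(1) that(2), of "h e"] h[OF that(2)] by auto
  have eq: "F (t, e) = 0 \<longleftrightarrow> t = h e" if "t \<in> {t0-\<eta><..<t0+\<eta>}" "e \<in> ball e0 \<rho>" for t e
    using less[OF that] gr[OF that] by (metis less_irrefl linorder_less_linear)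
  show ?thesis
  proof
    show "{t0-\<eta><..<t0+\<eta>} \<times> ball e0 \<rho> \<subseteq> S"
    proof -
      have "ball e0 \<rho> \<subseteq> B" using \<rho> by (auto simp: B'_def)
      then have "{t0-\<eta><..<t0+\<eta>} \<times> ball e0 \<rho> \<subseteq> A \<times> B" using J d(2) by blast
      then show ?thesis using AB(5) by (auto simp: S'_def)
    qed
    show "smooth (ball e0 \<rho>) h" by (rule I2.smooth_solution) (use h in auto)
    show "h e0 = t0" using eq[of t0 e0] zero \<eta> \<rho> by auto
    show "h e \<in> {t0-\<eta><..<t0+\<eta>}" if "e \<in> ball e0 \<rho>" for e using h[OF that] by blast
  qed (fact \<eta>(1) \<rho>(1) less eq)+
qed

text \<open>Write \<open>W (z, y) - W (a, y)\<close> as the integral of \<open>Wx\<close> from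
  \<open>a\<close> to \<open>z\<close>, with \<open>a\<close> to the left of \<open>x\<close>.
  Differentiate it in \<open>y\<close> under the integral sign, and then in \<open>z\<close> by the
  fundamental theorem.\<close>

lemma fderiv_commute:
  fixes W :: "real \<times> real \<Rightarrow> real"
  assumes I: "open I" and W: "smooth (UNIV \<times> I) W" and y: "y \<in> I"
  shows "fderiv (\<lambda>q. fderiv W q (0, 1)) (x, y) (1, 0) = fderiv (\<lambda>q. fderiv W q (1, 0)) (x, y) (0, 1)"
proof -
  have op: "open (UNIV \<times> I :: (real \<times> real) set)" using I by (intro open_Times) auto
  note sm = smooth_fderiv[OF op]
  have dx: "((\<lambda>x. F (x, y)) has_real_derivative fderiv F (x, y) (1, 0)) (at x)"
    if "smooth (UNIV \<times> I) F" "y \<in> I" for F :: "real \<times> real \<Rightarrow> real" and x y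
    using that by (intro has_real_derivative_Pair_left smooth_has_derivative[OF that(1)]) auto
  define a where "a = x - 1"
  define Wx where "Wx = (\<lambda>q. fderiv W q (1, 0))"
  define Wy where "Wy = (\<lambda>q. fderiv W q (0, 1))"
  have sWx: "smooth (UNIV \<times> I) Wx" and sWy: "smooth (UNIV \<times> I) Wy"
    unfolding Wx_def Wy_def by (intro sm W)+
  have FTC: "integral {a..z} (\<lambda>s. Wx (s, y)) = W (z, y) - W (a, y)" if "a \<le> z" "y \<in> I" for z y
    unfolding Wx_def using has_integral_real_derivative[OF that(1) dx[OF W that(2)]] by (rule integral_unique)
  have Wy': "fderiv W (z, y) (0, 1) - fderiv W (a, y) (0, 1) = integral {a..z} (\<lambda>s. fderiv Wx (s, y) (0, 1))"
    if z: "a \<le> z" for z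
  proof -
    have d: "((\<lambda>y. W (z, y)) has_derivative (\<lambda>v. fderiv W (z, y) (0, v))) (at y)" for z
      using has_derivative_Pair_right[OF smooth_has_derivative[OF W, of "(z, y)"]] y by auto
    have 1: "((\<lambda>y. W (z, y) - W (a, y)) has_derivative
        (\<lambda>v. fderiv W (z, y) (0, v) - fderiv W (a, y) (0, v))) (at y)"
      by (intro has_derivative_diff d)
    have "((\<lambda>y. integral {a..z} (\<lambda>s. Wx (s, y))) has_derivative
        (\<lambda>v. integral {a..z} (\<lambda>s. fderiv Wx (s, y) (0, v)))) (at y)"
      by (rule has_derivative_param_integral[OF I sWx y])
    then have 2: "((\<lambda>y. W (z, y) - W (a, y)) has_derivative
        (\<lambda>v. integral {a..z} (\<lambda>s. fderiv Wx (s, y) (0, v)))) (at y)"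
      by (rule has_derivative_transform_within_open[OF _ I y]) (use FTC z in auto)
    from fun_cong[OF has_derivative_unique[OF 1 2], of 1] show ?thesis .
  qed
  have "continuous_on (UNIV \<times> I) (\<lambda>q. fderiv Wx q (0, 1))"
    by (intro smooth_continuous_on sm sWx)
  then have "continuous_on {a..x+1} (\<lambda>s. fderiv Wx (s, y) (0, 1))"
    by (rule continuous_on_compose2) (use y in \<open>auto intro!: continuous_intros\<close>)
  then have "((\<lambda>z. integral {a..z} (\<lambda>s. fderiv Wx (s, y) (0, 1))) has_real_derivative
      fderiv Wx (x, y) (0, 1)) (at x within {a..x+1})"
    by (rule integral_has_real_derivative) (auto simp: a_def)
  then have "((\<lambda>z. integral {a..z} (\<lambda>s. fderiv Wx (s, y) (0, 1))) has_real_derivative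
      fderiv Wx (x, y) (0, 1)) (at x)"
    by (simp add: at_within_Icc_at a_def)
  then have "((\<lambda>z. Wy (z, y) - Wy (a, y)) has_real_derivative fderiv Wx (x, y) (0, 1)) (at x)"
    by (rule has_field_derivative_transform_within_open[where S="{a<..}"])
       (use Wy' in \<open>auto simp: a_def Wy_def\<close>)
  then have "((\<lambda>z. Wy (z, y) - Wy (a, y) + Wy (a, y)) has_real_derivative fderiv Wx (x, y) (0, 1) + 0) (at x)"
    by (intro DERIV_add DERIV_const)
  then have "((\<lambda>z. Wy (z, y)) has_real_derivative fderiv Wx (x, y) (0, 1)) (at x)" by simp
  from DERIV_unique[OF dx[OF sWy y] this] show ?thesis by (simp add: Wx_def Wy_def)
qed

section \<open>Phase-plane parametrization\<close>

text \<open>The antiderivative vanishing at 0, written over the fixed interval [0, 1]. The upper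
  limit becomes a parameter, so joint smoothness in limit and parameters is a case of parameter
  integrals, and negative arguments need no separate treatment.\<close>

definition prim :: "(real \<Rightarrow> real) \<Rightarrow> real \<Rightarrow> real" where
  "prim f t = t * integral {0..1} (\<lambda>s. f (t * s))"

lemma prim_0 [simp]: "prim f 0 = 0"
  by (simp add: prim_def)

lemma prim_antiderivative:
  assumes "\<And>x. (F has_real_derivative f x) (at x)"
  shows "prim f t = F t - F 0"
proof -
  have "((\<lambda>s. F (t * s)) has_real_derivative t * f (t * s)) (at s)" for s
  proof -
    have "((\<lambda>s. t * s) has_real_derivative t) (at s)" by (auto intro!: derivative_eq_intros)
    from DERIV_chain2[OF assms this] show ?thesis by (simp add: mult.commute)
  qed
  then have "((\<lambda>s. t * f (t * s)) has_integral F (t * 1) - F (t * 0)) {0..1}"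
    by (intro has_integral_real_derivative) auto
  from integral_unique[OF this] show ?thesis by (simp add: prim_def)
qed

lemma prim_has_real_derivative:
  assumes "continuous_on UNIV f"
  shows "(prim f has_real_derivative f t) (at t)"
proof -
  obtain F where F: "(F has_real_derivative f x) (at x)" for x
    using einterval_antiderivative[of "-\<infinity>" "\<infinity>" f] assms
    by (auto simp: continuous_on_eq_continuous_at has_real_derivative_iff_has_vector_derivative)
  have "prim f = (\<lambda>t. F t - F 0)" using prim_antiderivative[of F f, OF F] by blast
  then show ?thesis using DERIV_diff[OF F DERIV_const] by simp
qed

lemma prim_eq_integral:
  assumes "continuous_on UNIV f" "0 \<le> t"
  shows "prim f t = integral {0..t} f"
proof -
  have "(f has_integral prim f t - prim f 0) {0..t}"
    by (rule has_integral_real_derivative[OF assms(2) prim_has_real_derivative[OF assms(1)]])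
  then show ?thesis by (simp add: integral_unique)
qed

text \<open>Evenness makes the antiderivative odd, and periodicity makes its increment over 2 pi
  constant; taken from -pi to pi that increment is \<open>2 * prim f pi\<close>. As the shift covers
  two steps, the induction carries two consecutive multiples.\<close>

lemma prim_multiple_pi:
  assumes c: "continuous_on UNIV f" and even: "\<And>t. f (- t) = f t" and per: "\<And>t. f (t + 2 * pi) = f t"
  shows "prim f (real j * pi) = real j * prim f pi"
proof -
  have odd: "prim f (- t) = - prim f t" for t
    by (simp add: prim_def even)
  have "((\<lambda>t. prim f (t + 2 * pi) - prim f t) has_real_derivative 0) (at x)" for x
  proof -
    have "((\<lambda>t. prim f (t + 2 * pi)) has_real_derivative f (x + 2 * pi)) (at x)"
      using prim_has_real_derivative[OF c] DERIV_shift by blast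
    from DERIV_diff[OF this prim_has_real_derivative[OF c]] show ?thesis using per by simp
  qed
  then have "prim f (t + 2 * pi) - prim f t = prim f (- pi + 2 * pi) - prim f (- pi)" for t
    using DERIV_isconst_all by blast
  then have shift: "prim f (t + 2 * pi) = prim f t + 2 * prim f pi" for t
    using odd[of pi] by (smt (verit))
  have "prim f (real j * pi) = real j * prim f pi \<and>
        prim f (real (Suc j) * pi) = real (Suc j) * prim f pi"
  proof (induction j)
    case (Suc j)
    have "real (Suc (Suc j)) * pi = real j * pi + 2 * pi" by (simp add: algebra_simps)
    then show ?case using Suc shift[of "real j * pi"] by (simp add: algebra_simps)
  qed auto
  then show ?thesis by blast
qed

lemma smooth_prim:
  fixes f :: "'a::euclidean_space \<Rightarrow> real \<Rightarrow> real"
  assumes "open S" and f: "smooth (UNIV \<times> S) (\<lambda>q. f (snd q) (fst q))"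
  shows "smooth (UNIV \<times> S) (\<lambda>q. prim (f (snd q)) (fst q))"
proof -
  let ?G = "\<lambda>z :: real \<times> (real \<times> 'a). f (snd (snd z)) (fst (snd z) * fst z)"
  have "smooth (UNIV \<times> (UNIV \<times> S)) (\<lambda>z. f (snd (fst (snd z) * fst z, snd (snd z))) (fst (fst (snd z) * fst z, snd (snd z))))"
    by (rule smooth_compose[OF f, where f="\<lambda>z. (fst (snd z) * fst z, snd (snd z))"])
       (auto intro!: smooth_intros)
  then have "smooth (UNIV \<times> (UNIV \<times> S)) ?G" by simp
  then have "smooth (UNIV \<times> S) (\<lambda>q. integral {0..1} (\<lambda>s. ?G (s, q)))"
    by (intro smooth_param_integral open_Times assms open_UNIV)
  then show ?thesis unfolding prim_def by (intro smooth_intros) auto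
qed

text \<open>
  At \<open>u = m - r cos t\<close> the potential minus its chord over \<open>[m - r, m + r]\<close> is \<open>- (r sin t)\<^sup>2 kap / 2\<close>. So
  \<open>1 / sqrt (1 + u'\<^sup>2) = 1 - wgt\<close>, and \<open>spd\<close> is \<open>dx/dt\<close>.
\<close>

definition kap :: "real \<Rightarrow> real \<Rightarrow> real \<Rightarrow> real" where
  "kap m r c = 1 - 3 * m\<^sup>2 + 2 * m * r * c - r\<^sup>2 * c\<^sup>2 / 2 - r\<^sup>2 / 2"

definition wgt :: "real \<Rightarrow> real \<Rightarrow> real \<Rightarrow> real \<Rightarrow> real" where
  "wgt m r l t = l * r\<^sup>2 * (sin t)\<^sup>2 * kap m r (cos t) / 2"

definition amp :: "real \<Rightarrow> real \<Rightarrow> real \<Rightarrow> real \<Rightarrow> real" where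
  "amp m r l t = l * kap m r (cos t) * (1 - wgt m r l t / 2)"

definition spd :: "real \<times> real \<times> real \<Rightarrow> real \<Rightarrow> real" where
  "spd p t = (1 - wgt (fst p) (fst (snd p)) (snd (snd p)) t)
               / sqrt (amp (fst p) (fst (snd p)) (snd (snd p)) t)"

text \<open>Besides \<open>l > 0\<close>, the second inequality keeps \<open>kap\<close> positive at
  every angle, and the third, together with \<open>kap \<le> 2\<close>, keeps \<open>wgt\<close> at
  most 1/8. Both are symmetric in the sign of \<open>r\<close>, and \<open>r = 0\<close> is
  included.\<close>

definition Gam :: "(real \<times> real \<times> real) set" where
  "Gam = {p. 0 < snd (snd p) \<and> 3 * (fst p)\<^sup>2 + 2 * \<bar>fst p * fst (snd p)\<bar> + (fst (snd p))\<^sup>2 < 1 \<and>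
             snd (snd p) * (fst (snd p))\<^sup>2 < 1 / 8}"

lemma Gam_iff: "(m, r, l) \<in> Gam \<longleftrightarrow> 0 < l \<and> 3 * m\<^sup>2 + 2 * \<bar>m * r\<bar> + r\<^sup>2 < 1 \<and> l * r\<^sup>2 < 1 / 8"
  by (simp add: Gam_def)

lemma open_Gam: "open Gam"
  unfolding Gam_def by (intro open_Collect_conj open_Collect_less continuous_intros)

lemma kap_bounds:
  assumes "3 * m\<^sup>2 + 2 * \<bar>m * r\<bar> + r\<^sup>2 < 1" "\<bar>c\<bar> \<le> 1"
  shows "0 < kap m r c" "kap m r c \<le> 2"
proof -
  have "\<bar>m * r * c\<bar> \<le> \<bar>m * r\<bar>" using assms(2) by (simp add: abs_mult mult_left_le)
  moreover have "0 \<le> r\<^sup>2 * c\<^sup>2" "r\<^sup>2 * c\<^sup>2 \<le> r\<^sup>2"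
    using assms(2) by (auto simp: mult_left_le abs_square_le_1)
  ultimately show "0 < kap m r c" using assms(1) unfolding kap_def by (simp add: abs_if split: if_splits)
  have "2 * m * r * c \<le> 2 * \<bar>m * r\<bar>" using \<open>\<bar>m * r * c\<bar> \<le> \<bar>m * r\<bar>\<close> by linarith
  then show "kap m r c \<le> 2"
    using \<open>0 \<le> r\<^sup>2 * c\<^sup>2\<close> assms(1) zero_le_power2[of m] zero_le_power2[of r] unfolding kap_def
    by linarith
qed

context
  fixes m r l :: real
  assumes G: "(m, r, l) \<in> Gam"
begin

lemma l_pos: "0 < l" using G by (simp add: Gam_iff)

lemma kap_cos: "0 < kap m r (cos t)" "kap m r (cos t) \<le> 2"
  using kap_bounds[of m r "cos t"] G by (auto simp: Gam_iff)

lemma wgt_bounds: "0 \<le> wgt m r l t" "wgt m r l t \<le> 1 / 8"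
proof -
  have lr: "0 \<le> l * r\<^sup>2" "l * r\<^sup>2 \<le> 1 / 8" using G l_pos by (auto simp: Gam_iff)
  show "0 \<le> wgt m r l t" unfolding wgt_def using lr kap_cos[of t] by simp
  have "(sin t)\<^sup>2 * (kap m r (cos t) / 2) \<le> 1 * 1"
    using kap_cos[of t] by (intro mult_mono) (auto simp: abs_square_le_1)
  then have "(l * r\<^sup>2) * ((sin t)\<^sup>2 * (kap m r (cos t) / 2)) \<le> (l * r\<^sup>2) * 1"
    using lr by (intro mult_left_mono) auto
  then show "wgt m r l t \<le> 1 / 8" unfolding wgt_def using lr by (simp add: algebra_simps)
qed

lemma amp_bounds: "0 < amp m r l t" "amp m r l t \<le> 2 * l"
proof -
  show "0 < amp m r l t" unfolding amp_def using wgt_bounds[of t] kap_cos[of t] l_pos by simp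
  have "l * kap m r (cos t) * (1 - wgt m r l t / 2) \<le> (l * 2) * 1"
    using wgt_bounds[of t] kap_cos[of t] l_pos by (intro mult_mono) auto
  then show "amp m r l t \<le> 2 * l" by (simp add: amp_def)
qed

text \<open>The bound does not depend on \<open>t\<close>, so the position is unbounded in both
  directions as the angle varies. This is where surjectivity of \<open>prim (spd p)\<close> comes
  from.\<close>

lemma spd_lower: "7 / 8 / sqrt (2 * l) \<le> spd (m, r, l) t"
  unfolding spd_def using wgt_bounds[of t] amp_bounds[of t] l_pos
  by (intro frac_le) auto

lemma spd_pos: "0 < spd (m, r, l) t"
  unfolding spd_def using wgt_bounds[of t] amp_bounds[of t] by simp

end

lemma smooth_spd: "smooth (UNIV \<times> Gam) (\<lambda>q. spd (snd q) (fst q))"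
  unfolding spd_def
proof (intro smooth_intros)
  show "smooth (UNIV \<times> Gam) (\<lambda>x. wgt (fst (snd x)) (fst (snd (snd x))) (snd (snd (snd x))) (fst x))"
    unfolding wgt_def kap_def by (intro smooth_intros) auto
  show "smooth (UNIV \<times> Gam) (\<lambda>x. amp (fst (snd x)) (fst (snd (snd x))) (snd (snd (snd x))) (fst x))"
    unfolding amp_def wgt_def kap_def by (intro smooth_intros) auto
  show "0 < amp (fst (snd x)) (fst (snd (snd x))) (snd (snd (snd x))) (fst x)"
    if "x \<in> UNIV \<times> Gam" for x
    using that amp_bounds(1)[of "fst (snd x)" "fst (snd (snd x))" "snd (snd (snd x))"] by auto
  show "sqrt (amp (fst (snd x)) (fst (snd (snd x))) (snd (snd (snd x))) (fst x)) \<noteq> 0"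
    if "x \<in> UNIV \<times> Gam" for x
    using that amp_bounds(1)[of "fst (snd x)" "fst (snd (snd x))" "snd (snd (snd x))" "fst x"] by auto
qed

lemma continuous_spd: "p \<in> Gam \<Longrightarrow> continuous_on UNIV (spd p)"
  by (rule continuous_on_compose2[OF smooth_continuous_on[OF smooth_spd], of UNIV "\<lambda>t. (t, p)", simplified])
     (auto intro!: continuous_intros)

lemma spd_minus: "spd p (- t) = spd p t"
  by (simp add: spd_def amp_def wgt_def)

lemma spd_periodic: "spd p (t + 2 * pi) = spd p t"
  by (simp add: spd_def amp_def wgt_def)

text \<open>Replacing \<open>r\<close> by \<open>- r\<close> starts the same oscillation at the
  opposite turning point. All evenness in \<open>r\<close> used later goes back to this
  identity.\<close>

lemma spd_reflect: "spd (m, - r, l) (pi - t) = spd (m, r, l) t"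
  by (simp add: spd_def amp_def wgt_def kap_def)

lemma spd_0: "spd (m, 0, l) t = 1 / sqrt (l * (1 - 3 * m\<^sup>2))"
  by (simp add: spd_def amp_def wgt_def kap_def)

section \<open>The angle as a smooth function of position and parameters\<close>

definition angle :: "real \<times> real \<times> real \<Rightarrow> real \<Rightarrow> real" where
  "angle p x = (THE t. prim (spd p) t = x)"

lemma spd_pos': "p \<in> Gam \<Longrightarrow> 0 < spd p t"
  using spd_pos by (cases p) auto

lemma prim_spd_less_iff: "p \<in> Gam \<Longrightarrow> prim (spd p) s < prim (spd p) t \<longleftrightarrow> s < t"
proof -
  assume p: "p \<in> Gam"
  have *: "prim (spd p) s < prim (spd p) t" if "s < t" for s t
    using that by (rule DERIV_pos_imp_increasing)
      (use prim_has_real_derivative[OF continuous_spd[OF p]] spd_pos'[OF p] in blast)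
  show ?thesis using * by (metis less_asym less_linear)
qed

lemma prim_spd_surj:
  assumes p: "p \<in> Gam" shows "\<exists>t. prim (spd p) t = x"
proof -
  obtain m r l where mrl: "p = (m, r, l)" by (cases p)
  define b where "b = 7 / 8 / sqrt (2 * l)"
  have b: "b > 0" using l_pos[of m r l] p mrl by (simp add: b_def)
  have mono: "prim (spd p) s - b * s \<le> prim (spd p) t - b * t" if "s \<le> t" for s t
    using that
  proof (rule DERIV_nonneg_imp_nondecreasing)
    fix z
    have "((\<lambda>t. prim (spd p) t - b * t) has_real_derivative spd p z - b) (at z)"
      using DERIV_diff[OF prim_has_real_derivative[OF continuous_spd[OF p]] DERIV_cmult_Id] .
    then show "\<exists>y. ((\<lambda>t. prim (spd p) t - b * t) has_real_derivative y) (at z) \<and> 0 \<le> y"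
      using spd_lower[of m r l z] p mrl b_def by fastforce
  qed
  define R where "R = \<bar>x\<bar> / b"
  have "b * R = \<bar>x\<bar>" "R \<ge> 0" using b by (auto simp: R_def)
  then have "prim (spd p) R \<ge> x" "prim (spd p) (- R) \<le> x"
    using mono[of 0 R] mono[of "-R" 0] by (auto simp: abs_if split: if_splits)
  moreover have "isCont (prim (spd p)) t" for t
    using DERIV_isCont[OF prim_has_real_derivative[OF continuous_spd[OF p]]] .
  ultimately show ?thesis
    using IVT[of "prim (spd p)" "-R" x R] \<open>R \<ge> 0\<close> by auto
qed

lemma prim_spd_inj: "p \<in> Gam \<Longrightarrow> prim (spd p) s = prim (spd p) t \<longleftrightarrow> s = t"
  using prim_spd_less_iff[of p s t] prim_spd_less_iff[of p t s] by (metis less_irrefl less_linear)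

lemma prim_angle: "p \<in> Gam \<Longrightarrow> prim (spd p) (angle p x) = x"
  unfolding angle_def by (rule theI') (metis prim_spd_surj prim_spd_inj)

lemma angle_prim: "p \<in> Gam \<Longrightarrow> angle p (prim (spd p) t) = t"
  using prim_angle prim_spd_inj by blast

lemma angle_0: "p \<in> Gam \<Longrightarrow> angle p 0 = 0"
  using angle_prim[of p 0] by simp

lemma angle_pos: "p \<in> Gam \<Longrightarrow> 0 < x \<Longrightarrow> 0 < angle p x"
  using prim_spd_less_iff[of p 0 "angle p x"] by (simp add: prim_angle)

text \<open>The equation \<open>prim (spd p) t = x\<close> has slope \<open>spd p t > 0\<close> in
  \<open>t\<close> everywhere, so the implicit function argument applies globally, with the whole
  line as the range of the unknown.\<close>

lemma smooth_angle: "smooth (UNIV \<times> Gam) (\<lambda>q. angle (snd q) (fst q))"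
proof -
  let ?F = "\<lambda>z :: real \<times> (real \<times> (real \<times> real \<times> real)). prim (spd (snd (snd z))) (fst z) - fst (snd z)"
  have op: "open (UNIV \<times> Gam :: (real \<times> (real \<times> real \<times> real)) set)"
    by (intro open_Times open_Gam) auto
  have "smooth (UNIV \<times> (UNIV \<times> Gam)) (\<lambda>z :: real \<times> (real \<times> (real \<times> real \<times> real)).
      prim (spd (snd (fst z, snd (snd z)))) (fst (fst z, snd (snd z))))"
    by (rule smooth_compose[OF smooth_prim[OF open_Gam smooth_spd], where f="\<lambda>z. (fst z, snd (snd z))"])
       (auto intro!: smooth_intros)
  then have sm: "smooth (UNIV \<times> (UNIV \<times> Gam)) ?F"
    by (auto intro!: smooth_intros)
  interpret implicit ?F UNIV "UNIV \<times> Gam"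
  proof
    fix t :: real and e :: "real \<times> real \<times> real \<times> real" assume e: "e \<in> UNIV \<times> Gam"
    then have p: "snd e \<in> Gam" by auto
    have "(?F has_derivative fderiv ?F (t, e)) (at (t, e))"
      by (rule smooth_has_derivative[OF sm]) (use e in auto)
    from has_real_derivative_Pair_left[OF this]
    have "((\<lambda>t. prim (spd (snd e)) t - fst e) has_real_derivative fderiv ?F (t, e) (1, 0)) (at t)" by simp
    moreover have "((\<lambda>t. prim (spd (snd e)) t - fst e) has_real_derivative spd (snd e) t - 0) (at t)"
      by (intro DERIV_diff DERIV_const prim_has_real_derivative continuous_spd p)
    ultimately have "fderiv ?F (t, e) (1, 0) = spd (snd e) t" using DERIV_unique by fastforce
    then show "0 < fderiv ?F (t, e) (1, 0)" using spd_pos'[OF p] by simp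
  qed (use op sm in auto)
  show ?thesis by (rule smooth_solution) (auto simp: prim_angle)
qed

lemma angle_has_real_derivative:
  assumes p: "p \<in> Gam"
  shows "(angle p has_real_derivative 1 / spd p (angle p x)) (at x)"
proof -
  have "continuous_on UNIV (angle p)"
    by (rule continuous_on_compose2[OF smooth_continuous_on[OF smooth_angle], of UNIV "\<lambda>t. (t, p)", simplified])
       (use p in \<open>auto intro!: continuous_intros\<close>)
  then have "isCont (angle p) x" by (simp add: continuous_on_eq_continuous_at)
  then have "(angle p has_real_derivative inverse (spd p (angle p x))) (at x)"
    using prim_has_real_derivative[OF continuous_spd[OF p], of "angle p x"] spd_pos'[OF p, of "angle p x"]
    by (intro DERIV_inverse_function[where f="prim (spd p)" and a="x-1" and b="x+1"])
       (auto simp: prim_angle[OF p])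
  then show ?thesis by (simp add: inverse_eq_divide)
qed

section \<open>Smooth curves in \<open>C\<^sup>2\<close>\<close>

definition perfect :: "real set \<Rightarrow> bool" where
  "perfect S \<longleftrightarrow> (\<forall>x\<in>S. at x within S \<noteq> bot)"

lemma perfect_open: "open S \<Longrightarrow> perfect S"
  unfolding perfect_def by (metis at_neq_bot at_within_open)

lemma perfect_Icc: "a < b \<Longrightarrow> perfect {a..b::real}"
  unfolding perfect_def by (metis trivial_limit_within islimpt_Icc atLeastAtMost_iff)

lemma Dw_eqI:
  assumes "perfect S" "x \<in> S" "(u has_real_derivative d) (at x within S)"
  shows "Dw S u x = d"
  using assms unfolding Dw_def perfect_def
  by (intro vector_derivative_within) (auto simp: has_real_derivative_iff_has_vector_derivative)

lemma Dw_cong: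
  assumes "\<And>y. y \<in> S \<Longrightarrow> u y = v y" "x \<in> S"
  shows "Dw S u x = Dw S v x"
proof -
  have "(u has_vector_derivative d) (at x within S) \<longleftrightarrow> (v has_vector_derivative d) (at x within S)" for d
    using has_vector_derivative_transform[OF assms(2), of u v d]
      has_vector_derivative_transform[OF assms(2), of v u d] assms(1) by auto
  then show ?thesis unfolding Dw_def vector_derivative_def by simp
qed

text \<open>A proposed chain \<open>d\<close> of derivatives determines all iterates of
  \<open>Dw\<close> on \<open>S\<close>, because a set without isolated points has unique
  derivatives within it. Regularity and derivatives of concrete functions are obtained through
  this.\<close>

lemma Ck_on_derivI:
  assumes S: "perfect S"
    and 0: "\<And>x. x \<in> S \<Longrightarrow> u x = d 0 x"
    and d: "\<And>j x. j < n \<Longrightarrow> x \<in> S \<Longrightarrow> (d j has_real_derivative d (Suc j) x) (at x within S)"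
    and cont: "continuous_on S (d n)"
  shows "Ck_on n S u" "\<And>j x. j \<le> n \<Longrightarrow> x \<in> S \<Longrightarrow> (Dw S ^^ j) u x = d j x"
proof -
  show eq: "(Dw S ^^ j) u x = d j x" if "j \<le> n" "x \<in> S" for j x
    using that
  proof (induction j arbitrary: x)
    case (Suc j)
    have "(Dw S ^^ Suc j) u x = Dw S ((Dw S ^^ j) u) x" by simp
    also have "\<dots> = Dw S (d j) x" by (rule Dw_cong) (use Suc in auto)
    also have "\<dots> = d (Suc j) x" by (rule Dw_eqI[OF S]) (use Suc d in auto)
    finally show ?case .
  qed (use 0 in simp)
  have cont_d: "continuous_on S (d j)" if "j \<le> n" for j
  proof (cases "j = n")
    case False
    then show ?thesis using d[of j] that
      by (auto intro!: DERIV_continuous_on[of S "d j" "d (Suc j)"])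
  qed (use cont in simp)
  show "Ck_on n S u"
    unfolding Ck_on_def
  proof (intro conjI allI impI ballI)
    fix j x assume jx: "j < n" "x \<in> S"
    have "((Dw S ^^ j) u has_vector_derivative d (Suc j) x) (at x within S)"
      by (rule has_vector_derivative_transform[OF jx(2), of _ "d j"])
         (use eq jx d[OF jx] in \<open>auto simp: has_real_derivative_iff_has_vector_derivative\<close>)
    then show "(Dw S ^^ j) u differentiable at x within S"
      by (rule differentiableI_vector)
  next
    fix j assume "j \<le> n"
    then show "continuous_on S ((Dw S ^^ j) u)"
      using cont_d[of j] eq by (simp cong: continuous_on_cong)
  qed
qed

lemma Ck_on_has_derivative:
  assumes "Ck_on n S u" "j < n" "x \<in> S"
  shows "((Dw S ^^ j) u has_real_derivative (Dw S ^^ Suc j) u x) (at x within S)"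
  using assms unfolding Ck_on_def
  by (auto simp: Dw_def has_real_derivative_iff_has_vector_derivative vector_derivative_works)

lemma Ck_on_continuous: "Ck_on n S u \<Longrightarrow> j \<le> n \<Longrightarrow> continuous_on S ((Dw S ^^ j) u)"
  by (auto simp: Ck_on_def)

lemma Ck_on_cong:
  assumes "perfect S" "\<And>x. x \<in> S \<Longrightarrow> u x = v x"
  shows "Ck_on n S u \<longleftrightarrow> Ck_on n S v"
proof -
  have "Ck_on n S v" if "Ck_on n S u" "\<And>x. x \<in> S \<Longrightarrow> u x = v x" for u v
    by (rule Ck_on_derivI(1)[OF assms(1), of v "\<lambda>j. (Dw S ^^ j) u"])
       (use that Ck_on_has_derivative[OF that(1)] Ck_on_continuous[OF that(1)] in auto)
  then show ?thesis using assms(2) by metis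
qed

lemma flux_cong:
  assumes "\<And>x. x \<in> {0..L} \<Longrightarrow> u x = v x" "x \<in> {0..L}"
  shows "flux L u x = flux L v x"
  unfolding flux_def using Dw_cong[of "{0..L}" u v x] assms by simp

text \<open>Branch points are only compared on [0, L]. The one ingredient of
  \<open>is_solution\<close> that looks beyond a single value there is the two-sided
  \<open>deriv\<close> of the flux, and it is taken at interior points, where agreement on a
  neighbourhood suffices.\<close>

lemma is_solution_cong:
  assumes L: "L > 0" and eq: "\<And>x. x \<in> {0..L} \<Longrightarrow> u x = v x"
  shows "is_solution L M lam u \<longleftrightarrow> is_solution L M lam v"
proof -
  have "is_solution L M lam v" if sol: "is_solution L M lam u" and eq: "\<And>x. x \<in> {0..L} \<Longrightarrow> u x = v x" for u v
  proof -
    have C: "Ck_on 2 {0<..<L} v" "Ck_on 1 {0..L} v"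
      using sol eq Ck_on_cong[OF perfect_open[of "{0<..<L}"], of u v 2]
        Ck_on_cong[OF perfect_Icc[OF L], of u v 1] unfolding is_solution_def by auto
    have "deriv (flux L v) x = deriv (flux L u) x" if "x \<in> {0<..<L}" for x
    proof (rule deriv_cong_ev)
      have "eventually (\<lambda>y. y \<in> {0<..<L}) (nhds x)" using that by (intro eventually_nhds_in_open) auto
      then show "\<forall>\<^sub>F y in nhds x. flux L v y = flux L u y"
        by eventually_elim (rule flux_cong, use eq in auto)
    qed simp
    moreover have "integral {0..L} (\<lambda>s. cubic_f (u s)) = integral {0..L} (\<lambda>s. cubic_f (v s))"
      "integral {0..L} u = integral {0..L} v"
      using eq by (auto intro!: integral_cong)
    moreover have "Dw {0..L} v 0 = Dw {0..L} u 0" "Dw {0..L} v L = Dw {0..L} u L"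
      using Dw_cong[of "{0..L}" u v] eq L by auto
    ultimately show ?thesis using sol C eq unfolding is_solution_def by simp
  qed
  then show ?thesis using eq by metis
qed

lemma C2_norm_ge:
  assumes u: "Ck_on 2 {0..L} u" and j: "j \<le> 2" and x: "x \<in> {0..L}"
  shows "\<bar>(Dw {0..L} ^^ j) u x\<bar> \<le> C2_norm L u"
proof -
  have up: "\<bar>(Dw {0..L} ^^ i) u x\<bar> \<le> (SUP x\<in>{0..L}. \<bar>(Dw {0..L} ^^ i) u x\<bar>)" if "i \<le> 2" for i
  proof (rule cSUP_upper[OF x])
    have "continuous_on {0..L} (\<lambda>x. \<bar>(Dw {0..L} ^^ i) u x\<bar>)"
      by (intro continuous_intros Ck_on_continuous[OF u that])
    then show "bdd_above ((\<lambda>x. \<bar>(Dw {0..L} ^^ i) u x\<bar>) ` {0..L})"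
      by (intro bounded_imp_bdd_above compact_imp_bounded compact_continuous_image) auto
  qed
  have "\<bar>(Dw {0..L} ^^ j) u x\<bar> \<le> (SUP x\<in>{0..L}. \<bar>(Dw {0..L} ^^ j) u x\<bar>)" using up j .
  also have "\<dots> \<le> C2_norm L u"
    unfolding C2_norm_def
  proof (rule member_le_sum)
    fix i assume "i \<in> {..2} - {j}"
    then have "i \<le> 2" by simp
    show "0 \<le> (SUP x\<in>{0..L}. \<bar>(Dw {0..L} ^^ i) u x\<bar>)"
      by (rule order_trans[OF abs_ge_zero up[OF \<open>i \<le> 2\<close>]])
  qed (use j in auto)
  finally show ?thesis .
qed

lemma C2_norm_le:
  assumes "L > 0" "\<And>j x. j \<le> 2 \<Longrightarrow> x \<in> {0..L} \<Longrightarrow> \<bar>(Dw {0..L} ^^ j) u x\<bar> \<le> e"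
  shows "\<bar>C2_norm L u\<bar> \<le> 3 * e"
proof -
  have s: "0 \<le> (SUP x\<in>{0..L}. \<bar>(Dw {0..L} ^^ j) u x\<bar>) \<and> (SUP x\<in>{0..L}. \<bar>(Dw {0..L} ^^ j) u x\<bar>) \<le> e" if "j \<le> 2" for j
  proof
    have "bdd_above ((\<lambda>x. \<bar>(Dw {0..L} ^^ j) u x\<bar>) ` {0..L})"
      by (rule bdd_aboveI2[where M=e]) (use assms that in auto)
    then have "\<bar>(Dw {0..L} ^^ j) u 0\<bar> \<le> (SUP x\<in>{0..L}. \<bar>(Dw {0..L} ^^ j) u x\<bar>)"
      using assms(1) by (intro cSUP_upper) auto
    then show "0 \<le> (SUP x\<in>{0..L}. \<bar>(Dw {0..L} ^^ j) u x\<bar>)" by linarith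
    show "(SUP x\<in>{0..L}. \<bar>(Dw {0..L} ^^ j) u x\<bar>) \<le> e"
      by (rule cSUP_least) (use assms that in auto)
  qed
  have "{..2::nat} = {0, 1, 2}" by auto
  then show ?thesis unfolding C2_norm_def using s[of 0] s[of 1] s[of 2] by simp
qed

lemma near_bounds:
  assumes L: "L > 0" and nr: "near L M lam0 e lam u" and x: "x \<in> {0..L}"
  shows "\<bar>u x - M\<bar> < e" "\<bar>Dw {0..L} u x\<bar> < e"
proof -
  have C: "Ck_on 2 {0..L} u" "C2_norm L (\<lambda>x. u x - M) < e" using nr by (auto simp: near_def)
  \<comment> \<open>Subtracting \<open>M\<close> affects only the function itself and none of its
    derivatives; this chain transfers the bound on the norm of \<open>u - M\<close> to the slope of
    \<open>u\<close>.\<close>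
  define d where "d = (\<lambda>j. case j of 0 \<Rightarrow> (\<lambda>x. u x - M) | Suc i \<Rightarrow> (Dw {0..L} ^^ Suc i) u)"
  have dd: "(d j has_real_derivative d (Suc j) x) (at x within {0..L})" if "j < 2" "x \<in> {0..L}" for j x
  proof (cases j)
    case 0
    have "((\<lambda>x. u x - M) has_real_derivative (Dw {0..L} ^^ Suc 0) u x - 0) (at x within {0..L})"
      using Ck_on_has_derivative[OF C(1), of 0 x] that 0 by (intro DERIV_diff DERIV_const) auto
    then show ?thesis using 0 by (simp add: d_def)
  next
    case (Suc i)
    then show ?thesis using Ck_on_has_derivative[OF C(1), of j x] that by (simp add: d_def)
  qed
  have "continuous_on {0..L} (d 2)"
    using Ck_on_continuous[OF C(1), of 2] by (simp add: d_def numeral_2_eq_2)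
  note * = Ck_on_derivI[OF perfect_Icc[OF L], of "\<lambda>x. u x - M" d 2, OF _ dd this]
  have "Ck_on 2 {0..L} (\<lambda>x. u x - M)" by (rule *(1)) (auto simp: d_def)
  note ge = C2_norm_ge[OF this _ x]
  have "(Dw {0..L} ^^ 1) (\<lambda>x. u x - M) x = d 1 x" by (rule *(2)) (use x in \<open>auto simp: d_def\<close>)
  then show "\<bar>u x - M\<bar> < e" "\<bar>Dw {0..L} u x\<bar> < e"
    using ge[of 0] ge[of 1] C(2) by (auto simp: d_def)
qed

lemma smooth_imp_Ck_on:
  fixes f :: "real \<Rightarrow> real"
  assumes S: "open S" and f: "smooth S f"
  shows "Ck_on n S f"
proof -
  define d where "d = (\<lambda>j. ((\<lambda>g x. fderiv g x 1) ^^ j) f)"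
  have sm: "smooth S (d j)" for j
    by (induction j) (auto simp: d_def f intro: smooth_fderiv[OF S])
  show ?thesis
  proof (rule Ck_on_derivI(1)[OF perfect_open[OF S], of f d])
    fix j x assume "x \<in> S"
    have "(d j has_real_derivative fderiv (d j) x 1) (at x)"
      by (rule has_derivative_imp_real[OF smooth_has_derivative[OF sm \<open>x \<in> S\<close>]])
    then show "(d j has_real_derivative d (Suc j) x) (at x within S)"
      by (simp add: d_def has_field_derivative_at_within)
  qed (use sm in \<open>auto simp: d_def smooth_continuous_on\<close>)
qed

section \<open>Functions smooth on a strip, read as curves in the space C^2\<close>

abbreviation Dx :: "(real \<times> real \<Rightarrow> real) \<Rightarrow> real \<times> real \<Rightarrow> real" where
  "Dx W \<equiv> \<lambda>q. fderiv W q (1, 0)"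

abbreviation Dy :: "(real \<times> real \<Rightarrow> real) \<Rightarrow> real \<times> real \<Rightarrow> real" where
  "Dy W \<equiv> \<lambda>q. fderiv W q (0, 1)"

context
  fixes I :: "real set"
  assumes I: "open I"
begin

lemma open_strip: "open (UNIV \<times> I :: (real \<times> real) set)"
  using I by (intro open_Times) auto

lemma smooth_Dx_iter: "smooth (UNIV \<times> I) W \<Longrightarrow> smooth (UNIV \<times> I) ((Dx ^^ j) W)"
  by (induction j) (auto intro: smooth_fderiv[OF open_strip])

lemma smooth_Dy_iter: "smooth (UNIV \<times> I) W \<Longrightarrow> smooth (UNIV \<times> I) ((Dy ^^ j) W)"
  by (induction j) (auto intro: smooth_fderiv[OF open_strip])

lemma strip_Dx:
  assumes "smooth (UNIV \<times> I) W" "y \<in> I"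
  shows "((\<lambda>x. W (x, y)) has_real_derivative Dx W (x, y)) (at x)"
  using assms by (intro has_real_derivative_Pair_left smooth_has_derivative[OF assms(1)]) auto

lemma strip_Dy:
  assumes "smooth (UNIV \<times> I) W" "y \<in> I"
  shows "((\<lambda>y. W (x, y)) has_real_derivative Dy W (x, y)) (at y)"
  using assms by (intro has_real_derivative_Pair_right smooth_has_derivative[OF assms(1)]) auto

lemma Dx_cong:
  assumes W: "smooth (UNIV \<times> I) W" and eq: "\<And>q. q \<in> UNIV \<times> I \<Longrightarrow> W q = V q" and q: "q \<in> UNIV \<times> I"
  shows "Dx W q = Dx V q"
proof -
  have "(V has_derivative fderiv W q) (at q)"
    by (rule has_derivative_transform_within_open[OF smooth_has_derivative[OF W q] open_strip q eq])
  then have "fderiv W q = fderiv V q" by (rule frechet_derivative_at)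
  then show ?thesis by simp
qed

text \<open>The C^2 norm of a difference quotient in \<open>y\<close> involves x-derivatives of
  \<open>Dy W\<close>, while the mean value theorem in \<open>y\<close> is applied to x-derivatives
  of \<open>W\<close>; commuting them reconciles the two.\<close>

lemma Dx_iter_Dy:
  assumes W: "smooth (UNIV \<times> I) W"
  shows "q \<in> UNIV \<times> I \<Longrightarrow> (Dx ^^ j) (Dy W) q = Dy ((Dx ^^ j) W) q"
proof (induction j arbitrary: q)
  case (Suc j)
  have "(Dx ^^ Suc j) (Dy W) q = Dx ((Dx ^^ j) (Dy W)) q" by simp
  also have "\<dots> = Dx (Dy ((Dx ^^ j) W)) q"
    by (rule Dx_cong[OF smooth_Dx_iter[OF smooth_fderiv[OF open_strip W]] Suc.IH Suc.prems])
  also have "\<dots> = Dy (Dx ((Dx ^^ j) W)) q"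
    using fderiv_commute[OF I smooth_Dx_iter[OF W], of "snd q" j "fst q"] Suc.prems by auto
  finally show ?case by simp
qed simp

lemma strip_Ck_on:
  assumes W: "smooth (UNIV \<times> I) W" and y: "y \<in> I" and S: "perfect S"
  shows "Ck_on n S (\<lambda>x. W (x, y))"
proof -
  have d: "((\<lambda>x. (Dx ^^ j) W (x, y)) has_real_derivative (Dx ^^ Suc j) W (x, y)) (at x within S)" for j x
    using has_field_derivative_at_within[OF strip_Dx[OF smooth_Dx_iter[OF W] y]] by simp
  show ?thesis
    by (rule Ck_on_derivI(1)[OF S, of _ "\<lambda>j x. (Dx ^^ j) W (x, y)", OF _ d DERIV_continuous_on[OF d]]) simp
qed

text \<open>The mean value theorem turns the difference quotient into \<open>Dy W\<close> at a
  nearby point, and uniform continuity on the compact set \<open>{0..L} \<times> cball y r\<close>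
  makes the error independent of \<open>x\<close>.\<close>

lemma strip_uniform_derivative:
  assumes W: "smooth (UNIV \<times> I) W" and y: "y \<in> I" and e: "e > 0"
  shows "\<forall>\<^sub>F h in at 0. y + h \<in> I \<and> (\<forall>x\<in>{0..L}. \<bar>(W (x, y + h) - W (x, y)) / h - Dy W (x, y)\<bar> \<le> e)"
proof -
  obtain r where r: "r > 0" "cball y r \<subseteq> I" using I y open_contains_cball by blast
  have "continuous_on (UNIV \<times> I) (Dy W)"
    by (intro smooth_continuous_on smooth_fderiv[OF open_strip W])
  then have "continuous_on ({0..L} \<times> cball y r) (Dy W)"
    by (rule continuous_on_subset) (use r in auto)
  then have "uniformly_continuous_on ({0..L} \<times> cball y r) (Dy W)"
    by (intro compact_uniformly_continuous compact_Times) auto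
  then obtain d where d: "d > 0" "\<And>q q'. q \<in> {0..L} \<times> cball y r \<Longrightarrow> q' \<in> {0..L} \<times> cball y r \<Longrightarrow>
      dist q' q < d \<Longrightarrow> dist (Dy W q') (Dy W q) < e"
    using e unfolding uniformly_continuous_on_def by metis
  have "\<forall>\<^sub>F h in at (0::real). dist h 0 < min d r \<and> h \<noteq> 0"
    unfolding eventually_at by (rule exI[of _ "min d r"]) (use d(1) r(1) in auto)
  then show ?thesis
  proof eventually_elim
    case (elim h)
    have inI: "z \<in> I" if "\<bar>z - y\<bar> \<le> \<bar>h\<bar>" for z
      using that elim r by (auto simp: subset_iff dist_real_def abs_minus_commute)
    have "\<bar>(W (x, y + h) - W (x, y)) / h - Dy W (x, y)\<bar> \<le> e" if x: "x \<in> {0..L}" for x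
    proof -
      have D: "((\<lambda>z. W (x, z)) has_real_derivative Dy W (x, z)) (at z)" if "\<bar>z - y\<bar> \<le> \<bar>h\<bar>" for z
        using strip_Dy[OF W inI[OF that]] .
      have "\<exists>z. min y (y + h) \<le> z \<and> z \<le> max y (y + h) \<and> W (x, y + h) - W (x, y) = (y + h - y) * Dy W (x, z)"
        by (rule mvt_between, rule D) (auto simp: min_def max_def split: if_splits)
      then obtain z where "min y (y + h) \<le> z" "z \<le> max y (y + h)" "W (x, y + h) - W (x, y) = (y + h - y) * Dy W (x, z)"
        by blast
      then have z: "\<bar>z - y\<bar> \<le> \<bar>h\<bar>" "W (x, y + h) - W (x, y) = h * Dy W (x, z)"
        by (auto simp: min_def max_def split: if_splits)
      have "dist (Dy W (x, z)) (Dy W (x, y)) < e"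
        by (rule d(2)) (use x z elim r in \<open>auto simp: dist_Pair_Pair dist_real_def abs_minus_commute\<close>)
      then show ?thesis using z elim by (simp add: dist_real_def)
    qed
    then show ?case using inI[of "y + h"] by auto
  qed
qed

lemma strip_has_C2_derivative:
  assumes W: "smooth (UNIV \<times> I) W" and y: "y \<in> I" and L: "L > 0"
  shows "has_C2_derivative L (\<lambda>y x. W (x, y)) (\<lambda>x. Dy W (x, y)) y"
  unfolding has_C2_derivative_def
proof
  show "Ck_on 2 {0..L} (\<lambda>x. Dy W (x, y))"
    by (rule strip_Ck_on[OF smooth_fderiv[OF open_strip W] y perfect_Icc[OF L]])
  show "((\<lambda>h. C2_norm L (\<lambda>x. (W (x, y + h) - W (x, y)) / h - Dy W (x, y))) \<longlongrightarrow> 0) (at 0)"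
  proof (rule tendstoI)
    fix e :: real assume "e > 0"
    \<comment> \<open>\<open>C2_norm\<close> adds three suprema, and three quarters of
      \<open>e\<close> is still strictly below \<open>e\<close>.\<close>
    then have e: "e / 4 > 0" by simp
    have "\<forall>\<^sub>F h in at 0. \<forall>j\<in>{..2}. y + h \<in> I \<and> (\<forall>x\<in>{0..L}. \<bar>((Dx ^^ j) W (x, y + h) - (Dx ^^ j) W (x, y)) / h
        - Dy ((Dx ^^ j) W) (x, y)\<bar> \<le> e / 4)"
      by (intro eventually_ball_finite ballI strip_uniform_derivative smooth_Dx_iter W y e) auto
    then show "\<forall>\<^sub>F h in at 0. dist (C2_norm L (\<lambda>x. (W (x, y + h) - W (x, y)) / h - Dy W (x, y))) 0 < e"
    proof eventually_elim
      case (elim h)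
      then have yh: "y + h \<in> I" by auto
      let ?R = "\<lambda>x. (W (x, y + h) - W (x, y)) / h - Dy W (x, y)"
      define d where "d = (\<lambda>j x. ((Dx ^^ j) W (x, y + h) - (Dx ^^ j) W (x, y)) / h - (Dx ^^ j) (Dy W) (x, y))"
      have dd: "(d j has_real_derivative d (Suc j) x) (at x within {0..L})" for j x
      proof -
        have "(d j has_real_derivative (Dx ((Dx ^^ j) W) (x, y + h) - Dx ((Dx ^^ j) W) (x, y)) / h
            - Dx ((Dx ^^ j) (Dy W)) (x, y)) (at x)"
          unfolding d_def
          by (intro DERIV_diff DERIV_cdivide strip_Dx smooth_Dx_iter smooth_fderiv[OF open_strip W] W y yh)
        then show ?thesis by (simp add: d_def has_field_derivative_at_within)
      qed
      have eq: "(Dw {0..L} ^^ j) ?R x = d j x" if "j \<le> 2" "x \<in> {0..L}" for j x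
        by (rule Ck_on_derivI(2)[OF perfect_Icc[OF L], of ?R d 2])
           (use that dd DERIV_continuous_on[OF dd] in \<open>auto simp: d_def\<close>)
      have "\<bar>C2_norm L ?R\<bar> \<le> 3 * (e / 4)"
      proof (rule C2_norm_le[OF L])
        fix j :: nat and x assume jx: "j \<le> 2" "x \<in> {0..L}"
        have "(Dx ^^ j) (Dy W) (x, y) = Dy ((Dx ^^ j) W) (x, y)"
          using Dx_iter_Dy[OF W, of "(x, y)" j] y by auto
        then show "\<bar>(Dw {0..L} ^^ j) ?R x\<bar> \<le> e / 4"
          using elim jx eq[OF jx] by (auto simp: d_def)
      qed
      then show ?case using \<open>e > 0\<close> by (simp add: dist_real_def)
    qed
  qed
qed

end

lemma smooth_C2_curve_strip:
  assumes W: "smooth (UNIV \<times> {-\<delta><..<\<delta>}) W" and L: "L > 0"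
  shows "smooth_C2_curve L \<delta> (\<lambda>y x. W (x, y))"
  unfolding smooth_C2_curve_def
proof (intro exI[of _ "\<lambda>n y x. (Dy ^^ n) W (x, y)"] conjI allI ballI)
  fix n y assume y: "y \<in> {-\<delta><..<\<delta>}"
  note sm = smooth_Dy_iter[OF open_greaterThanLessThan W, of n]
  show "Ck_on 2 {0..L} (\<lambda>x. (Dy ^^ n) W (x, y))"
    by (rule strip_Ck_on[OF open_greaterThanLessThan sm y perfect_Icc[OF L]])
  show "has_C2_derivative L (\<lambda>y x. (Dy ^^ n) W (x, y)) (\<lambda>x. (Dy ^^ Suc n) W (x, y)) y"
    using strip_has_C2_derivative[OF open_greaterThanLessThan sm y L] by simp
qed simp

section \<open>Small orbits\<close>

definition orbit :: "real \<times> real \<times> real \<Rightarrow> real \<Rightarrow> real" where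
  "orbit p x = fst p - fst (snd p) * cos (angle p x)"

text \<open>The integrand \<open>u - M\<close> after the change of variable from position to
  angle.\<close>

definition moment :: "real \<Rightarrow> real \<times> real \<times> real \<Rightarrow> real \<Rightarrow> real" where
  "moment M p t = (fst p - M - fst (snd p) * cos t) * spd p t"

lemma smooth_moment: "smooth (UNIV \<times> Gam) (\<lambda>q. moment M (snd q) (fst q))"
  unfolding moment_def by (intro smooth_intros smooth_spd)

lemma continuous_moment: "p \<in> Gam \<Longrightarrow> continuous_on UNIV (moment M p)"
  unfolding moment_def by (intro continuous_intros continuous_spd)

lemma prim_moment_pi: "p \<in> Gam \<Longrightarrow> prim (moment M p) (real j * pi) = real j * prim (moment M p) pi"
  by (rule prim_multiple_pi[OF continuous_moment]) (simp_all add: moment_def spd_minus spd_periodic)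

lemma prim_spd_pi: "p \<in> Gam \<Longrightarrow> prim (spd p) (real j * pi) = real j * prim (spd p) pi"
  by (rule prim_multiple_pi[OF continuous_spd]) (simp_all add: spd_minus spd_periodic)

lemma smooth_angle_fixed: "p \<in> Gam \<Longrightarrow> smooth UNIV (angle p)"
  using smooth_compose[OF smooth_angle smooth_Pair[OF smooth_ident smooth_const], of UNIV p] by simp

context
  fixes m r l :: real
  assumes G: "(m, r, l) \<in> Gam"
begin

text \<open>Since \<open>r * sin t / spd\<close> is the slope u', this is the squared form of the
  first integral 1 / sqrt (1 + u'^2) = 1 - \<open>wgt\<close>. It holds because \<open>amp\<close>
  makes (r sin t)^2 \<open>amp\<close> equal to 1 - (1 - \<open>wgt\<close>)^2.\<close>

lemma one_plus_slope:
  "1 + (r * sin t / spd (m, r, l) t)\<^sup>2 = 1 / (1 - wgt m r l t)\<^sup>2"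
proof -
  have w: "1 - wgt m r l t > 0" using wgt_bounds[OF G, of t] by simp
  have A: "amp m r l t > 0" by (rule amp_bounds(1)[OF G])
  have "(r * sin t / spd (m, r, l) t)\<^sup>2 = r\<^sup>2 * (sin t)\<^sup>2 * amp m r l t / (1 - wgt m r l t)\<^sup>2"
    using A w by (simp add: spd_def power_divide power_mult_distrib)
  also have "r\<^sup>2 * (sin t)\<^sup>2 * amp m r l t = 2 * wgt m r l t - (wgt m r l t)\<^sup>2"
    by (simp add: amp_def wgt_def algebra_simps power2_eq_square)
  finally have "1 + (r * sin t / spd (m, r, l) t)\<^sup>2
      = ((1 - wgt m r l t)\<^sup>2 + (2 * wgt m r l t - (wgt m r l t)\<^sup>2)) / (1 - wgt m r l t)\<^sup>2"
    using w by (simp add: add_divide_distrib)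
  also have "(1 - wgt m r l t)\<^sup>2 + (2 * wgt m r l t - (wgt m r l t)\<^sup>2) = 1"
    by (simp add: power2_eq_square algebra_simps)
  finally show ?thesis .
qed

lemma flux_form:
  "(r * sin t / spd (m, r, l) t) / sqrt (1 + (r * sin t / spd (m, r, l) t)\<^sup>2) = r * sin t * sqrt (amp m r l t)"
proof -
  have w: "1 - wgt m r l t > 0" using wgt_bounds[OF G, of t] by simp
  have "sqrt (1 + (r * sin t / spd (m, r, l) t)\<^sup>2) = 1 / (1 - wgt m r l t)"
    unfolding one_plus_slope using w by (simp add: real_sqrt_divide)
  then show ?thesis using w by (simp add: spd_def)
qed

text \<open>The square of the flux is 1 - (1 - \<open>wgt\<close>)^2, at most 2 \<open>wgt\<close>
  and so at most 1/4. On this range the slope is a Lipschitz function of the flux.\<close>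

lemma flux_form_bound: "\<bar>r * sin t * sqrt (amp m r l t)\<bar> \<le> 1 / 2"
proof -
  have w: "0 \<le> wgt m r l t" "wgt m r l t \<le> 1 / 8" using wgt_bounds[OF G, of t] by simp_all
  have "(r * sin t * sqrt (amp m r l t))\<^sup>2 = r\<^sup>2 * (sin t)\<^sup>2 * amp m r l t"
    using amp_bounds(1)[OF G, of t] by (simp add: power_mult_distrib)
  also have "\<dots> = 2 * wgt m r l t - (wgt m r l t)\<^sup>2"
    by (simp add: amp_def wgt_def algebra_simps power2_eq_square)
  also have "\<dots> \<le> (1 / 2)\<^sup>2"
  proof -
    have "(1 / 2 :: real)\<^sup>2 = 1 / 4" by (simp add: power2_eq_square)
    then show ?thesis using w zero_le_power2[of "wgt m r l t"] by linarith
  qed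
  finally have "\<bar>r * sin t * sqrt (amp m r l t)\<bar> \<le> \<bar>1 / 2\<bar>" by (simp only: abs_le_square_iff)
  then show ?thesis by simp
qed

text \<open>The differential equation in the angle variable. The constant
  \<open>m - m ^ 3 - m * r\<^sup>2\<close> is the slope of the chord of u^2/2 - u^4/4 over
  [m - r, m + r]; dividing by \<open>spd\<close> gives the equation in \<open>x\<close>.\<close>

lemma flux_form_derivative:
  "((\<lambda>t. r * sin t * sqrt (amp m r l t)) has_real_derivative
     spd (m, r, l) t * (l * (m - m ^ 3 - m * r\<^sup>2 - cubic_f (m - r * cos t)))) (at t)"
proof -
  define C S where "C = cos t" and "S = sin t"
  define K where "K = kap m r C"
  define K' where "K' = - 2 * m * r * S + r\<^sup>2 * C * S"
  define w where "w = l * r\<^sup>2 * S\<^sup>2 * K / 2"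
  define w' where "w' = l * r\<^sup>2 * (2 * S * C * K + S\<^sup>2 * K') / 2"
  define A where "A = l * K * (1 - w / 2)"
  define A' where "A' = l * K' * (1 - w / 2) - l * K * w' / 2"
  have dK: "((\<lambda>t. kap m r (cos t)) has_real_derivative K') (at t)"
    unfolding kap_def K'_def C_def S_def
    by (auto intro!: derivative_eq_intros simp: power2_eq_square)
  have dw: "((\<lambda>t. wgt m r l t) has_real_derivative w') (at t)"
  proof -
    have "((\<lambda>t. (sin t)\<^sup>2) has_real_derivative 2 * S * C) (at t)"
      unfolding S_def C_def by (auto intro!: derivative_eq_intros)
    from DERIV_cmult[OF DERIV_mult[OF this dK], of "l * r\<^sup>2 / 2"]
    have "((\<lambda>t. l * r\<^sup>2 / 2 * ((sin t)\<^sup>2 * kap m r (cos t))) has_real_derivative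
        l * r\<^sup>2 / 2 * (2 * S * C * kap m r (cos t) + K' * (sin t)\<^sup>2)) (at t)" .
    moreover have "l * r\<^sup>2 / 2 * (2 * S * C * kap m r (cos t) + K' * (sin t)\<^sup>2) = w'"
      by (simp add: w'_def K_def C_def S_def)
    moreover have "(\<lambda>t. l * r\<^sup>2 / 2 * ((sin t)\<^sup>2 * kap m r (cos t))) = wgt m r l"
      by (simp add: wgt_def fun_eq_iff)
    ultimately show ?thesis by simp
  qed
  have dA: "((\<lambda>t. amp m r l t) has_real_derivative A') (at t)"
  proof -
    have "((\<lambda>t. 1 - wgt m r l t / 2) has_real_derivative - w' / 2) (at t)"
      by (rule derivative_eq_intros dw refl | simp)+
    from DERIV_mult[OF DERIV_cmult[OF dK, of l] this]
    show ?thesis unfolding amp_def[abs_def] A'_def w_def K_def C_def S_def wgt_def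
      by (simp add: field_simps)
  qed
  have A: "amp m r l t = A" "wgt m r l t = w" by (simp_all add: A_def amp_def wgt_def w_def C_def S_def K_def)
  have Apos: "A > 0" using amp_bounds(1)[OF G, of t] A by simp
  have "((\<lambda>t. r * sin t * sqrt (amp m r l t)) has_real_derivative
     (r * C * sqrt A + r * S * (A' / (2 * sqrt A)))) (at t)"
  proof -
    have "((\<lambda>t. sqrt (amp m r l t)) has_real_derivative inverse (sqrt A) / 2 * A') (at t)"
      using DERIV_chain2[OF DERIV_real_sqrt dA] Apos by (simp add: A)
    from DERIV_mult[OF DERIV_cmult[OF DERIV_sin, of r] this]
    show ?thesis by (rule DERIV_cong) (simp add: A C_def S_def inverse_eq_divide mult_ac)
  qed
  moreover have "r * C * sqrt A + r * S * (A' / (2 * sqrt A)) = (r * C * A + r * S * A' / 2) / sqrt A"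
    using Apos by (simp add: field_simps)
  moreover have "r * C * A + r * S * A' / 2 = (1 - w) * (l * (r * C * K + r * S * K' / 2))"
  proof -
    \<comment> \<open>\<open>w\<close> is a constant times \<open>S\<^sup>2 * K\<close>, so
      \<open>K * S * w'\<close> is again a multiple of \<open>w\<close>. This lets the factor
      \<open>1 - w\<close>, the numerator of \<open>spd\<close>, split off.\<close>
    have F: "K * (S * w') = w * (2 * C * K + S * K')"
      by (simp add: w_def w'_def power2_eq_square algebra_simps)
    have "r * C * A + r * S * A' / 2
        = r * C * l * K * (1 - w / 2) + r * S * l * K' * (1 - w / 2) / 2 - r * l * (K * (S * w')) / 4"
      by (simp add: A_def A'_def field_simps)
    then show ?thesis unfolding F by (simp add: field_simps)
  qed
  moreover have "r * C * K + r * S * K' / 2 = m - m ^ 3 - m * r\<^sup>2 - cubic_f (m - r * C)"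
  proof -
    have S2: "S\<^sup>2 = 1 - C\<^sup>2" unfolding S_def C_def by (rule sin_squared_eq)
    have "r * S * K' / 2 = S\<^sup>2 * (r\<^sup>2 * (r * C / 2 - m))"
      unfolding K'_def by (simp add: field_simps power2_eq_square)
    then show ?thesis unfolding S2 K_def kap_def cubic_f_def
      by (simp add: field_simps power2_eq_square power3_eq_cube)
  qed
  moreover have "spd (m, r, l) t = (1 - w) / sqrt A" by (simp add: spd_def A)
  ultimately show ?thesis by (simp add: C_def)
qed

lemma orbit_derivative: "(orbit (m, r, l) has_real_derivative r * sin (angle (m, r, l) x) / spd (m, r, l) (angle (m, r, l) x)) (at x)"
  unfolding orbit_def using angle_has_real_derivative[OF G, of x]
  by (auto intro!: derivative_eq_intros)

lemma smooth_orbit: "smooth UNIV (orbit (m, r, l))"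
  unfolding orbit_def by (intro smooth_intros smooth_angle_fixed G)

lemma orbit_Dw: "L > 0 \<Longrightarrow> x \<in> {0..L} \<Longrightarrow> Dw {0..L} (orbit (m, r, l)) x = r * sin (angle (m, r, l) x) / spd (m, r, l) (angle (m, r, l) x)"
  by (rule Dw_eqI[OF perfect_Icc]) (auto intro: has_field_derivative_at_within orbit_derivative)

lemma orbit_flux:
  "L > 0 \<Longrightarrow> x \<in> {0..L} \<Longrightarrow> flux L (orbit (m, r, l)) x = r * sin (angle (m, r, l) x) * sqrt (amp m r l (angle (m, r, l) x))"
  by (simp only: flux_def orbit_Dw flux_form)

lemma orbit_flux_derivative:
  "((\<lambda>x. r * sin (angle (m, r, l) x) * sqrt (amp m r l (angle (m, r, l) x))) has_real_derivative
     l * (m - m ^ 3 - m * r\<^sup>2 - cubic_f (orbit (m, r, l) x))) (at x)"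
  using DERIV_chain2[OF flux_form_derivative angle_has_real_derivative[OF G, of x]]
    spd_pos[OF G, of "angle (m, r, l) x"] by (simp add: orbit_def)

lemma orbit_mean:
  assumes "L > 0"
  shows "((\<lambda>x. orbit (m, r, l) x - M) has_integral prim (moment M (m, r, l)) (angle (m, r, l) L)) {0..L}"
proof -
  have "((\<lambda>x. prim (moment M (m, r, l)) (angle (m, r, l) x)) has_real_derivative orbit (m, r, l) x - M) (at x)" for x
    using DERIV_chain2[OF prim_has_real_derivative[OF continuous_moment[OF G]]
        angle_has_real_derivative[OF G, of x], of M] spd_pos[OF G, of "angle (m, r, l) x"]
    by (simp add: orbit_def moment_def algebra_simps)
  then have "((\<lambda>x. orbit (m, r, l) x - M) has_integral
      prim (moment M (m, r, l)) (angle (m, r, l) L) - prim (moment M (m, r, l)) (angle (m, r, l) 0)) {0..L}"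
    using assms by (intro has_integral_real_derivative) auto
  then show ?thesis by (simp add: angle_0[OF G])
qed

lemma orbit_is_solution:
  assumes L: "L > 0" and ang: "angle (m, r, l) L = real k * pi" and mean: "prim (moment M (m, r, l)) pi = 0"
  shows "is_solution L M l (orbit (m, r, l))"
proof -
  let ?u = "orbit (m, r, l)" and ?s = "m - m ^ 3 - m * r\<^sup>2"
  let ?z = "\<lambda>x. r * sin (angle (m, r, l) x) * sqrt (amp m r l (angle (m, r, l) x))"
  have "smooth (UNIV \<times> UNIV) (\<lambda>q :: real \<times> real. ?u (fst q))"
    by (rule smooth_compose[OF smooth_orbit]) (auto intro: smooth_intros)
  note C = strip_Ck_on[OF open_UNIV this UNIV_I, simplified]
  \<comment> \<open>The flux vanishes at both ends, so integrating the equation forces the chord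
    slope \<open>?s\<close> to be the mean of \<open>cubic_f\<close> along the orbit: the nonlocal
    term comes out right by itself.\<close>
  have "((\<lambda>x. l * (?s - cubic_f (?u x))) has_integral ?z L - ?z 0) {0..L}"
    using L orbit_flux_derivative by (intro has_integral_real_derivative) auto
  then have 0: "((\<lambda>x. l * (?s - cubic_f (?u x))) has_integral 0) {0..L}"
    by (simp add: ang angle_0[OF G])
  have "continuous_on {0..L} ?u"
    using smooth_continuous_on[OF smooth_orbit] continuous_on_subset by blast
  then have "continuous_on {0..L} (\<lambda>x. cubic_f (?u x))"
    unfolding cubic_f_def by (intro continuous_intros)
  then have i: "(\<lambda>x. cubic_f (?u x)) integrable_on {0..L}" by (rule integrable_continuous_interval)
  have "((\<lambda>x. l * (?s - cubic_f (?u x))) has_integral l * (L * ?s - integral {0..L} (\<lambda>x. cubic_f (?u x)))) {0..L}"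
    using has_integral_const_real[of ?s 0 L] L
    by (intro has_integral_mult_right has_integral_diff integrable_integral[OF i]) auto
  from has_integral_unique[OF this 0] have s: "integral {0..L} (\<lambda>x. cubic_f (?u x)) = L * ?s"
    using l_pos[OF G] by simp
  have dflux: "deriv (flux L ?u) x = l * (?s - cubic_f (?u x))" if "x \<in> {0<..<L}" for x
    by (rule DERIV_imp_deriv, rule has_field_derivative_transform_within_open[OF orbit_flux_derivative, where S="{0<..<L}"])
       (use that orbit_flux[OF L] in auto)
  have "(?u has_integral 0 + M * L) {0..L}"
    using has_integral_add[OF orbit_mean[OF L, of M] has_integral_const_real[of M 0 L]] L mean
    by (simp add: ang prim_moment_pi[OF G] mult.commute[of L])
  then have mn: "integral {0..L} ?u = M * L" by (simp add: integral_unique)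
  have eqn: "deriv (flux L ?u) x + l * cubic_f (?u x) - l / L * integral {0..L} (\<lambda>s. cubic_f (?u s)) = 0"
    if "x \<in> {0<..<L}" for x
    unfolding s dflux[OF that] using L by (simp add: algebra_simps)
  have "Dw {0..L} ?u 0 = 0" "Dw {0..L} ?u L = 0"
    using orbit_Dw[OF L, of 0] orbit_Dw[OF L, of L] L by (simp_all add: angle_0[OF G] ang)
  then show ?thesis
    unfolding is_solution_def mn
    using L l_pos[OF G] C perfect_open[of "{0<..<L}"] perfect_Icc[OF L] eqn by simp
qed

end

section \<open>Uniqueness for the initial value problem\<close>

lemma slope_of_flux:
  fixes p :: real
  assumes "z = p / sqrt (1 + p\<^sup>2)"
  shows "p = z / sqrt (1 - z\<^sup>2)"
proof -
  have q: "1 + p\<^sup>2 > 0" by (simp add: add_pos_nonneg)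
  have "z\<^sup>2 = p\<^sup>2 / (1 + p\<^sup>2)" using q assms by (simp add: power_divide)
  then have "1 - z\<^sup>2 = 1 / (1 + p\<^sup>2)" using q by (simp add: field_simps)
  then have "sqrt (1 - z\<^sup>2) = 1 / sqrt (1 + p\<^sup>2)" by (simp add: real_sqrt_divide)
  then show ?thesis using q assms by simp
qed

lemma flux_abs_le: "\<bar>flux L u x\<bar> \<le> \<bar>Dw {0..L} u x\<bar>"
proof -
  have "1 \<le> sqrt (1 + (Dw {0..L} u x)\<^sup>2)" by simp
  then have "\<bar>Dw {0..L} u x\<bar> / sqrt (1 + (Dw {0..L} u x)\<^sup>2) \<le> \<bar>Dw {0..L} u x\<bar> / 1"
    by (intro divide_left_mono) (auto simp: add_pos_nonneg)
  then show ?thesis unfolding flux_def by (simp add: abs_divide)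
qed

text \<open>The derivative of z / sqrt (1 - z^2) is (1 - z^2)^(-3/2). For |z| at most 1/2 it is at
  most 16/9, from 1 - z^2 \<ge> 3/4 and the cruder sqrt (1 - z^2) \<ge> 3/4.\<close>

lemma slope_lipschitz:
  fixes a b :: real
  assumes "\<bar>a\<bar> \<le> 1 / 2" "\<bar>b\<bar> \<le> 1 / 2"
  shows "\<bar>a / sqrt (1 - a\<^sup>2) - b / sqrt (1 - b\<^sup>2)\<bar> \<le> 2 * \<bar>a - b\<bar>"
proof -
  have sq: "z\<^sup>2 \<le> 1 / 4" if "z \<in> {-1/2..1/2}" for z :: real
    using that abs_le_square_iff[of z "1/2"] by (auto simp: power2_eq_square)
  have "norm (a / sqrt (1 - a\<^sup>2) - b / sqrt (1 - b\<^sup>2)) \<le> 2 * norm (a - b)"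
  proof (rule field_differentiable_bound[where S="{-1/2..1/2}" and f'="\<lambda>z. 1 / ((1 - z\<^sup>2) * sqrt (1 - z\<^sup>2))"])
    fix z :: real assume z: "z \<in> {-1/2..1/2}"
    have q: "1 - z\<^sup>2 \<ge> 3 / 4" using sq[OF z] by simp
    have "((\<lambda>z. 1 - z\<^sup>2) has_real_derivative - (2 * z)) (at z)"
      by (auto intro!: derivative_eq_intros)
    from DERIV_chain2[OF DERIV_real_sqrt this]
    have "((\<lambda>z. sqrt (1 - z\<^sup>2)) has_real_derivative - z / sqrt (1 - z\<^sup>2)) (at z)"
      using q by (simp add: inverse_eq_divide)
    from DERIV_divide[OF DERIV_ident this]
    have "((\<lambda>z. z / sqrt (1 - z\<^sup>2)) has_real_derivative
       (1 * sqrt (1 - z\<^sup>2) - z * (- z / sqrt (1 - z\<^sup>2))) / (sqrt (1 - z\<^sup>2))\<^sup>2) (at z)"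
      using q by (simp add: power2_eq_square)
    moreover have "(1 * sqrt (1 - z\<^sup>2) - z * (- z / sqrt (1 - z\<^sup>2))) / (sqrt (1 - z\<^sup>2))\<^sup>2
        = 1 / ((1 - z\<^sup>2) * sqrt (1 - z\<^sup>2))"
    proof -
      define s where "s = sqrt (1 - z\<^sup>2)"
      have "s > 0" "s\<^sup>2 = 1 - z\<^sup>2" using q by (auto simp: s_def)
      then have "(1 * s - z * (- z / s)) / s\<^sup>2 = (s\<^sup>2 + z\<^sup>2) / (s\<^sup>2 * s)"
        by (simp add: field_simps power2_eq_square)
      also have "s\<^sup>2 + z\<^sup>2 = 1" using \<open>s\<^sup>2 = 1 - z\<^sup>2\<close> by simp
      finally show ?thesis using \<open>s\<^sup>2 = 1 - z\<^sup>2\<close> by (simp add: s_def)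
    qed
    ultimately show "((\<lambda>z. z / sqrt (1 - z\<^sup>2)) has_real_derivative 1 / ((1 - z\<^sup>2) * sqrt (1 - z\<^sup>2)))
        (at z within {-1/2..1/2})"
      by (simp add: has_field_derivative_at_within)
    have "3 / 4 * (3 / 4) \<le> (1 - z\<^sup>2) * sqrt (1 - z\<^sup>2)"
    proof (rule mult_mono)
      show "3 / 4 \<le> sqrt (1 - z\<^sup>2)"
        by (rule real_le_rsqrt) (use q in \<open>simp add: power2_eq_square\<close>)
    qed (use q in auto)
    then show "norm (1 / ((1 - z\<^sup>2) * sqrt (1 - z\<^sup>2))) \<le> 2"
      using q by (simp add: divide_le_eq)
  qed (use assms in auto)
  then show ?thesis by simp
qed

text \<open>The product of \<open>E\<close> with \<open>exp (- K * x)\<close> is nonincreasing and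
  starts at 0.\<close>

lemma gronwall_zero:
  fixes E :: "real \<Rightarrow> real"
  assumes cont: "continuous_on {0..L} E" and 0: "E 0 = 0" and nonneg: "\<And>x. x \<in> {0..L} \<Longrightarrow> 0 \<le> E x"
    and der: "\<And>x. x \<in> {0<..<L} \<Longrightarrow> (E has_real_derivative E' x) (at x)"
    and le: "\<And>x. x \<in> {0<..<L} \<Longrightarrow> E' x \<le> K * E x" and x: "x \<in> {0..L}"
  shows "E x = 0"
proof -
  let ?F = "\<lambda>x. E x * exp (- K * x)"
  have "?F 0 \<ge> ?F x"
  proof (rule DERIV_nonpos_imp_decreasing_open[where f="?F"])
    show "continuous_on {0..x} ?F"
      by (intro continuous_intros continuous_on_subset[OF cont]) (use x in auto)
    fix z assume z: "0 < z" "z < x"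
    then have zL: "z \<in> {0<..<L}" using x by auto
    have "(?F has_real_derivative (E' z - K * E z) * exp (- K * z)) (at z)"
      by (rule derivative_eq_intros der[OF zL] refl | simp)+ (simp add: algebra_simps)
    moreover have "(E' z - K * E z) * exp (- K * z) \<le> 0"
      using le[OF zL] by (simp add: mult_nonpos_nonneg)
    ultimately show "\<exists>y. (?F has_real_derivative y) (at z) \<and> y \<le> 0" by blast
  qed (use x in auto)
  then have "E x * exp (- K * x) \<le> 0" using 0 by simp
  then have "E x \<le> 0" by (simp add: mult_le_0_iff)
  then show ?thesis using nonneg[OF x] by simp
qed

text \<open>\<open>is_solution\<close> speaks of \<open>deriv\<close>, which by itself does not
  assert that a derivative exists; the C^2 regularity supplies that.\<close>

lemma flux_differentiable:
  assumes L: "L > 0" and C: "Ck_on 2 {0..L} u" and x: "x \<in> {0<..<L}"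
  shows "(flux L u has_real_derivative deriv (flux L u) x) (at x)"
proof -
  have "(Dw {0..L} u has_real_derivative (Dw {0..L} ^^ 2) u x) (at x within {0..L})"
    using Ck_on_has_derivative[OF C, of 1 x] x by (simp add: numeral_2_eq_2)
  then have D: "(Dw {0..L} u has_real_derivative (Dw {0..L} ^^ 2) u x) (at x)"
    using x by (simp add: at_within_Icc_at)
  have q: "1 + (Dw {0..L} u x)\<^sup>2 > 0" by (simp add: add_pos_nonneg)
  have "\<exists>d. ((\<lambda>x. Dw {0..L} u x / sqrt (1 + (Dw {0..L} u x)\<^sup>2)) has_real_derivative d) (at x)"
    by (rule exI, (rule derivative_eq_intros D refl | use q in simp)+)
  then have "\<exists>d. (flux L u has_real_derivative d) (at x)" by (simp add: flux_def[abs_def])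
  then show ?thesis using DERIV_imp_deriv by blast
qed

lemma flux_continuous:
  assumes C: "Ck_on 2 {0..L} u" shows "continuous_on {0..L} (flux L u)"
proof -
  have q: "1 + (Dw {0..L} u x)\<^sup>2 \<noteq> 0" for x by (smt (verit) zero_le_power2)
  have "continuous_on {0..L} (Dw {0..L} u)" using Ck_on_continuous[OF C, of 1] by simp
  then show ?thesis unfolding flux_def using q by (intro continuous_intros) auto
qed

text \<open>The pair of \<open>u\<close> and its flux solves a first-order system whose right-hand
  side is Lipschitz while the flux stays within 1/2, so Gronwall applies to the squared distance
  \<open>E\<close> from the orbit.\<close>

lemma orbit_unique:
  assumes G: "(m, r, l) \<in> Gam" and L: "L > 0" and C: "Ck_on 2 {0..L} u"
    and ode: "\<And>x. x \<in> {0<..<L} \<Longrightarrow> deriv (flux L u) x = l * (m - m ^ 3 - m * r\<^sup>2 - cubic_f (u x))"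
    and ini: "u 0 = m - r" "Dw {0..L} u 0 = 0"
    and small: "\<And>x. x \<in> {0..L} \<Longrightarrow> \<bar>Dw {0..L} u x\<bar> \<le> 1 / 2" and x: "x \<in> {0..L}"
  shows "u x = orbit (m, r, l) x"
proof -
  let ?o = "orbit (m, r, l)" and ?\<theta> = "angle (m, r, l)"
  let ?po = "\<lambda>y. r * sin (?\<theta> y) / spd (m, r, l) (?\<theta> y)"
  define z where "z = flux L u"
  define zo where "zo = (\<lambda>x. r * sin (?\<theta> x) * sqrt (amp m r l (?\<theta> x)))"
  have cu: "continuous_on {0..L} u" using Ck_on_continuous[OF C, of 0] by simp
  have co: "continuous_on {0..L} ?o"
    using smooth_continuous_on[OF smooth_orbit[OF G]] continuous_on_subset by blast
  have czo: "continuous_on {0..L} zo"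
    by (rule DERIV_continuous_on[OF has_field_derivative_at_within[OF orbit_flux_derivative[OF G]], folded zo_def])
  have cz: "continuous_on {0..L} z" unfolding z_def by (rule flux_continuous[OF C])
  have "compact (?o ` {0..L} \<union> u ` {0..L})"
    by (intro compact_Un compact_continuous_image cu co) auto
  then have "bounded (?o ` {0..L} \<union> u ` {0..L})" by (rule compact_imp_bounded)
  then obtain R where R: "\<And>a. a \<in> ?o ` {0..L} \<union> u ` {0..L} \<Longrightarrow> \<bar>a\<bar> \<le> R"
    unfolding bounded_iff by auto
  define B where "B = 1 + 3 * R\<^sup>2"
  have lip: "\<bar>cubic_f (u y) - cubic_f (?o y)\<bar> \<le> B * \<bar>u y - ?o y\<bar>" if "y \<in> {0..L}" for y
  proof -
    have "\<bar>u y\<bar> \<le> R" "\<bar>?o y\<bar> \<le> R" using R that by auto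
    then have "\<bar>u y * u y\<bar> \<le> R * R" "\<bar>u y * ?o y\<bar> \<le> R * R" "\<bar>?o y * ?o y\<bar> \<le> R * R"
      unfolding abs_mult by (intro mult_mono; simp)+
    then have "\<bar>1 - (u y * u y + u y * ?o y + ?o y * ?o y)\<bar> \<le> B"
      unfolding B_def power2_eq_square by linarith
    moreover have "cubic_f (u y) - cubic_f (?o y) = (1 - (u y * u y + u y * ?o y + ?o y * ?o y)) * (u y - ?o y)"
      by (simp add: cubic_f_def algebra_simps power3_eq_cube)
    ultimately show ?thesis by (simp add: abs_mult mult_right_mono)
  qed
  define E where "E = (\<lambda>x. (u x - ?o x)\<^sup>2 + (z x - zo x)\<^sup>2)"
  define E' where "E' = (\<lambda>x. 2 * (u x - ?o x) * (Dw {0..L} u x - ?po x)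
     + 2 * (z x - zo x) * (- l * (cubic_f (u x) - cubic_f (?o x))))"
  have "E x = 0"
  \<comment> \<open>With \<open>a\<close> and \<open>b\<close> the distances of the values and of
    the fluxes, \<open>E'\<close> is at most 4 a b + 2 l B a b, and 2 a b is at most
    \<open>E\<close>; this gives the rate \<open>2 + l * B\<close>.\<close>
  proof (rule gronwall_zero[where E=E and x=x and E'=E' and K="2 + l * B" and L=L])
    show "continuous_on {0..L} E" unfolding E_def by (intro continuous_intros cu co cz czo)
    show "E 0 = 0" using ini by (simp add: E_def z_def zo_def orbit_def angle_0[OF G] flux_def)
    fix y assume y: "y \<in> {0<..<L}"
    then have y': "y \<in> {0..L}" by auto
    have "(u has_real_derivative Dw {0..L} u y) (at y within {0..L})"
      using Ck_on_has_derivative[OF C, of 0 y] y by simp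
    then have du: "(u has_real_derivative Dw {0..L} u y) (at y)" using y by (simp add: at_within_Icc_at)
    have dz: "(z has_real_derivative l * (m - m ^ 3 - m * r\<^sup>2 - cubic_f (u y))) (at y)"
      using flux_differentiable[OF L C y] ode[OF y] by (simp add: z_def)
    have dzo: "(zo has_real_derivative l * (m - m ^ 3 - m * r\<^sup>2 - cubic_f (?o y))) (at y)"
      unfolding zo_def by (rule orbit_flux_derivative[OF G])
    show "(E has_real_derivative E' y) (at y)"
      unfolding E_def E'_def
      by (rule derivative_eq_intros du dz dzo orbit_derivative[OF G] refl | simp)+ (simp add: algebra_simps)
    have zs: "\<bar>z y\<bar> \<le> 1 / 2" using flux_abs_le[of L u y] small[OF y'] by (simp add: z_def)
    have zos: "\<bar>zo y\<bar> \<le> 1 / 2" unfolding zo_def by (rule flux_form_bound[OF G])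
    have p: "Dw {0..L} u y = z y / sqrt (1 - (z y)\<^sup>2)"
      by (rule slope_of_flux) (simp add: z_def flux_def)
    have po: "?po y = zo y / sqrt (1 - (zo y)\<^sup>2)"
      by (rule slope_of_flux) (simp only: zo_def flux_form[OF G])
    have pp: "\<bar>Dw {0..L} u y - ?po y\<bar> \<le> 2 * \<bar>z y - zo y\<bar>"
      unfolding p po by (rule slope_lipschitz[OF zs zos])
    define a b where "a = \<bar>u y - ?o y\<bar>" and "b = \<bar>z y - zo y\<bar>"
    have ab: "2 * (a * b) \<le> E y" "0 \<le> a" "0 \<le> b"
      using sum_squares_bound[of a b] by (auto simp: E_def a_def b_def)
    have 1: "2 * (u y - ?o y) * (Dw {0..L} u y - ?po y) \<le> 2 * (a * (2 * b))"
    proof -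
      have "\<bar>(u y - ?o y) * (Dw {0..L} u y - ?po y)\<bar> \<le> a * (2 * b)"
        unfolding abs_mult a_def b_def by (intro mult_left_mono pp) auto
      then show ?thesis by linarith
    qed
    have 2: "2 * (z y - zo y) * (- l * (cubic_f (u y) - cubic_f (?o y))) \<le> 2 * (b * (l * (B * a)))"
    proof -
      have "\<bar>(z y - zo y) * (l * (cubic_f (u y) - cubic_f (?o y)))\<bar> \<le> b * (l * (B * a))"
        unfolding abs_mult a_def b_def using l_pos[OF G] lip[OF y'] by (intro mult_left_mono) auto
      moreover have "2 * (z y - zo y) * (- l * (cubic_f (u y) - cubic_f (?o y)))
          = - 2 * ((z y - zo y) * (l * (cubic_f (u y) - cubic_f (?o y))))" by simp
      ultimately show ?thesis by linarith
    qed
    have lB: "0 \<le> l * B" using l_pos[OF G] by (simp add: B_def)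
    have "E' y \<le> (2 + l * B) * (2 * (a * b))"
      unfolding E'_def using 1 2 by (simp add: algebra_simps)
    also have "\<dots> \<le> (2 + l * B) * E y" using ab lB by (intro mult_left_mono) auto
    finally show "E' y \<le> (2 + l * B) * E y" .
  qed (use x in \<open>auto simp: E_def\<close>)
  then show ?thesis by (simp add: E_def sum_power2_eq_zero_iff)
qed

section \<open>The bifurcating branch\<close>

lemma deriv_cubic_f: "deriv cubic_f M = 1 - 3 * M\<^sup>2"
  unfolding cubic_f_def[abs_def]
  by (rule DERIV_imp_deriv) (auto intro!: derivative_eq_intros simp: power2_eq_square)

lemma even_deriv_0:
  fixes f :: "real \<Rightarrow> real"
  assumes d: "(f has_real_derivative d) (at 0)" and r: "0 < \<rho>" and even: "\<And>x. \<bar>x\<bar> < \<rho> \<Longrightarrow> f (- x) = f x"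
  shows "d = 0"
proof -
  have "((\<lambda>x. f (- x)) has_real_derivative - d) (at 0)"
    using d by (simp add: DERIV_mirror[of f _ 0, simplified])
  moreover have "((\<lambda>x. f (- x)) has_real_derivative d) (at 0)"
    by (rule has_field_derivative_transform_within_open[OF d, of "{-\<rho><..<\<rho>}"]) (use r even in auto)
  ultimately have "- d = d" by (rule DERIV_unique)
  then show ?thesis by simp
qed

lemma second_order_limit:
  fixes f :: "real \<Rightarrow> real"
  assumes d: "\<forall>\<^sub>F x in at 0. (f has_real_derivative f1 x) (at x)" "(f has_real_derivative 0) (at 0)"
    and d1: "(f1 has_real_derivative c) (at 0)" and 0: "f1 0 = 0"
  shows "((\<lambda>x. (f x - f 0) / x\<^sup>2) \<longlongrightarrow> c / 2) (at 0)"
proof (rule lhopital[where f'=f1 and g'="\<lambda>x. 2 * x"])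
  have "isCont f 0" using d(2) DERIV_isCont by blast
  then have "((\<lambda>x. f x - f 0) \<longlongrightarrow> f 0 - f 0) (at 0)"
    unfolding isCont_def by (intro tendsto_intros)
  then show "((\<lambda>x. f x - f 0) \<longlongrightarrow> 0) (at 0)" by simp
  have "((\<lambda>x::real. x\<^sup>2) \<longlongrightarrow> 0\<^sup>2) (at 0)" by (intro tendsto_intros)
  then show "((\<lambda>x::real. x\<^sup>2) \<longlongrightarrow> 0) (at 0)" by simp
  show "\<forall>\<^sub>F x::real in at 0. x\<^sup>2 \<noteq> 0" "\<forall>\<^sub>F x::real in at 0. 2 * x \<noteq> 0"
    by (auto simp: eventually_at_filter)
  show "\<forall>\<^sub>F x in at 0. ((\<lambda>x. f x - f 0) has_real_derivative f1 x) (at x)"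
    using d(1) by eventually_elim (auto intro!: derivative_eq_intros)
  show "\<forall>\<^sub>F x::real in at 0. ((\<lambda>x. x\<^sup>2) has_real_derivative 2 * x) (at x)"
    by (auto intro!: always_eventually derivative_eq_intros)
  have "((\<lambda>x. f1 x / x) \<longlongrightarrow> c) (at 0)"
    using d1 0 by (simp add: DERIV_def)
  from tendsto_divide[OF this tendsto_const[of 2]]
  show "((\<lambda>x. f1 x / (2 * x)) \<longlongrightarrow> c / 2) (at 0)" by (simp add: mult.commute)
qed

lemma smooth_real_deriv:
  fixes f :: "real \<Rightarrow> real"
  assumes "open S" "smooth S f"
  obtains f1 where "\<And>x. x \<in> S \<Longrightarrow> (f has_real_derivative f1 x) (at x)" "smooth S f1"
proof
  show "smooth S (\<lambda>x. fderiv f x 1)" by (rule smooth_fderiv[OF assms])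
  fix x assume "x \<in> S"
  then show "(f has_real_derivative fderiv f x 1) (at x)"
    by (intro has_derivative_imp_real smooth_has_derivative[OF assms(2)])
qed

text \<open>Evenness removes the first-order term. Later this provides the quadratic bound on the
  shift of \<open>m\<close> that keeps the mean equal to \<open>M\<close>.\<close>

lemma even_second_order_limit:
  fixes f :: "real \<Rightarrow> real"
  assumes r: "0 < \<rho>" and sm: "smooth (ball 0 \<rho>) f" and even: "\<And>x. \<bar>x\<bar> < \<rho> \<Longrightarrow> f (- x) = f x"
  obtains c where "((\<lambda>x. (f x - f 0) / x\<^sup>2) \<longlongrightarrow> c) (at 0)"
proof -
  obtain f1 where f1: "\<And>x. x \<in> ball 0 \<rho> \<Longrightarrow> (f has_real_derivative f1 x) (at x)" "smooth (ball 0 \<rho>) f1"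
    using smooth_real_deriv[OF open_ball sm] by blast
  obtain f2 where f2: "\<And>x. x \<in> ball 0 \<rho> \<Longrightarrow> (f1 has_real_derivative f2 x) (at x)"
    using smooth_real_deriv[OF open_ball f1(2)] by blast
  have z: "f1 0 = 0" using even_deriv_0[OF f1(1) r even] r by simp
  have "\<forall>\<^sub>F x in at 0. x \<in> ball 0 \<rho>"
    using r by (intro eventually_at_in_open') auto
  then have ev: "\<forall>\<^sub>F x in at 0. (f has_real_derivative f1 x) (at x)"
    by eventually_elim (rule f1)
  have 0: "(0::real) \<in> ball 0 \<rho>" using r by simp
  then have "(f has_real_derivative 0) (at 0)" using f1(1)[OF 0] z by simp
  from second_order_limit[OF ev this f2[OF 0] z] show ?thesis by (rule that)
qed

definition halfperiod :: "real \<times> real \<times> real \<Rightarrow> real" where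
  "halfperiod p = prim (spd p) pi"

definition defect :: "real \<Rightarrow> real \<times> real \<times> real \<Rightarrow> real" where
  "defect M p = prim (moment M p) pi"

lemma smooth_halfperiod: "smooth Gam halfperiod"
proof -
  have "smooth Gam (\<lambda>p. prim (spd (snd (pi, p))) (fst (pi, p)))"
    by (rule smooth_compose[OF smooth_prim[OF open_Gam smooth_spd], of Gam "\<lambda>p. (pi, p)"])
       (auto intro!: smooth_Pair smooth_const smooth_ident)
  then show ?thesis by (simp add: halfperiod_def[abs_def])
qed

lemma smooth_defect: "smooth Gam (defect M)"
proof -
  have "smooth Gam (\<lambda>p. prim (moment M (snd (pi, p))) (fst (pi, p)))"
    by (rule smooth_compose[OF smooth_prim[OF open_Gam smooth_moment], of Gam "\<lambda>p. (pi, p)"])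
       (auto intro!: smooth_Pair smooth_const smooth_ident)
  then show ?thesis by (simp add: defect_def[abs_def])
qed

lemma prim_const: "prim (\<lambda>t. c) x = c * x"
  by (simp add: prim_def)

lemma halfperiod_0: "halfperiod (m, 0, l) = pi / sqrt (l * (1 - 3 * m\<^sup>2))"
proof -
  have "spd (m, 0, l) = (\<lambda>t. 1 / sqrt (l * (1 - 3 * m\<^sup>2)))" using spd_0 by blast
  then show ?thesis by (simp add: halfperiod_def prim_const)
qed

lemma defect_0: "defect M (m, 0, l) = (m - M) * (pi / sqrt (l * (1 - 3 * m\<^sup>2)))"
proof -
  have "moment M (m, 0, l) = (\<lambda>t. (m - M) / sqrt (l * (1 - 3 * m\<^sup>2)))"
    by (simp add: moment_def[abs_def] spd_0)
  then show ?thesis by (simp add: defect_def prim_const)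
qed

lemma integral_reflect_pi:
  fixes f :: "real \<Rightarrow> real"
  shows "integral {0..pi} (\<lambda>t. f (pi - t)) = integral {0..pi} f"
proof -
  have "integral {0..pi} (\<lambda>t. f (pi - t)) = integral {- pi..0} (f \<circ> (\<lambda>x. x + pi))"
    using Henstock_Kurzweil_Integration.integral_reflect_real[where f="\<lambda>t. f (pi - t)" and a=0 and b=pi] by (simp add: o_def add.commute)
  also have "\<dots> = integral {- pi + pi..0 + pi} f"
    using integral_shift_real_ivl[of "-pi + pi" pi "0 + pi" f] by (simp add: o_def)
  finally show ?thesis by simp
qed

lemma Gam_minus: "(m, - r, l) \<in> Gam \<longleftrightarrow> (m, r, l) \<in> Gam"
  by (simp add: Gam_iff abs_mult)

lemma halfperiod_minus: "(m, r, l) \<in> Gam \<Longrightarrow> halfperiod (m, - r, l) = halfperiod (m, r, l)"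
proof -
  assume G: "(m, r, l) \<in> Gam"
  then have G': "(m, - r, l) \<in> Gam" by (simp add: Gam_minus)
  have "halfperiod (m, - r, l) = integral {0..pi} (\<lambda>t. spd (m, - r, l) (pi - t))"
    using prim_eq_integral[OF continuous_spd[OF G'], of pi] integral_reflect_pi[of "spd (m, - r, l)"]
    by (simp add: halfperiod_def)
  also have "\<dots> = halfperiod (m, r, l)"
    unfolding spd_reflect halfperiod_def using prim_eq_integral[OF continuous_spd[OF G], of pi] by simp
  finally show ?thesis .
qed

lemma defect_minus: "(m, r, l) \<in> Gam \<Longrightarrow> defect M (m, - r, l) = defect M (m, r, l)"
proof -
  assume G: "(m, r, l) \<in> Gam"
  then have G': "(m, - r, l) \<in> Gam" by (simp add: Gam_minus)
  have "defect M (m, - r, l) = integral {0..pi} (\<lambda>t. moment M (m, - r, l) (pi - t))"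
    using prim_eq_integral[OF continuous_moment[OF G'], of pi] integral_reflect_pi[of "moment M (m, - r, l)"]
    by (simp add: defect_def)
  also have "(\<lambda>t. moment M (m, - r, l) (pi - t)) = moment M (m, r, l)"
    by (auto simp: moment_def spd_reflect)
  also have "integral {0..pi} (moment M (m, r, l)) = defect M (m, r, l)"
    unfolding defect_def using prim_eq_integral[OF continuous_moment[OF G], of pi] by simp
  finally show ?thesis .
qed

section \<open>The mean-value and half-period equations\<close>

locale neumann_bifurcation =
  fixes L M :: real and k :: nat
  assumes L: "L > 0" and k: "k \<ge> 1" and M: "3 * M\<^sup>2 < 1"
begin

definition "K = 1 - 3 * M\<^sup>2"
definition "lam0 = lambda_k L M k"

abbreviation "mbox \<eta> \<equiv> {M-\<eta><..<M+\<eta>}"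
abbreviation "lbox \<eta> \<equiv> {lam0-\<eta><..<lam0+\<eta>}"

lemma K: "K > 0" using M by (simp add: K_def)

text \<open>The defining property of \<open>lam0\<close>: the equation linearized at
  \<open>M\<close> has frequency k pi / L, that of the k-th cosine.\<close>

lemma lam0_K: "lam0 * K = (real k * pi / L)\<^sup>2"
  using K L by (simp add: lam0_def lambda_k_def deriv_cubic_f K_def power_divide power_mult_distrib)

lemma lam0: "lam0 > 0"
proof -
  have "lam0 * K > 0" unfolding lam0_K using L k by simp
  then show ?thesis using K by (simp add: zero_less_mult_iff)
qed

lemma sqrt_lam0_K: "sqrt (lam0 * K) = real k * pi / L"
  unfolding lam0_K using L by simp

lemma base_Gam: "(M, 0, lam0) \<in> Gam"
  using M lam0 by (simp add: Gam_iff)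

lemma halfperiod_base: "halfperiod (M, 0, lam0) = L / real k"
  using sqrt_lam0_K L k by (simp add: halfperiod_0 K_def)

lemma halfperiod_deriv_m:
  "((\<lambda>m. halfperiod (m, 0, lam0)) has_real_derivative L / real k * (3 * M / K)) (at M)"
proof -
  have p: "lam0 * (1 - 3 * M\<^sup>2) > 0" using lam0 K by (simp add: K_def)
  have "((\<lambda>m. lam0 * (1 - 3 * m\<^sup>2)) has_real_derivative lam0 * (- (6 * M))) (at M)"
    by (auto intro!: derivative_eq_intros)
  from DERIV_chain2[OF DERIV_real_sqrt[OF p] this]
  have s: "((\<lambda>m. sqrt (lam0 * (1 - 3 * m\<^sup>2))) has_real_derivative
      inverse (sqrt (lam0 * K)) / 2 * (lam0 * (- (6 * M)))) (at M)" by (simp add: K_def)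
  define z where "z = sqrt (lam0 * K)"
  have z: "z > 0" "lam0 = z * z / K" using lam0 K by (auto simp: z_def)
  have "sqrt (lam0 * (1 - 3 * M\<^sup>2)) \<noteq> 0" using real_sqrt_gt_zero[OF p] by linarith
  from DERIV_divide[OF DERIV_const s this, of pi]
  have "((\<lambda>m. pi / sqrt (lam0 * (1 - 3 * m\<^sup>2))) has_real_derivative pi / z * (3 * M / K)) (at M)"
    unfolding K_def[symmetric] z_def[symmetric]
  proof (rule DERIV_cong)
    show "(0 * z - pi * (inverse z / 2 * (lam0 * - (6 * M)))) / (z * z) = pi / z * (3 * M / K)"
      unfolding z(2) using z(1) K by (simp add: inverse_eq_divide)
  qed
  moreover have "pi / z = L / real k" using halfperiod_base by (simp add: halfperiod_0 z_def K_def)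
  ultimately show ?thesis by (simp only: halfperiod_0)
qed

lemma defect_deriv_m: "((\<lambda>m. defect M (m, 0, lam0)) has_real_derivative L / real k) (at M)"
  using DERIV_mult[OF DERIV_diff[OF DERIV_ident DERIV_const[of M]] halfperiod_deriv_m]
  by (simp add: defect_0 halfperiod_0[symmetric] halfperiod_base)

lemma defect_slope: "fderiv (defect M) (M, (0, lam0)) (1, 0) = L / real k"
  using has_real_derivative_Pair_left[OF smooth_has_derivative[OF smooth_defect base_Gam]] defect_deriv_m
  by (rule DERIV_unique)

text \<open>At \<open>r = 0\<close> the defect is \<open>m - M\<close> times the half period, so its
  slope in \<open>m\<close> at the base point is the half period \<open>L / real k\<close>, which is
  positive.\<close>

lemma ex_mean_curve:
  "\<exists>\<eta> \<rho> h. 0 < \<eta> \<and> 0 < \<rho> \<and> mbox \<eta> \<times> ball (0, lam0) \<rho> \<subseteq> Gam \<and> smooth (ball (0, lam0) \<rho>) h \<and>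
     (\<forall>e\<in>ball (0, lam0) \<rho>. h e \<in> mbox \<eta>) \<and>
     (\<forall>m\<in>mbox \<eta>. \<forall>e\<in>ball (0, lam0) \<rho>. defect M (m, e) = 0 \<longleftrightarrow> m = h e)"
proof -
  have z: "defect M (M, (0, lam0)) = 0" by (simp add: defect_0)
  have p: "0 < fderiv (defect M) (M, (0, lam0)) (1, 0)" using L k by (simp add: defect_slope)
  obtain \<eta> \<rho> h where "0 < \<eta>" "0 < \<rho>" "mbox \<eta> \<times> ball (0, lam0) \<rho> \<subseteq> Gam"
    "smooth (ball (0, lam0) \<rho>) h" "h (0, lam0) = M"
    "\<And>e. e \<in> ball (0, lam0) \<rho> \<Longrightarrow> h e \<in> mbox \<eta>"
    "\<And>t e. t \<in> mbox \<eta> \<Longrightarrow> e \<in> ball (0, lam0) \<rho> \<Longrightarrow> defect M (t, e) = 0 \<longleftrightarrow> t = h e"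
    by (rule implicit_function[OF open_Gam smooth_defect base_Gam z p]) blast
  then show ?thesis by blast
qed

end

locale mean_curve = neumann_bifurcation +
  fixes \<eta>1 \<rho>1 :: real and h :: "real \<times> real \<Rightarrow> real"
  assumes \<eta>1: "0 < \<eta>1" and \<rho>1: "0 < \<rho>1"
    and box_Gam: "mbox \<eta>1 \<times> ball (0, lam0) \<rho>1 \<subseteq> Gam"
    and smooth_h: "smooth (ball (0, lam0) \<rho>1) h"
    and h_box: "\<And>e. e \<in> ball (0, lam0) \<rho>1 \<Longrightarrow> h e \<in> mbox \<eta>1"
    and h_iff: "\<And>m e. m \<in> mbox \<eta>1 \<Longrightarrow> e \<in> ball (0, lam0) \<rho>1 \<Longrightarrow> defect M (m, e) = 0 \<longleftrightarrow> m = h e"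
begin

lemma h_Gam: "(r, l) \<in> ball (0, lam0) \<rho>1 \<Longrightarrow> (h (r, l), r, l) \<in> Gam"
  using box_Gam h_box by blast

lemma ball_minus: "(- r :: real, l) \<in> ball (0, lam0) \<rho>1 \<longleftrightarrow> (r, l) \<in> ball (0, lam0) \<rho>1"
  by (simp add: dist_norm norm_Pair)

lemma h_0: "(0 :: real, l) \<in> ball (0, lam0) \<rho>1 \<Longrightarrow> h (0, l) = M"
proof -
  assume b: "(0 :: real, l) \<in> ball (0, lam0) \<rho>1"
  have "defect M (M, (0, l)) = 0" "M \<in> mbox \<eta>1" using \<eta>1 by (simp_all add: defect_0)
  then show ?thesis using h_iff[OF _ b] by blast
qed

lemma h_minus:
  assumes "(r, l) \<in> ball (0, lam0) \<rho>1" shows "h (- r, l) = h (r, l)"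
proof -
  have "defect M (h (r, l), (- r, l)) = 0"
    using defect_minus[OF h_Gam[OF assms]] h_iff[OF h_box[OF assms] assms] by simp
  then show ?thesis
    using h_iff[OF h_box[OF assms], of "(- r, l)"] assms by (simp only: ball_minus)
qed

text \<open>The pair has \<open>l\<close> in front because \<open>l\<close> is now the unknown. The
  difference is taken in this order because the half period decreases in \<open>l\<close> at the
  base point, which makes the slope positive.\<close>

definition excess :: "real \<times> real \<Rightarrow> real" where
  "excess q = L / real k - halfperiod (h (snd q, fst q), snd q, fst q)"

definition D2 :: "(real \<times> real) set" where
  "D2 = {q. (snd q, fst q) \<in> ball (0, lam0) \<rho>1}"

lemma open_D2: "open D2"
proof -
  have "D2 = UNIV \<inter> (\<lambda>q. (snd q, fst q)) -` ball (0, lam0) \<rho>1" by (auto simp: D2_def)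
  then show ?thesis
    by (simp only:) (intro continuous_open_preimage continuous_intros; simp)
qed

lemma smooth_excess: "smooth D2 excess"
proof -
  have "smooth D2 (\<lambda>q. halfperiod (h (snd q, fst q), snd q, fst q))"
  proof (rule smooth_compose[OF smooth_halfperiod])
    show "smooth D2 (\<lambda>q. (h (snd q, fst q), snd q, fst q))"
      by (intro smooth_Pair smooth_compose[OF smooth_h] smooth_snd smooth_fst smooth_ident) (simp add: D2_def)
  qed (use h_Gam in \<open>simp add: D2_def\<close>)
  then show ?thesis unfolding excess_def[abs_def] by (intro smooth_diff smooth_const)
qed

lemma base_D2: "(lam0, 0) \<in> D2"
  using \<rho>1 by (simp add: D2_def)

lemma excess_base: "excess (lam0, 0) = 0"
  using h_0[of lam0] \<rho>1 by (simp add: excess_def halfperiod_base)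

lemma excess_slope: "fderiv excess (lam0, 0) (1, 0) > 0"
proof -
  have 1: "((\<lambda>l. excess (l, 0)) has_real_derivative fderiv excess (lam0, 0) (1, 0)) (at lam0)"
    by (intro has_real_derivative_Pair_left smooth_has_derivative[OF smooth_excess] base_D2)
  define z where "z = sqrt (lam0 * K)"
  have z: "z > 0" using lam0 K by (simp add: z_def)
  have "((\<lambda>l. l * K) has_real_derivative K) (at lam0)" by (auto intro!: derivative_eq_intros)
  from DERIV_chain2[OF DERIV_real_sqrt this]
  have "((\<lambda>l. sqrt (l * K)) has_real_derivative inverse z / 2 * K) (at lam0)"
    using lam0 K by (simp add: z_def)
  note d = this
  have "sqrt (lam0 * K) \<noteq> 0" using lam0 K by simp
  from DERIV_diff[OF DERIV_const[of "L / real k"] DERIV_divide[OF DERIV_const[of pi] d this]]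
  have "((\<lambda>l. L / real k - pi / sqrt (l * K)) has_real_derivative pi * K / (2 * z ^ 3)) (at lam0)"
    unfolding z_def[symmetric]
    by (rule DERIV_cong) (use z in \<open>auto simp: z_def[symmetric] field_simps power3_eq_cube\<close>)
  then have "((\<lambda>l. excess (l, 0)) has_real_derivative pi * K / (2 * z ^ 3)) (at lam0)"
  proof (rule has_field_derivative_transform_within_open[where S="ball lam0 \<rho>1"])
    fix l assume "l \<in> ball lam0 \<rho>1"
    then have "h (0, l) = M" by (intro h_0) (simp add: dist_Pair_Pair)
    then show "L / real k - pi / sqrt (l * K) = excess (l, 0)" by (simp add: excess_def halfperiod_0 K_def)
  qed (use \<rho>1 in auto)
  with 1 have "fderiv excess (lam0, 0) (1, 0) = pi * K / (2 * z ^ 3)" by (rule DERIV_unique)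
  then show ?thesis using z K by simp
qed

lemma ex_lambda_curve:
  "\<exists>\<eta> \<rho> \<Lambda>. 0 < \<eta> \<and> 0 < \<rho> \<and> lbox \<eta> \<times> ball 0 \<rho> \<subseteq> D2 \<and> smooth (ball 0 \<rho>) \<Lambda> \<and> \<Lambda> 0 = lam0 \<and>
     (\<forall>r\<in>ball 0 \<rho>. \<Lambda> r \<in> lbox \<eta>) \<and>
     (\<forall>l\<in>lbox \<eta>. \<forall>r\<in>ball 0 \<rho>. (excess (l, r) = 0 \<longleftrightarrow> l = \<Lambda> r) \<and> (excess (l, r) < 0 \<longleftrightarrow> l < \<Lambda> r))"
proof -
  obtain \<eta> \<rho> \<Lambda> where "0 < \<eta>" "0 < \<rho>" "lbox \<eta> \<times> ball 0 \<rho> \<subseteq> D2"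
    "smooth (ball 0 \<rho>) \<Lambda>" "\<Lambda> 0 = lam0"
    "\<And>r. r \<in> ball 0 \<rho> \<Longrightarrow> \<Lambda> r \<in> lbox \<eta>"
    "\<And>l r. l \<in> lbox \<eta> \<Longrightarrow> r \<in> ball 0 \<rho> \<Longrightarrow> excess (l, r) = 0 \<longleftrightarrow> l = \<Lambda> r"
    "\<And>l r. l \<in> lbox \<eta> \<Longrightarrow> r \<in> ball 0 \<rho> \<Longrightarrow> excess (l, r) < 0 \<longleftrightarrow> l < \<Lambda> r"
    by (rule implicit_function[OF open_D2 smooth_excess base_D2 excess_base excess_slope]) blast
  then show ?thesis by blast
qed

end

section \<open>The branch and its tangent\<close>

locale bifurcation_branch = mean_curve +
  fixes \<eta>2 \<delta> :: real and \<Lambda> :: "real \<Rightarrow> real"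
  assumes \<eta>2: "0 < \<eta>2" and \<delta>: "0 < \<delta>" and box_D2: "lbox \<eta>2 \<times> ball 0 \<delta> \<subseteq> D2"
    and smooth_Lam: "smooth (ball 0 \<delta>) \<Lambda>" and Lam_0: "\<Lambda> 0 = lam0"
    and Lam_box: "\<And>r. r \<in> ball 0 \<delta> \<Longrightarrow> \<Lambda> r \<in> lbox \<eta>2"
    and Lam_iff: "\<And>l r. l \<in> lbox \<eta>2 \<Longrightarrow> r \<in> ball 0 \<delta> \<Longrightarrow> excess (l, r) = 0 \<longleftrightarrow> l = \<Lambda> r"
    and Lam_less: "\<And>l r. l \<in> lbox \<eta>2 \<Longrightarrow> r \<in> ball 0 \<delta> \<Longrightarrow> excess (l, r) < 0 \<longleftrightarrow> l < \<Lambda> r"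
begin

lemma box_ball: "(l :: real) \<in> lbox \<eta>2 \<Longrightarrow> r \<in> ball 0 \<delta> \<Longrightarrow> (r :: real, l) \<in> ball (0, lam0) \<rho>1"
proof -
  assume "l \<in> lbox \<eta>2" "r \<in> ball 0 \<delta>"
  then have "(l, r) \<in> D2" using box_D2 by blast
  then show ?thesis by (simp only: D2_def mem_Collect_eq fst_conv snd_conv)
qed

lemma Lam_ball: "r \<in> ball 0 \<delta> \<Longrightarrow> (r, \<Lambda> r) \<in> ball (0, lam0) \<rho>1"
  using box_ball Lam_box by blast

lemma Lam_minus:
  assumes r: "r \<in> ball 0 \<delta>" shows "\<Lambda> (- r) = \<Lambda> r"
proof -
  have r': "- r \<in> ball 0 \<delta>" using r by simp
  have "excess (\<Lambda> r, - r) = excess (\<Lambda> r, r)"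
    using h_minus[OF Lam_ball[OF r]] halfperiod_minus[OF h_Gam[OF Lam_ball[OF r]]] by (simp add: excess_def)
  also have "\<dots> = 0" using Lam_iff[OF Lam_box[OF r] r] by simp
  finally show ?thesis using Lam_iff[OF Lam_box[OF r] r'] by simp
qed

definition "pc y = (h (y, \<Lambda> y), y, \<Lambda> y)"

lemma pc_Gam: "y \<in> ball 0 \<delta> \<Longrightarrow> pc y \<in> Gam"
  unfolding pc_def by (rule h_Gam[OF Lam_ball])

lemma smooth_pc: "smooth (ball 0 \<delta>) pc"
  unfolding pc_def[abs_def]
  by (intro smooth_Pair smooth_compose[OF smooth_h] smooth_ident smooth_Lam) (rule Lam_ball)

lemma pc_0: "pc 0 = (M, 0, lam0)"
  using h_0[of lam0] \<rho>1 by (simp add: pc_def Lam_0)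

lemma halfperiod_pc: "y \<in> ball 0 \<delta> \<Longrightarrow> halfperiod (pc y) = L / real k"
proof -
  assume y: "y \<in> ball 0 \<delta>"
  have "excess (\<Lambda> y, y) = 0" using Lam_iff[OF Lam_box[OF y] y] by blast
  then show ?thesis by (simp add: excess_def pc_def)
qed

lemma defect_pc: "y \<in> ball 0 \<delta> \<Longrightarrow> defect M (pc y) = 0"
  unfolding pc_def using h_iff[OF h_box[OF Lam_ball] Lam_ball] by blast

lemma prim_pc: "y \<in> ball 0 \<delta> \<Longrightarrow> prim (spd (pc y)) (real j * pi) = real j * (L / real k)"
  using prim_spd_pi[OF pc_Gam, of y j] halfperiod_pc[of y] by (simp add: halfperiod_def)

lemma angle_pc: "y \<in> ball 0 \<delta> \<Longrightarrow> angle (pc y) (real j * (L / real k)) = real j * pi"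
  using angle_prim[OF pc_Gam, of y "real j * pi"] prim_pc by simp

lemma branch_solution: "y \<in> ball 0 \<delta> \<Longrightarrow> is_solution L M (\<Lambda> y) (orbit (pc y))"
proof -
  assume y: "y \<in> ball 0 \<delta>"
  have "angle (pc y) L = real k * pi" using angle_pc[OF y, of k] k by simp
  moreover have "prim (moment M (pc y)) pi = 0" using defect_pc[OF y] by (simp add: defect_def)
  ultimately show ?thesis
    using orbit_is_solution[OF _ L, of "h (y, \<Lambda> y)" y "\<Lambda> y" k M] pc_Gam[OF y] by (simp add: pc_def)
qed

text \<open>At \<open>x = L / k\<close> the angle is pi, so the orbit has moved from
  \<open>m - y\<close> to \<open>m + y\<close>.\<close>

lemma branch_nonconstant:
  assumes y: "y \<in> ball 0 \<delta>" "y \<noteq> 0" shows "\<not> orbit (pc y) constant_on {0..L}"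
proof
  assume "orbit (pc y) constant_on {0..L}"
  moreover have "L / real k \<in> {0..L}" using L k by (simp add: divide_le_eq)
  ultimately have "orbit (pc y) 0 = orbit (pc y) (L / real k)"
    using L unfolding constant_on_def by (metis atLeastAtMost_iff less_imp_le order_refl)
  moreover have "angle (pc y) (L / real k) = pi" using angle_pc[OF y(1), of 1] by simp
  ultimately show False using y angle_0[OF pc_Gam[OF y(1)]] by (simp add: orbit_def pc_def)
qed

definition "Wf q = orbit (pc (snd q)) (fst q)"

lemma smooth_Wf: "smooth (UNIV \<times> {-\<delta><..<\<delta>}) Wf"
proof -
  have b: "{-\<delta><..<\<delta>} = ball 0 \<delta>" by (simp add: ball_eq_greaterThanLessThan)
  have pc: "smooth (UNIV \<times> ball 0 \<delta>) (\<lambda>q :: real \<times> real. pc (snd q))"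
    by (rule smooth_compose[OF smooth_pc]) (auto intro: smooth_intros)
  have "smooth (UNIV \<times> ball 0 \<delta>) (\<lambda>q :: real \<times> real. angle (snd (fst q, pc (snd q))) (fst (fst q, pc (snd q))))"
    by (rule smooth_compose[OF smooth_angle, of _ "\<lambda>q. (fst q, pc (snd q))"])
       (auto intro!: smooth_Pair smooth_fst smooth_ident pc simp: pc_Gam)
  then have "smooth (UNIV \<times> ball 0 \<delta>) (\<lambda>q :: real \<times> real. angle (pc (snd q)) (fst q))" by simp
  then show ?thesis unfolding Wf_def[abs_def] orbit_def b
    by (intro smooth_diff smooth_mult smooth_cos smooth_fst smooth_snd pc)
qed

lemma deriv_Lam_0: "deriv \<Lambda> 0 = 0"
proof -
  obtain f1 where "\<And>x. x \<in> ball 0 \<delta> \<Longrightarrow> (\<Lambda> has_real_derivative f1 x) (at x)"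
    using smooth_real_deriv[OF open_ball smooth_Lam] by blast
  then have d: "(\<Lambda> has_real_derivative f1 0) (at 0)" using \<delta> by simp
  have "f1 0 = 0" by (rule even_deriv_0[OF d \<delta>]) (simp add: Lam_minus)
  then show ?thesis using d DERIV_imp_deriv by metis
qed

text \<open>\<open>m\<close> is even in \<open>y\<close>, so its derivative at 0 vanishes; at
  \<open>y = 0\<close> the speed is constant and the angle is k pi x / L. The factor -1 stems from
  the convention u = m - r cos \<theta>.\<close>

lemma branch_tangent: "has_C2_derivative L (\<lambda>y x. Wf (x, y)) (\<lambda>x. - 1 * cos (real k * pi * x / L)) 0"
proof -
  have 0: "(0::real) \<in> {-\<delta><..<\<delta>}" using \<delta> by simp
  have Z: "(0::real) \<in> ball 0 \<delta>" using \<delta> by simp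
  have "Dy Wf (x, 0) = - 1 * cos (real k * pi * x / L)" for x
  proof -
    have 1: "((\<lambda>y. Wf (x, y)) has_real_derivative Dy Wf (x, 0)) (at 0)"
      by (rule strip_Dy[OF open_greaterThanLessThan smooth_Wf 0])
    have sm: "smooth (ball 0 \<delta>) (\<lambda>y. fst (pc y))" by (intro smooth_fst smooth_pc)
    obtain m1 where "\<And>y. y \<in> ball 0 \<delta> \<Longrightarrow> ((\<lambda>y. fst (pc y)) has_real_derivative m1 y) (at y)"
      using smooth_real_deriv[OF open_ball sm] by blast
    then have m1: "((\<lambda>y. fst (pc y)) has_real_derivative m1 0) (at 0)" using Z by blast
    have m0: "m1 0 = 0"
      by (rule even_deriv_0[OF m1 \<delta>]) (use h_minus[OF Lam_ball] in \<open>simp add: pc_def Lam_minus\<close>)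
    have "smooth (ball 0 \<delta>) (\<lambda>y. angle (snd (x, pc y)) (fst (x, pc y)))"
      by (rule smooth_compose[OF smooth_angle, of _ "\<lambda>y. (x, pc y)"])
         (auto intro!: smooth_Pair smooth_const smooth_pc simp: pc_Gam)
    then have "smooth (ball 0 \<delta>) (\<lambda>y. cos (angle (pc y) x))" by (auto intro: smooth_cos)
    then obtain c1 where "\<And>y. y \<in> ball 0 \<delta> \<Longrightarrow> ((\<lambda>y. cos (angle (pc y) x)) has_real_derivative c1 y) (at y)"
      using smooth_real_deriv[OF open_ball] by blast
    then have c1: "((\<lambda>y. cos (angle (pc y) x)) has_real_derivative c1 0) (at 0)" using Z by blast
    have "((\<lambda>y. fst (pc y) - y * cos (angle (pc y) x)) has_real_derivative
        m1 0 - (1 * cos (angle (pc 0) x) + c1 0 * 0)) (at 0)"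
      by (intro DERIV_diff m1 DERIV_mult DERIV_ident c1)
    moreover have "(\<lambda>y. Wf (x, y)) = (\<lambda>y. fst (pc y) - y * cos (angle (pc y) x))"
      by (simp add: Wf_def orbit_def pc_def fun_eq_iff)
    ultimately have "Dy Wf (x, 0) = - cos (angle (pc 0) x)"
      using DERIV_unique[OF 1] m0 by simp
    moreover have "angle (pc 0) x = real k * pi * x / L"
    proof -
      have "spd (pc 0) = (\<lambda>t. L / (real k * pi))"
        using sqrt_lam0_K by (simp add: pc_0 spd_0 K_def fun_eq_iff)
      then have "prim (spd (pc 0)) (real k * pi * x / L) = x"
        using L k by (simp add: prim_const)
      then show ?thesis using angle_prim[OF pc_Gam[OF Z]] by metis
    qed
    ultimately show ?thesis by simp
  qed
  then show ?thesis using strip_has_C2_derivative[OF open_greaterThanLessThan smooth_Wf 0 L] by simp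
qed

end

section \<open>Solutions near the trivial one\<close>

context bifurcation_branch
begin

text \<open>Here \<open>a\<close> stands for u(0) and \<open>c\<close> for the mean of f(u), the
  data that a given solution offers. The first clause says that \<open>c\<close> is the chord slope
  for the orbit with \<open>r = m - a\<close>; the last leaves room for \<open>k\<close> half
  periods in [0, L] and for no other positive number of them.\<close>

definition "admissible a c l m \<longleftrightarrow>
  c = m - m ^ 3 - m * (m - a)\<^sup>2 \<and> m \<in> mbox \<eta>1 \<and> l \<in> lbox \<eta>2 \<and> m - a \<in> ball 0 \<delta> \<and>
  \<bar>L - real k * halfperiod (m, m - a, l)\<bar> < halfperiod (m, m - a, l)"

definition "on_branch lam u \<longleftrightarrow>
  (\<forall>x\<in>{0..L}. u x = M) \<or> (\<exists>y\<in>{-\<delta><..<\<delta>}. lam = \<Lambda> y \<and> (\<forall>x\<in>{0..L}. u x = orbit (pc y) x))"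

text \<open>A further implicit function yields \<open>m\<close>: at \<open>m = a = M\<close> the
  chord slope m - m^3 - m (m - a)^2 has \<open>m\<close>-derivative 1 - 3 M^2 = \<open>K\<close> >
  0. The remaining clauses are open conditions that hold at \<open>(M, 0, lam0)\<close>.\<close>

lemma exists_parameters:
  "\<exists>\<rho>>0. \<forall>a c l. \<bar>a - M\<bar> < \<rho> \<longrightarrow> \<bar>c - cubic_f M\<bar> < \<rho> \<longrightarrow> \<bar>l - lam0\<bar> < \<rho> \<longrightarrow>
     (\<exists>m. admissible a c l m)"
proof -
  define B where "B = mbox \<eta>1 \<times> (ball (0::real) \<delta> \<times> lbox \<eta>2)"
  have B_Gam: "B \<subseteq> Gam"
  proof
    fix p assume "p \<in> B"
    then obtain m r l where p: "p = (m, r, l)" "m \<in> mbox \<eta>1" "r \<in> ball 0 \<delta>" "l \<in> lbox \<eta>2"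
      by (auto simp: B_def)
    then show "p \<in> Gam" using box_Gam box_ball by blast
  qed
  define N where "N = B \<inter> (\<lambda>p. halfperiod p - \<bar>L - real k * halfperiod p\<bar>) -` {0<..}"
  have "continuous_on B halfperiod"
    using smooth_continuous_on[OF smooth_halfperiod] B_Gam continuous_on_subset by blast
  then have open_N: "open N" unfolding N_def
    by (intro continuous_open_preimage continuous_intros) (auto simp: B_def intro!: open_Times)
  have base_N: "(M, M - M, lam0) \<in> N"
    using \<eta>1 \<eta>2 \<delta> L k by (simp add: N_def B_def halfperiod_base)
  let ?F = "\<lambda>q :: real \<times> (real \<times> real). fst q - fst q ^ 3 - fst q * (fst q - fst (snd q))\<^sup>2 - snd (snd q)"
  have sm: "smooth UNIV ?F" by (intro smooth_intros)
  have z: "?F (M, (M, cubic_f M)) = 0" by (simp add: cubic_f_def)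
  have "((\<lambda>m. ?F (m, (M, cubic_f M))) has_real_derivative fderiv ?F (M, (M, cubic_f M)) (1, 0)) (at M)"
    by (intro has_real_derivative_Pair_left smooth_has_derivative[OF sm]) simp
  moreover have "((\<lambda>m. ?F (m, (M, cubic_f M))) has_real_derivative K) (at M)"
    by (auto intro!: derivative_eq_intros simp: K_def power2_eq_square)
  ultimately have "fderiv ?F (M, (M, cubic_f M)) (1, 0) = K" by (rule DERIV_unique)
  then have pos: "fderiv ?F (M, (M, cubic_f M)) (1, 0) > 0" using K by simp
  obtain \<eta>3 \<rho>3 h3 where h3: "0 < \<eta>3" "0 < \<rho>3"
    "mbox \<eta>3 \<times> ball (M, cubic_f M) \<rho>3 \<subseteq> UNIV"
    "smooth (ball (M, cubic_f M) \<rho>3) h3" "h3 (M, cubic_f M) = M"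
    "\<And>e. e \<in> ball (M, cubic_f M) \<rho>3 \<Longrightarrow> h3 e \<in> mbox \<eta>3"
    "\<And>t e. t \<in> mbox \<eta>3 \<Longrightarrow> e \<in> ball (M, cubic_f M) \<rho>3 \<Longrightarrow> ?F (t, e) = 0 \<longleftrightarrow> t = h3 e"
    by (rule implicit_function[OF open_UNIV sm UNIV_I z pos]) blast
  let ?B3 = "ball (M, cubic_f M) \<rho>3"
  let ?G = "\<lambda>w :: (real \<times> real) \<times> real. (h3 (fst w), h3 (fst w) - fst (fst w), snd w)"
  have "continuous_on (?B3 \<times> UNIV) (\<lambda>w :: (real \<times> real) \<times> real. h3 (fst w))"
    by (rule continuous_on_compose2[OF smooth_continuous_on[OF h3(4)]]) (auto intro!: continuous_intros)
  then have cG: "continuous_on (?B3 \<times> UNIV) ?G" by (intro continuous_intros)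
  have "open ((?B3 \<times> UNIV) \<inter> ?G -` N)"
    by (intro continuous_open_preimage[OF cG] open_N open_Times) auto
  moreover have "((M, cubic_f M), lam0) \<in> (?B3 \<times> UNIV) \<inter> ?G -` N"
    using h3(2,5) base_N by simp
  ultimately obtain A C where AC: "open A" "open C" "(M, cubic_f M) \<in> A" "lam0 \<in> C" "A \<times> C \<subseteq> (?B3 \<times> UNIV) \<inter> ?G -` N"
    by (rule open_prod_elim) blast
  obtain A1 A2 where A: "open A1" "open A2" "M \<in> A1" "cubic_f M \<in> A2" "A1 \<times> A2 \<subseteq> A"
    using AC(1,3) by (rule open_prod_elim) blast
  obtain d1 where d1: "d1 > 0" "ball M d1 \<subseteq> A1" using A openE by blast
  obtain d2 where d2: "d2 > 0" "ball (cubic_f M) d2 \<subseteq> A2" using A openE by blast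
  obtain d3 where d3: "d3 > 0" "ball lam0 d3 \<subseteq> C" using AC openE by blast
  show ?thesis
  proof (rule exI[of _ "min d1 (min d2 d3)"], intro conjI allI impI)
    fix a c l assume acl: "\<bar>a - M\<bar> < min d1 (min d2 d3)" "\<bar>c - cubic_f M\<bar> < min d1 (min d2 d3)" "\<bar>l - lam0\<bar> < min d1 (min d2 d3)"
    then have "a \<in> ball M d1" "c \<in> ball (cubic_f M) d2" "l \<in> ball lam0 d3"
      by (auto simp: dist_real_def abs_minus_commute)
    then have "((a, c), l) \<in> A \<times> C" using d1 d2 d3 A by blast
    then have in_B3: "(a, c) \<in> ?B3" and in_N: "(h3 (a, c), h3 (a, c) - a, l) \<in> N" using AC(5) by auto
    define m where "m = h3 (a, c)"
    have "?F (m, (a, c)) = 0" unfolding m_def using h3(7)[OF h3(6)[OF in_B3] in_B3] by blast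
    then have cm: "c = m - m ^ 3 - m * (m - a)\<^sup>2" by simp
    have "(m, m - a, l) \<in> N" using in_N by (simp only: m_def)
    with cm have "admissible a c l m" unfolding admissible_def N_def B_def by simp
    then show "\<exists>m. admissible a c l m" by blast
  qed (use d1 d2 d3 in auto)
qed

text \<open>The solution and the orbit share equation and initial data, hence coincide. The Neumann
  condition at \<open>L\<close> and the mean value of \<open>u\<close> then become the two scalar
  equations, unless \<open>r = 0\<close>, where the orbit is constant.\<close>

lemma solution_on_branch:
  assumes u: "Ck_on 2 {0..L} u" and sol: "is_solution L M lam u"
    and small: "\<And>x. x \<in> {0..L} \<Longrightarrow> \<bar>Dw {0..L} u x\<bar> \<le> 1 / 2"
    and adm: "admissible (u 0) (1 / L * integral {0..L} (\<lambda>s. cubic_f (u s))) lam m"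
  shows "on_branch lam u"
proof -
  have m: "1 / L * integral {0..L} (\<lambda>s. cubic_f (u s)) = m - m ^ 3 - m * (m - u 0)\<^sup>2"
      "m \<in> mbox \<eta>1" "lam \<in> lbox \<eta>2" "m - u 0 \<in> ball 0 \<delta>"
    and P: "\<bar>L - real k * halfperiod (m, m - u 0, lam)\<bar> < halfperiod (m, m - u 0, lam)"
    using adm unfolding admissible_def by blast+
  define r where "r = m - u 0"
  let ?p = "(m, r, lam)"
  have rl: "(r, lam) \<in> ball (0, lam0) \<rho>1" using box_ball m(3,4) by (simp add: r_def)
  have G: "?p \<in> Gam" using box_Gam rl m(2) by blast
  have ode: "deriv (flux L u) x = lam * (m - m ^ 3 - m * r\<^sup>2 - cubic_f (u x))" if "x \<in> {0<..<L}" for x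
  proof -
    have "deriv (flux L u) x + lam * cubic_f (u x) - lam * (1 / L * integral {0..L} (\<lambda>s. cubic_f (u s))) = 0"
      using sol that unfolding is_solution_def by simp
    then show ?thesis unfolding m(1) r_def by (simp add: algebra_simps)
  qed
  have bc: "Dw {0..L} u 0 = 0" "Dw {0..L} u L = 0" "integral {0..L} u = M * L"
    using sol L unfolding is_solution_def by (auto simp: field_simps)
  have u_eq: "u x = orbit ?p x" if "x \<in> {0..L}" for x
    by (rule orbit_unique[OF G L u ode _ bc(1) small that]) (simp_all add: r_def)
  have int: "((\<lambda>x. orbit ?p x - M) has_integral 0) {0..L}"
  proof -
    have "u integrable_on {0..L}"
      using Ck_on_continuous[OF u, of 0] by (intro integrable_continuous_interval) simp
    from has_integral_diff[OF integrable_integral[OF this] has_integral_const_real[of M 0 L]]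
    have "((\<lambda>x. u x - M) has_integral 0) {0..L}" using bc(3) L by simp
    then show ?thesis by (rule has_integral_eq[rotated]) (simp add: u_eq)
  qed
  have mom: "prim (moment M ?p) (angle ?p L) = 0"
    using has_integral_unique[OF orbit_mean[OF G L] int] .
  show ?thesis
  proof (cases "r = 0")
    case True
    then have "((\<lambda>x. m - M) has_integral 0) {0..L}" using int by (simp add: orbit_def)
    then have "m = M" using has_integral_unique[OF has_integral_const_real[of "m - M" 0 L]] L by fastforce
    then show ?thesis using u_eq True by (simp add: orbit_def on_branch_def)
  next
    case False
    have "Dw {0..L} u L = Dw {0..L} (orbit ?p) L"
      by (rule Dw_cong) (use u_eq L in auto)
    then have "sin (angle ?p L) = 0"
      using bc(2) False orbit_Dw[OF G L, of L] L spd_pos[OF G, of "angle ?p L"] by simp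
    then obtain i :: int where i: "angle ?p L = of_int i * pi"
      using sin_zero_iff_int2 by blast
    have "i > 0" using angle_pos[OF G L] i by (simp add: zero_less_mult_iff)
    then obtain j :: nat where j: "angle ?p L = real j * pi" "j > 0"
      using i by (metis of_int_of_nat_eq of_nat_0_less_iff zero_less_imp_eq_int)
    have Lj: "L = real j * halfperiod ?p"
      using prim_angle[OF G, of L] prim_spd_pi[OF G, of j] by (simp add: j halfperiod_def)
    \<comment> \<open>A wrong count would put \<open>L\<close>, which is \<open>j\<close> half
      periods, at distance at least one half period from \<open>k\<close> of them, against the last
      clause of \<open>admissible\<close>.\<close>
    have "j = k"
    proof (rule ccontr)
      assume "j \<noteq> k"
      have hp: "halfperiod ?p > 0" using Lj L j by (simp add: zero_less_mult_iff)
      have "1 \<le> \<bar>real j - real k\<bar>" using \<open>j \<noteq> k\<close> by linarith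
      then have "1 * halfperiod ?p \<le> \<bar>real j - real k\<bar> * halfperiod ?p"
        using hp by (intro mult_right_mono) auto
      also have "\<dots> = \<bar>(real j - real k) * halfperiod ?p\<bar>" using hp by (simp add: abs_mult)
      also have "(real j - real k) * halfperiod ?p = L - real k * halfperiod ?p"
        by (subst Lj) (simp add: algebra_simps)
      finally show False using P by (simp add: r_def)
    qed
    have "defect M ?p = 0"
      using mom prim_moment_pi[OF G, of M j] j by (simp add: defect_def)
    then have mh: "m = h (r, lam)" using h_iff[OF m(2) rl] by blast
    have "L / real k = halfperiod ?p" using Lj \<open>j = k\<close> j(2) by (simp add: field_simps)
    then have "excess (lam, r) = 0" unfolding excess_def by (simp add: mh[symmetric])
    moreover have "excess (lam, r) = 0 \<longleftrightarrow> lam = \<Lambda> r"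
      by (rule Lam_iff[OF m(3)]) (simp only: r_def m(4))
    ultimately have lam: "lam = \<Lambda> r" by blast
    have "?p = pc r" unfolding pc_def mh[symmetric] lam[symmetric] using mh by simp
    then have "\<forall>x\<in>{0..L}. u x = orbit (pc r) x" using u_eq by metis
    moreover have "r \<in> {-\<delta><..<\<delta>}" using m(4) by (auto simp: r_def)
    ultimately show ?thesis using lam unfolding on_branch_def by blast
  qed
qed

lemma near_solutions:
  "\<exists>\<epsilon>>0. \<epsilon> \<le> lam0 \<and> (\<forall>lam u. near L M lam0 \<epsilon> lam u \<longrightarrow> is_solution L M lam u \<longrightarrow>
     on_branch lam u)"
proof -
  obtain \<rho> where \<rho>: "\<rho> > 0" "\<And>a c l. \<bar>a - M\<bar> < \<rho> \<Longrightarrow> \<bar>c - cubic_f M\<bar> < \<rho> \<Longrightarrow> \<bar>l - lam0\<bar> < \<rho> \<Longrightarrow>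
     (\<exists>m. admissible a c l m)"
    using exists_parameters by blast
  have "isCont cubic_f M" unfolding cubic_f_def[abs_def] by (intro continuous_intros)
  then obtain d where d: "d > 0" "\<And>v. dist v M < d \<Longrightarrow> dist (cubic_f v) (cubic_f M) < \<rho> / 2"
    using \<rho>(1) unfolding continuous_at_eps_delta by (metis half_gt_zero)
  \<comment> \<open>\<open>d\<close> brings the mean of \<open>cubic_f\<close> within
    \<open>\<rho> / 2\<close> of its value at \<open>M\<close>, hence strictly within
    \<open>\<rho>\<close>; 1/2 is the slope bound for uniqueness; \<open>lam0\<close> keeps
    \<open>lam\<close> positive, so that the nearby constants are solutions.\<close>
  define \<epsilon> where "\<epsilon> = min (min d \<rho>) (min (1 / 2) lam0)"
  have \<epsilon>: "\<epsilon> > 0" "\<epsilon> \<le> d" "\<epsilon> \<le> \<rho>" "\<epsilon> \<le> 1 / 2" "\<epsilon> \<le> lam0" using d \<rho> lam0 by (auto simp: \<epsilon>_def)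
  have "on_branch lam u"
    if nr: "near L M lam0 \<epsilon> lam u" and sol: "is_solution L M lam u" for lam u
  proof -
    have C: "Ck_on 2 {0..L} u" "\<bar>lam - lam0\<bar> < \<epsilon>" using nr by (auto simp: near_def)
    note bd = near_bounds[OF L nr]
    have cu: "continuous_on {0..L} u" using Ck_on_continuous[OF C(1), of 0] by simp
    then have cf: "continuous_on {0..L} (\<lambda>x. cubic_f (u x))"
      unfolding cubic_f_def by (intro continuous_intros)
    define c where "c = 1 / L * integral {0..L} (\<lambda>s. cubic_f (u s))"
    have "norm (integral {0..L} (\<lambda>s. cubic_f (u s) - cubic_f M)) \<le> \<rho> / 2 * (L - 0)"
    proof (rule integral_bound)
      fix t assume "t \<in> {0..L}"
      then have "dist (u t) M < d" using bd(1)[of t] \<epsilon> by (simp add: dist_real_def)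
      then show "norm (cubic_f (u t) - cubic_f M) \<le> \<rho> / 2"
        using d(2) by (fastforce simp: dist_norm)
    qed (use L cf in \<open>auto intro!: continuous_intros\<close>)
    moreover have "integral {0..L} (\<lambda>s. cubic_f (u s) - cubic_f M) = L * (c - cubic_f M)"
    proof -
      have "integral {0..L} (\<lambda>s. cubic_f (u s) - cubic_f M)
          = integral {0..L} (\<lambda>s. cubic_f (u s)) - integral {0..L} (\<lambda>s. cubic_f M)"
        by (intro integral_diff integrable_continuous_interval cf continuous_intros)
      then show ?thesis using L by (simp add: c_def right_diff_distrib)
    qed
    ultimately have "L * \<bar>c - cubic_f M\<bar> \<le> L * (\<rho> / 2)" using L by (simp add: abs_mult mult.commute)
    then have "\<bar>c - cubic_f M\<bar> \<le> \<rho> / 2" using L by (simp only: mult_le_cancel_left_pos)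
    then have "\<bar>c - cubic_f M\<bar> < \<rho>" using \<rho>(1) by linarith
    moreover have "\<bar>u 0 - M\<bar> < \<rho>" using bd(1)[of 0] L \<epsilon> by simp
    moreover have "\<bar>lam - lam0\<bar> < \<rho>" using C(2) \<epsilon> by linarith
    ultimately obtain m where m: "admissible (u 0) c lam m"
      using \<rho>(2) by metis
    have "\<bar>Dw {0..L} u x\<bar> \<le> 1 / 2" if "x \<in> {0..L}" for x using bd(2)[OF that] \<epsilon> by linarith
    then show ?thesis using solution_on_branch[OF C(1) sol _ m[unfolded c_def]] by blast
  qed
  then show ?thesis using \<epsilon> by blast
qed

lemma const_is_solution: "lam > 0 \<Longrightarrow> is_solution L M lam (\<lambda>x. M)"
proof -
  assume lam: "lam > 0"
  have "(M, 0, lam) \<in> Gam" using M lam by (simp add: Gam_iff)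
  have C: "Ck_on n S (\<lambda>x. M)" if "perfect S" for n S
    by (rule Ck_on_derivI(1)[OF that, of _ "\<lambda>j x. if j = 0 then M else 0"]) auto
  have D: "Dw {0..L} (\<lambda>x. M) x = 0" if "x \<in> {0..L}" for x
    by (rule Dw_eqI[OF perfect_Icc[OF L] that]) simp
  have "deriv (flux L (\<lambda>x. M)) x = 0" if "x \<in> {0<..<L}" for x
    by (rule DERIV_imp_deriv, rule has_field_derivative_transform_within_open[of "\<lambda>x. 0" _ _ "{0<..<L}"])
       (use that D in \<open>auto simp: flux_def\<close>)
  then show ?thesis
    unfolding is_solution_def
    using lam L C perfect_open[of "{0<..<L}"] perfect_Icc[OF L] D by auto
qed

lemma branch_pitchfork: "pitchfork_curve L M k lam0 \<delta> \<Lambda> (\<lambda>y. orbit (pc y))"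
proof -
  have b: "ball 0 \<delta> = {-\<delta><..<\<delta>}" by (simp add: ball_eq_greaterThanLessThan)
  have W: "(\<lambda>y. orbit (pc y)) = (\<lambda>y x. Wf (x, y))" by (simp add: Wf_def fun_eq_iff)
  obtain \<epsilon> where \<epsilon>: "\<epsilon> > 0" "\<epsilon> \<le> lam0" "\<And>lam u. near L M lam0 \<epsilon> lam u \<Longrightarrow> is_solution L M lam u \<Longrightarrow>
     on_branch lam u"
    using near_solutions by blast
  have sol: "is_solution L M lam u \<longleftrightarrow>
      on_branch lam u"
    if nr: "near L M lam0 \<epsilon> lam u" for lam u
  proof
    show "on_branch lam u" if "is_solution L M lam u" using \<epsilon>(3)[OF nr that] .
  next
    assume "on_branch lam u"
    then show "is_solution L M lam u"
      unfolding on_branch_def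
    proof
      assume "\<forall>x\<in>{0..L}. u x = M"
      then have "is_solution L M lam u \<longleftrightarrow> is_solution L M lam (\<lambda>x. M)"
        by (intro is_solution_cong[OF L]) auto
      moreover have "lam > 0" using nr \<epsilon>(2) by (auto simp: near_def)
      ultimately show ?thesis using const_is_solution by blast
    next
      assume "\<exists>y\<in>{-\<delta><..<\<delta>}. lam = \<Lambda> y \<and> (\<forall>x\<in>{0..L}. u x = orbit (pc y) x)"
      then obtain y where y: "y \<in> ball 0 \<delta>" "lam = \<Lambda> y" "\<forall>x\<in>{0..L}. u x = orbit (pc y) x" unfolding b by blast
      then have "is_solution L M lam u \<longleftrightarrow> is_solution L M lam (orbit (pc y))"
        by (intro is_solution_cong[OF L]) auto
      then show ?thesis using branch_solution[OF y(1)] y(2) by blast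
    qed
  qed
  have "smooth {-\<delta><..<\<delta>} \<Lambda>" using smooth_Lam by (simp add: b)
  then have 1: "\<forall>n. Ck_on n {-\<delta><..<\<delta>} \<Lambda>" using smooth_imp_Ck_on[OF open_greaterThanLessThan] by blast
  have 2: "smooth_C2_curve L \<delta> (\<lambda>y. orbit (pc y))"
    unfolding W by (rule smooth_C2_curve_strip[OF smooth_Wf L])
  have 3: "\<exists>c. c \<noteq> 0 \<and> has_C2_derivative L (\<lambda>y. orbit (pc y)) (\<lambda>x. c * cos (real k * pi * x / L)) 0"
    unfolding W using branch_tangent by (intro exI[of _ "-1"]) simp
  have 4: "\<forall>x\<in>{0..L}. orbit (pc 0) x = M" by (simp add: pc_0 orbit_def)
  have 5: "\<forall>y\<in>{-\<delta><..<\<delta>}. is_solution L M (\<Lambda> y) (orbit (pc y))"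
    using branch_solution unfolding b by blast
  have 6: "\<forall>y\<in>{-\<delta><..<\<delta>}. y \<noteq> 0 \<longrightarrow> \<not> orbit (pc y) constant_on {0..L}"
    using branch_nonconstant unfolding b by blast
  show ?thesis
    unfolding pitchfork_curve_def
    using \<delta> 1 2 Lam_0 deriv_Lam_0 4 3 5 6 \<epsilon>(1) sol unfolding on_branch_def by blast
qed

end

section \<open>Direction of the bifurcation\<close>

lemma DERIV_quot_sqrt:
  assumes N: "(N has_real_derivative N') (at x)" and A: "(A has_real_derivative A') (at x)" and pos: "A x > 0"
  shows "((\<lambda>x. N x / sqrt (A x)) has_real_derivative
           N' / sqrt (A x) - N x * A' / (2 * A x * sqrt (A x))) (at x)"
proof -
  have "((\<lambda>x. sqrt (A x)) has_real_derivative inverse (sqrt (A x)) / 2 * A') (at x)"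
    using DERIV_chain2[OF DERIV_real_sqrt[OF pos] A] .
  moreover have s: "sqrt (A x) > 0" using pos by simp
  ultimately have d: "((\<lambda>x. N x / sqrt (A x)) has_real_derivative
      (N' * sqrt (A x) - N x * (inverse (sqrt (A x)) / 2 * A')) / (sqrt (A x) * sqrt (A x))) (at x)"
    by (intro DERIV_divide N) auto
  define z where "z = sqrt (A x)"
  have z: "z > 0" "A x = z * z" using pos by (auto simp: z_def)
  show ?thesis
  proof (rule DERIV_cong[OF d])
    show "(N' * sqrt (A x) - N x * (inverse (sqrt (A x)) / 2 * A')) / (sqrt (A x) * sqrt (A x)) =
      N' / sqrt (A x) - N x * A' / (2 * A x * sqrt (A x))"
      unfolding z_def[symmetric] z(2) using z(1) by (simp add: field_simps)
  qed
qed

text \<open>The root of \<open>A x\<close> is named \<open>z\<close>, so that the final comparison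
  is an identity of rational functions.\<close>

lemma DERIV2_quot_sqrt:
  fixes N A N1 A1 :: "real \<Rightarrow> real"
  assumes N: "(N has_real_derivative N1 x) (at x)" and A: "(A has_real_derivative A1 x) (at x)"
    and N1: "(N1 has_real_derivative N2) (at x)" and A1: "(A1 has_real_derivative A2) (at x)"
    and z: "z > 0" "A x = z * z"
  shows "((\<lambda>x. N1 x / sqrt (A x) - N x * A1 x / (2 * A x * sqrt (A x))) has_real_derivative
           N2 / z - N1 x * A1 x / z ^ 3 - N x * A2 / (2 * z ^ 3) + 3 * N x * (A1 x)\<^sup>2 / (4 * z ^ 5)) (at x)"
proof -
  have pos: "A x > 0" using z by simp
  have sz: "sqrt (A x) = z" using z by simp
  have 1: "((\<lambda>x. N1 x / sqrt (A x)) has_real_derivative N2 / z - N1 x * A1 x / (2 * A x * z)) (at x)"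
    using DERIV_quot_sqrt[OF N1 A pos] sz by simp
  have s: "((\<lambda>x. sqrt (A x)) has_real_derivative inverse z / 2 * A1 x) (at x)"
    using DERIV_chain2[OF DERIV_real_sqrt[OF pos] A] sz by simp
  have den: "((\<lambda>x. 2 * A x * sqrt (A x)) has_real_derivative 2 * A1 x * z + inverse z / 2 * A1 x * (2 * A x)) (at x)"
    using DERIV_mult[OF DERIV_cmult[OF A, of 2] s] sz by simp
  have num: "((\<lambda>x. N x * A1 x) has_real_derivative N1 x * A1 x + A2 * N x) (at x)"
    by (rule DERIV_mult[OF N A1])
  have "2 * A x * sqrt (A x) \<noteq> 0" using pos z by simp
  from DERIV_diff[OF 1 DERIV_divide[OF num den this]]
  show ?thesis
  proof (rule DERIV_cong)
    have "z \<noteq> 0" using z(1) by simp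
    then show "N2 / z - N1 x * A1 x / (2 * A x * z) -
      ((N1 x * A1 x + A2 * N x) * (2 * A x * sqrt (A x)) - N x * A1 x * (2 * A1 x * z + inverse z / 2 * A1 x * (2 * A x))) /
      (2 * A x * sqrt (A x) * (2 * A x * sqrt (A x)))
      = N2 / z - N1 x * A1 x / z ^ 3 - N x * A2 / (2 * z ^ 3) + 3 * N x * (A1 x)\<^sup>2 / (4 * z ^ 5)"
      unfolding sz unfolding z(2) by (simp add: field_simps power2_eq_square power3_eq_cube eval_nat_numeral)
  qed
qed

lemma has_integral_cos_0_pi: "((\<lambda>t. cos t) has_integral 0) {0..pi}"
proof -
  have "((\<lambda>t. cos t) has_integral sin pi - sin 0) {0..pi}"
    by (intro has_integral_real_derivative DERIV_sin) simp
  then show ?thesis by simp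
qed

lemma has_integral_cos_sq_0_pi: "((\<lambda>t. (cos t)\<^sup>2) has_integral pi / 2) {0..pi}"
proof -
  have "((\<lambda>t. (cos t)\<^sup>2) has_integral (pi / 2 + sin pi * cos pi / 2) - (0 / 2 + sin 0 * cos 0 / 2)) {0..pi}"
  proof (intro has_integral_real_derivative)
    fix t :: real
    have "((\<lambda>t. t / 2 + sin t * cos t / 2) has_real_derivative 1 / 2 + (cos t * cos t - sin t * sin t) / 2) (at t)"
      by (auto intro!: derivative_eq_intros simp: field_simps)
    then show "((\<lambda>t. t / 2 + sin t * cos t / 2) has_real_derivative (cos t)\<^sup>2) (at t)"
      by (rule DERIV_cong) (simp add: power2_eq_square[symmetric] sin_squared_eq field_simps)
  qed simp
  then show ?thesis by simp
qed

context neumann_bifurcation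
begin

text \<open>
  Adding this multiple of the mean-value defect to the half period makes the sum stationary in
  \<open>m\<close> at the bifurcation point, so that the second-order shift of \<open>m\<close> along the branch drops out.
\<close>

definition "cM = - 3 * M / K"

definition "corr q = halfperiod q + cM * defect M q"

lemma smooth_corr: "smooth Gam corr"
  unfolding corr_def[abs_def] by (intro smooth_intros smooth_halfperiod smooth_defect)

lemma corr_base: "corr (M, 0, lam0) = L / real k"
  by (simp add: corr_def halfperiod_base defect_0)

lemma corr_stationary: "fderiv corr (M, (0, lam0)) (1, 0) = 0"
proof -
  have "((\<lambda>m. corr (m, (0, lam0))) has_real_derivative L / real k * (3 * M / K) + cM * (L / real k)) (at M)"
    unfolding corr_def by (intro DERIV_add halfperiod_deriv_m DERIV_cmult defect_deriv_m)
  from DERIV_unique[OF has_real_derivative_Pair_left[OF smooth_has_derivative[OF smooth_corr base_Gam]] this]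
  show ?thesis by (simp add: cM_def)
qed

definition "SG = {r. (M, r, lam0) \<in> Gam}"

lemma SG: "open SG" "0 \<in> SG"
proof -
  have "open (UNIV \<inter> (\<lambda>r. (M, r, lam0)) -` Gam)"
    by (intro continuous_open_preimage continuous_intros open_Gam) auto
  moreover have "SG = UNIV \<inter> (\<lambda>r. (M, r, lam0)) -` Gam" by (auto simp: SG_def)
  ultimately show "open SG" by simp
  show "0 \<in> SG" using base_Gam by (simp add: SG_def)
qed

text \<open>The integrand of \<open>corr\<close> at \<open>m = M\<close>, where the moment reduces
  to \<open>- r * cos t\<close> times the speed.\<close>

definition "integrand q = (1 - cM * snd q * cos (fst q)) * spd (M, snd q, lam0) (fst q)"

lemma smooth_integrand: "smooth (UNIV \<times> SG) integrand"
proof -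
  have "smooth (UNIV \<times> SG) (\<lambda>q. spd (snd (fst q, (M, snd q, lam0))) (fst (fst q, (M, snd q, lam0))))"
    by (rule smooth_compose[OF smooth_spd, where f="\<lambda>q. (fst q, (M, snd q, lam0))"])
       (auto intro!: smooth_intros simp: SG_def)
  then have "smooth (UNIV \<times> SG) (\<lambda>q. spd (M, snd q, lam0) (fst q))" by simp
  then show ?thesis unfolding integrand_def[abs_def] by (intro smooth_intros)
qed

lemma corr_eq_integral:
  assumes "r \<in> SG" shows "corr (M, r, lam0) = integral {0..pi} (\<lambda>t. integrand (t, r))"
proof -
  have G: "(M, r, lam0) \<in> Gam" using assms by (simp add: SG_def)
  have i: "spd (M, r, lam0) integrable_on {0..pi}" "moment M (M, r, lam0) integrable_on {0..pi}"
    by (auto intro!: integrable_continuous_interval continuous_on_subset[OF continuous_spd[OF G]]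
        continuous_on_subset[OF continuous_moment[OF G]])
  have "corr (M, r, lam0) = integral {0..pi} (spd (M, r, lam0)) + cM * integral {0..pi} (moment M (M, r, lam0))"
    using prim_eq_integral[OF continuous_spd[OF G], of pi] prim_eq_integral[OF continuous_moment[OF G], of pi]
    by (simp add: corr_def halfperiod_def defect_def)
  also have "\<dots> = integral {0..pi} (\<lambda>t. spd (M, r, lam0) t + cM * moment M (M, r, lam0) t)"
    using i by (simp add: integral_add integral_mult_right integrable_on_mult_right)
  also have "(\<lambda>t. spd (M, r, lam0) t + cM * moment M (M, r, lam0) t) = (\<lambda>t. integrand (t, r))"
    by (simp add: integrand_def moment_def fun_eq_iff algebra_simps)
  finally show ?thesis .
qed

text \<open>The frequency sqrt (\<open>lam0\<close> \<open>K\<close>) of the linearization.\<close>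

definition "zz = real k * pi / L"

lemma zz: "zz > 0" "lam0 * K = zz * zz"
  using L k lam0_K by (simp_all add: zz_def power2_eq_square)

text \<open>The second derivative of \<open>corr (M, r, lam0)\<close> in \<open>r\<close> at 0. If
  it is positive, small oscillations at \<open>lam0\<close> have too long a half period, and a
  larger parameter is needed to restore \<open>L / k\<close>.\<close>

definition "curvature = 3 * pi / (4 * K\<^sup>2 * zz) * (1 - 5 * M\<^sup>2 - (zz * K)\<^sup>2 / 2)"

context
  fixes t :: real
begin

text \<open>The pieces of the integrand at a fixed angle \<open>t\<close>, as functions of
  \<open>r\<close>. A trailing 1 marks first derivatives; second derivatives are computed only at
  \<open>r = 0\<close>.\<close>

definition "kr r = kap M r (cos t)"
definition "kr1 r = 2 * M * cos t - r * ((cos t)\<^sup>2 + 1)"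
definition "wr r = wgt M r lam0 t"
definition "wr1 r = lam0 * (sin t)\<^sup>2 / 2 * (2 * r * kr r + r\<^sup>2 * kr1 r)"
definition "Nr r = (1 - cM * r * cos t) * (1 - wr r)"
definition "Nr1 r = - cM * cos t * (1 - wr r) - wr1 r * (1 - cM * r * cos t)"
definition "Ar r = amp M r lam0 t"
definition "Ar1 r = lam0 * kr1 r * (1 - wr r / 2) - lam0 * kr r * wr1 r / 2"

lemma integrand_quot: "integrand (t, r) = Nr r / sqrt (Ar r)"
  by (simp add: integrand_def spd_def Nr_def Ar_def wr_def)

lemma d_kr: "(kr has_real_derivative kr1 r) (at r)"
  unfolding kr_def[abs_def] kr1_def kap_def
  by (auto intro!: derivative_eq_intros simp: algebra_simps)

lemma d_wr: "(wr has_real_derivative wr1 r) (at r)"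
proof -
  have "((\<lambda>r. r\<^sup>2) has_real_derivative 2 * r) (at r)" by (auto intro!: derivative_eq_intros)
  from DERIV_cmult[OF DERIV_mult[OF this d_kr], of "lam0 * (sin t)\<^sup>2 / 2"]
  have "((\<lambda>r. lam0 * (sin t)\<^sup>2 / 2 * (r\<^sup>2 * kr r)) has_real_derivative wr1 r) (at r)"
    by (simp add: wr1_def mult.commute)
  moreover have "(\<lambda>r. lam0 * (sin t)\<^sup>2 / 2 * (r\<^sup>2 * kr r)) = wr"
    by (simp add: wr_def wgt_def kr_def fun_eq_iff)
  ultimately show ?thesis by simp
qed

lemma d_Nr: "(Nr has_real_derivative Nr1 r) (at r)"
proof -
  have a: "((\<lambda>r. 1 - cM * r * cos t) has_real_derivative - (cM * cos t)) (at r)"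
    by (auto intro!: derivative_eq_intros)
  have b: "((\<lambda>r. 1 - wr r) has_real_derivative - wr1 r) (at r)"
    using DERIV_diff[OF DERIV_const d_wr, of 1] by simp
  from DERIV_mult[OF a b] show ?thesis unfolding Nr_def[abs_def]
    by (rule DERIV_cong) (simp add: Nr1_def)
qed

lemma d_Ar: "(Ar has_real_derivative Ar1 r) (at r)"
proof -
  have b: "((\<lambda>r. 1 - wr r / 2) has_real_derivative - (wr1 r / 2)) (at r)"
    using DERIV_diff[OF DERIV_const DERIV_cdivide[OF d_wr], of 1] by simp
  from DERIV_mult[OF DERIV_cmult[OF d_kr, of lam0] b]
  have "((\<lambda>r. lam0 * kr r * (1 - wr r / 2)) has_real_derivative Ar1 r) (at r)"
    by (rule DERIV_cong) (simp add: Ar1_def)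
  then show ?thesis by (simp add: Ar_def[abs_def] amp_def kr_def wr_def)
qed

lemma at_0: "kr 0 = K" "wr 0 = 0" "wr1 0 = 0" "Nr 0 = 1" "Ar 0 = lam0 * K"
  "kr1 0 = 2 * M * cos t" "Nr1 0 = - cM * cos t" "Ar1 0 = 2 * lam0 * M * cos t"
  by (simp_all add: kr_def kap_def K_def wr_def wgt_def wr1_def Nr_def Ar_def amp_def kr1_def Nr1_def Ar1_def)

lemma d_kr1: "(kr1 has_real_derivative - ((cos t)\<^sup>2 + 1)) (at 0)"
  unfolding kr1_def[abs_def] by (auto intro!: derivative_eq_intros)

lemma d_wr1: "(wr1 has_real_derivative lam0 * (sin t)\<^sup>2 * K) (at 0)"
proof -
  have a: "((\<lambda>r::real. 2 * r) has_real_derivative 2) (at 0)" by (auto intro!: derivative_eq_intros)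
  have b: "((\<lambda>r::real. r\<^sup>2) has_real_derivative 0) (at 0)" by (auto intro!: derivative_eq_intros)
  from DERIV_cmult[OF DERIV_add[OF DERIV_mult[OF a d_kr] DERIV_mult[OF b d_kr1]], of "lam0 * (sin t)\<^sup>2 / 2"]
  show ?thesis unfolding wr1_def[abs_def] by (rule DERIV_cong) (simp add: at_0)
qed

lemma d_Nr1: "(Nr1 has_real_derivative - (lam0 * (sin t)\<^sup>2 * K)) (at 0)"
proof -
  have a: "((\<lambda>r. 1 - cM * r * cos t) has_real_derivative - (cM * cos t)) (at 0)"
    by (auto intro!: derivative_eq_intros)
  have b: "((\<lambda>r. 1 - wr r) has_real_derivative - wr1 0) (at 0)"
    using DERIV_diff[OF DERIV_const d_wr, of 1] by simp
  from DERIV_diff[OF DERIV_cmult[OF b, of "- cM * cos t"] DERIV_mult[OF d_wr1 a]]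
  show ?thesis unfolding Nr1_def[abs_def] by (rule DERIV_cong) (simp add: at_0)
qed

lemma d_Ar1: "(Ar1 has_real_derivative - (lam0 * ((cos t)\<^sup>2 + 1)) - lam0 * K * (lam0 * (sin t)\<^sup>2 * K) / 2) (at 0)"
proof -
  have b: "((\<lambda>r. 1 - wr r / 2) has_real_derivative - (wr1 0 / 2)) (at 0)"
    using DERIV_diff[OF DERIV_const DERIV_cdivide[OF d_wr], of 1] by simp
  from DERIV_diff[OF DERIV_mult[OF DERIV_cmult[OF d_kr1, of lam0] b]
      DERIV_cdivide[OF DERIV_mult[OF DERIV_cmult[OF d_kr, of lam0] d_wr1], of 2]]
  show ?thesis unfolding Ar1_def[abs_def] by (rule DERIV_cong) (simp add: at_0 algebra_simps)
qed

lemma Ar_pos: "r \<in> SG \<Longrightarrow> Ar r > 0"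
  unfolding Ar_def SG_def using amp_bounds(1) by blast

lemma integrand_r:
  assumes r: "r \<in> SG"
  shows "Dy integrand (t, r) = Nr1 r / sqrt (Ar r) - Nr r * Ar1 r / (2 * Ar r * sqrt (Ar r))"
proof -
  have "((\<lambda>r. integrand (t, r)) has_real_derivative Dy integrand (t, r)) (at r)"
    by (rule strip_Dy[OF SG(1) smooth_integrand r])
  then show ?thesis using DERIV_quot_sqrt[OF d_Nr d_Ar Ar_pos[OF r]]
    unfolding integrand_quot by (rule DERIV_unique)
qed

lemma integrand_r_0: "Dy integrand (t, 0) = 2 * M / (K * zz) * cos t"
proof -
  have "Dy integrand (t, 0) = - cM * cos t / zz - 2 * lam0 * M * cos t / (2 * (zz * zz) * zz)"
    unfolding integrand_r[OF SG(2)] at_0 zz(2) using zz(1) by simp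
  also have "lam0 = zz * zz / K" using zz K by (simp add: field_simps)
  also have "- cM * cos t / zz - 2 * (zz * zz / K) * M * cos t / (2 * (zz * zz) * zz) = 2 * M / (K * zz) * cos t"
    unfolding cM_def using zz(1) K by (simp add: field_simps)
  finally show ?thesis .
qed

lemma integrand_rr_0:
  "Dy (Dy integrand) (t, 0) = (1 / zz) * ((- 3 / 4 * zz\<^sup>2 + 1 / (2 * K)) + (3 / 4 * zz\<^sup>2 - 3 * M\<^sup>2 / K\<^sup>2 + 1 / (2 * K)) * (cos t)\<^sup>2)"
proof -
  have 1: "((\<lambda>r. Dy integrand (t, r)) has_real_derivative Dy (Dy integrand) (t, 0)) (at 0)"
    by (rule strip_Dy[OF SG(1) smooth_fderiv[OF open_strip[OF SG(1)] smooth_integrand] SG(2)])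
  define D where "D = - (lam0 * (sin t)\<^sup>2 * K) / zz - Nr1 0 * Ar1 0 / zz ^ 3
    - Nr 0 * (- (lam0 * ((cos t)\<^sup>2 + 1)) - lam0 * K * (lam0 * (sin t)\<^sup>2 * K) / 2) / (2 * zz ^ 3) + 3 * Nr 0 * (Ar1 0)\<^sup>2 / (4 * zz ^ 5)"
  have "((\<lambda>r. Nr1 r / sqrt (Ar r) - Nr r * Ar1 r / (2 * Ar r * sqrt (Ar r))) has_real_derivative D) (at 0)"
    unfolding D_def using zz by (intro DERIV2_quot_sqrt d_Nr d_Ar d_Nr1 d_Ar1) (simp_all add: at_0)
  then have "((\<lambda>r. Dy integrand (t, r)) has_real_derivative D) (at 0)"
    by (rule has_field_derivative_transform_within_open[OF _ SG]) (simp add: integrand_r)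
  with 1 have "Dy (Dy integrand) (t, 0) = D" by (rule DERIV_unique)
  also have "D = (1 / zz) * ((- 3 / 4 * zz\<^sup>2 + 1 / (2 * K)) + (3 / 4 * zz\<^sup>2 - 3 * M\<^sup>2 / K\<^sup>2 + 1 / (2 * K)) * (cos t)\<^sup>2)"
  proof -
    define C where "C = (cos t)\<^sup>2"
    have S: "(sin t)\<^sup>2 = 1 - C" by (simp add: C_def sin_squared_eq)
    have "lam0 = zz * zz / K" using zz K by (simp add: field_simps)
    have e: "Nr1 0 * Ar1 0 = 6 * lam0 * M\<^sup>2 * C / K" "(Ar1 0)\<^sup>2 = 4 * lam0\<^sup>2 * M\<^sup>2 * C"
      by (simp_all add: at_0 cM_def C_def power2_eq_square)
    show ?thesis
      unfolding D_def e S C_def[symmetric] \<open>lam0 = zz * zz / K\<close> at_0(4) using zz(1) K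
      by (simp add: divide_simps) (simp add: algebra_simps eval_nat_numeral)
  qed
  finally show ?thesis .
qed

end

text \<open>Differentiate twice under the integral sign. At \<open>r = 0\<close> the first
  derivative is a multiple of cos t and integrates to 0 over [0, pi]; the second is affine in (cos
  t)^2, whose mean is 1/2.\<close>

lemma corr_second_order:
  "((\<lambda>r. (corr (M, r, lam0) - L / real k) / r\<^sup>2) \<longlongrightarrow> curvature / 2) (at 0)"
proof -
  let ?F = "\<lambda>r. corr (M, r, lam0)" and ?F1 = "\<lambda>r. integral {0..pi} (\<lambda>t. Dy integrand (t, r))"
  note s1 = smooth_fderiv[OF open_strip[OF SG(1)] smooth_integrand]
  have d1: "(?F has_real_derivative ?F1 r) (at r)" if r: "r \<in> SG" for r
    using has_derivative_imp_real[OF has_derivative_param_integral[OF SG(1) smooth_integrand r, of 0 pi]]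
    by (rule has_field_derivative_transform_within_open[OF _ SG(1) r]) (simp add: corr_eq_integral)
  have "(?F1 has_real_derivative integral {0..pi} (\<lambda>t. Dy (Dy integrand) (t, 0))) (at 0)"
    by (rule has_derivative_imp_real[OF has_derivative_param_integral[OF SG(1) s1 SG(2)]])
  moreover have "integral {0..pi} (\<lambda>t. Dy (Dy integrand) (t, 0)) = curvature"
  proof -
    let ?a = "- 3 / 4 * zz\<^sup>2 + 1 / (2 * K)" and ?b = "3 / 4 * zz\<^sup>2 - 3 * M\<^sup>2 / K\<^sup>2 + 1 / (2 * K)"
    have "((\<lambda>t. Dy (Dy integrand) (t, 0)) has_integral (1 / zz) * (?a * pi + ?b * (pi / 2))) {0..pi}"
      unfolding integrand_rr_0
      using has_integral_const_real[of ?a 0 pi]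
      by (intro has_integral_mult_right has_integral_add has_integral_cos_sq_0_pi) (simp add: mult.commute)
    moreover have "(1 / zz) * (?a * pi + ?b * (pi / 2)) = curvature"
    proof -
      have e: "1 - 5 * M\<^sup>2 = K - 2 * M\<^sup>2" by (simp add: K_def)
      show ?thesis unfolding curvature_def power_mult_distrib e using zz(1) K
        by (simp add: divide_simps) (simp add: algebra_simps eval_nat_numeral)
    qed
    ultimately show ?thesis by (simp add: integral_unique)
  qed
  ultimately have d2: "(?F1 has_real_derivative curvature) (at 0)" by simp
  have z: "?F1 0 = 0"
    unfolding integrand_r_0 using has_integral_mult_right[OF has_integral_cos_0_pi, of "2 * M / (K * zz)"]
    by (simp add: integral_unique)
  have "\<forall>\<^sub>F r in at 0. r \<in> SG" using SG by (intro eventually_at_in_open') auto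
  then have "\<forall>\<^sub>F r in at 0. (?F has_real_derivative ?F1 r) (at r)" by eventually_elim (rule d1)
  from second_order_limit[OF this _ d2 z] d1[OF SG(2)] z
  show ?thesis by (simp add: corr_base)
qed

end

context mean_curve
begin

text \<open>On the curve \<open>m = h (r, lam0)\<close> the defect vanishes, so the half period
  equals \<open>corr\<close>. Passing from \<open>m = M\<close> to this curve changes
  \<open>corr\<close> by a term of order r^2 times an \<open>m\<close>-derivative that tends to 0,
  so only \<open>corr (M, r, lam0)\<close> contributes to the limit.\<close>

lemma excess_limit: "((\<lambda>r. excess (lam0, r) / r\<^sup>2) \<longlongrightarrow> - curvature / 2) (at 0)"
proof -
  let ?m = "\<lambda>r. h (r, lam0)"
  have in_ball: "(r, lam0) \<in> ball (0, lam0) \<rho>1 \<longleftrightarrow> \<bar>r\<bar> < \<rho>1" for r :: real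
    by (simp add: dist_Pair_Pair)
  have sm: "smooth (ball 0 \<rho>1) ?m"
  proof (rule smooth_compose[OF smooth_h])
    show "(r, lam0) \<in> ball (0, lam0) \<rho>1" if "r \<in> ball 0 \<rho>1" for r :: real
      unfolding in_ball using that by simp
  qed (intro smooth_intros)
  have m0: "?m 0 = M" by (rule h_0) (use \<rho>1 in \<open>simp add: in_ball\<close>)
  have m_even: "?m (- r) = ?m r" if "\<bar>r\<bar> < \<rho>1" for r by (rule h_minus) (use that in \<open>simp only: in_ball\<close>)
  obtain n where n: "((\<lambda>r. (?m r - M) / r\<^sup>2) \<longlongrightarrow> n) (at 0)"
    by (rule even_second_order_limit[OF \<rho>1 sm m_even]) (simp_all add: m0)
  have smc: "smooth (mbox \<eta>1 \<times> ball (0, lam0) \<rho>1) corr"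
    by (rule smooth_subset[OF smooth_corr box_Gam])
  have ev: "\<forall>\<^sub>F r in at 0. r \<in> ball 0 \<rho>1" using \<rho>1 by (intro eventually_at_in_open') auto
  have "\<exists>\<xi>. min M (?m r) \<le> \<xi> \<and> \<xi> \<le> max M (?m r) \<and>
      corr (?m r, (r, lam0)) - corr (M, (r, lam0)) = (?m r - M) * fderiv corr (\<xi>, (r, lam0)) (1, 0)"
    if "r \<in> ball 0 \<rho>1" for r
  proof (rule mvt_between)
    fix x assume x: "min M (?m r) \<le> x" "x \<le> max M (?m r)"
    have b: "(r, lam0) \<in> ball (0, lam0) \<rho>1" unfolding in_ball using that by simp
    have "x \<in> mbox \<eta>1" using x h_box[OF b] \<eta>1 by (auto simp: min_def max_def split: if_splits)
    then show "((\<lambda>x. corr (x, (r, lam0))) has_real_derivative fderiv corr (x, (r, lam0)) (1, 0)) (at x)"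
      using b by (intro has_real_derivative_Pair_left smooth_has_derivative[OF smc]) blast
  qed
  then obtain \<xi> where \<xi>: "\<And>r. r \<in> ball 0 \<rho>1 \<Longrightarrow> min M (?m r) \<le> \<xi> r \<and> \<xi> r \<le> max M (?m r) \<and>
      corr (?m r, (r, lam0)) - corr (M, (r, lam0)) = (?m r - M) * fderiv corr (\<xi> r, (r, lam0)) (1, 0)"
    by metis
  have "isCont ?m 0" using smooth_continuous_on[OF sm] \<rho>1 by (simp add: continuous_on_eq_continuous_at)
  then have mlim: "(?m \<longlongrightarrow> M) (at 0)" by (simp add: isCont_def m0)
  have \<xi>lim: "(\<xi> \<longlongrightarrow> M) (at 0)"
  proof (rule tendsto_sandwich)
    show "((\<lambda>r. min M (?m r)) \<longlongrightarrow> M) (at 0)" "((\<lambda>r. max M (?m r)) \<longlongrightarrow> M) (at 0)"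
      using tendsto_min[OF tendsto_const mlim, of M] tendsto_max[OF tendsto_const mlim, of M] by simp_all
    show "\<forall>\<^sub>F r in at 0. min M (?m r) \<le> \<xi> r" "\<forall>\<^sub>F r in at 0. \<xi> r \<le> max M (?m r)"
      using ev by (eventually_elim, use \<xi> in blast)+
  qed
  have "continuous_on Gam (\<lambda>q. fderiv corr q (1, 0))"
    by (intro smooth_continuous_on smooth_fderiv[OF open_Gam smooth_corr])
  then have "isCont (\<lambda>q. fderiv corr q (1, 0)) (M, (0, lam0))"
    using open_Gam base_Gam by (simp add: continuous_on_eq_continuous_at)
  then have "((\<lambda>r. fderiv corr (\<xi> r, (r, lam0)) (1, 0)) \<longlongrightarrow> fderiv corr (M, (0, lam0)) (1, 0)) (at 0)"
    by (rule isCont_tendsto_compose) (intro tendsto_intros \<xi>lim)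
  from tendsto_add[OF tendsto_mult[OF n this] corr_second_order]
  have lim: "((\<lambda>r. (?m r - M) / r\<^sup>2 * fderiv corr (\<xi> r, (r, lam0)) (1, 0) + (corr (M, r, lam0) - L / real k) / r\<^sup>2)
      \<longlongrightarrow> curvature / 2) (at 0)"
    by (simp add: corr_stationary)
  have "\<forall>\<^sub>F r in at 0. (?m r - M) / r\<^sup>2 * fderiv corr (\<xi> r, (r, lam0)) (1, 0) + (corr (M, r, lam0) - L / real k) / r\<^sup>2
      = - (excess (lam0, r) / r\<^sup>2)"
    using ev
  proof eventually_elim
    case (elim r)
    have b: "(r, lam0) \<in> ball (0, lam0) \<rho>1" unfolding in_ball using elim by simp
    have "defect M (?m r, (r, lam0)) = 0" using h_iff[OF h_box[OF b] b] by blast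
    then have "corr (?m r, r, lam0) = halfperiod (?m r, r, lam0)" by (simp add: corr_def)
    then have "- excess (lam0, r) = (?m r - M) * fderiv corr (\<xi> r, (r, lam0)) (1, 0) + (corr (M, r, lam0) - L / real k)"
      using \<xi>[OF elim] by (simp add: excess_def)
    from arg_cong[where f="\<lambda>x. x / r\<^sup>2", OF this] show ?case by (simp add: add_divide_distrib)
  qed
  from tendsto_cong[THEN iffD1, OF this lim] show ?thesis
    using tendsto_minus by fastforce
qed

end

context bifurcation_branch
begin

text \<open>A negative excess at \<open>lam0\<close> means, by \<open>Lam_less\<close>, that the
  zero \<open>\<Lambda> r\<close> of the excess lies to the right of \<open>lam0\<close>.\<close>

lemma branch_supercritical: "curvature > 0 \<Longrightarrow> \<forall>\<^sub>F y in at 0. \<Lambda> y > lam0"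
proof -
  assume "curvature > 0"
  then have "\<forall>\<^sub>F r in at 0. excess (lam0, r) / r\<^sup>2 < 0"
    by (intro order_tendstoD(2)[OF excess_limit]) simp
  moreover have "\<forall>\<^sub>F r in at 0. r \<in> ball 0 \<delta>" using \<delta> by (intro eventually_at_in_open') auto
  ultimately show ?thesis
  proof eventually_elim
    case (elim r)
    then have "excess (lam0, r) < 0" by (simp add: divide_less_0_iff)
    then show ?case using Lam_less[of lam0 r] elim \<eta>2 by simp
  qed
qed

lemma branch_subcritical: "curvature < 0 \<Longrightarrow> \<forall>\<^sub>F y in at 0. \<Lambda> y < lam0"
proof -
  assume "curvature < 0"
  then have "\<forall>\<^sub>F r in at 0. 0 < excess (lam0, r) / r\<^sup>2"
    by (intro order_tendstoD(1)[OF excess_limit]) simp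
  moreover have "\<forall>\<^sub>F r in at 0. r \<in> ball 0 \<delta>" using \<delta> by (intro eventually_at_in_open') auto
  ultimately show ?thesis
  proof eventually_elim
    case (elim r)
    then have "excess (lam0, r) > 0" by (simp add: zero_less_divide_iff)
    then have "\<not> excess (lam0, r) < 0" "excess (lam0, r) \<noteq> 0" by auto
    then show ?case using Lam_less[of lam0 r] Lam_iff[of lam0 r] elim \<eta>2 by auto
  qed
qed

end

section \<open>Absence of bifurcations\<close>

text \<open>Averaging \<open>v x - v s\<close> over \<open>s\<close> gives \<open>v x\<close>, since
  the mean of \<open>v\<close> is zero. Bounding |p| by (\<eta> + p^2 / \<eta>) / 2 takes the place
  of Cauchy-Schwarz, and \<eta> is optimized where the bound is used.\<close>

lemma poincare_mean_zero:
  fixes v p :: "real \<Rightarrow> real"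
  assumes L: "L > 0" and v: "\<And>x. x \<in> {0..L} \<Longrightarrow> (v has_real_derivative p x) (at x within {0..L})"
    and p: "continuous_on {0..L} p" and mean: "integral {0..L} v = 0" and x: "x \<in> {0..L}" and e: "\<eta> > 0"
  shows "\<bar>v x\<bar> \<le> (\<eta> * L + integral {0..L} (\<lambda>x. (p x)\<^sup>2) / \<eta>) / 2"
proof -
  let ?q = "\<lambda>x. (\<eta> + (p x)\<^sup>2 / \<eta>) / 2"
  define J where "J = integral {0..L} ?q"
  have cq: "continuous_on {0..L} ?q" using e by (intro continuous_intros p) auto
  have pq: "\<bar>p x\<bar> \<le> ?q x" for x
  proof -
    have "2 * (\<bar>p x\<bar> * \<eta>) \<le> \<bar>p x\<bar>\<^sup>2 + \<eta>\<^sup>2" using sum_squares_bound[of "\<bar>p x\<bar>" \<eta>] by simp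
    then show ?thesis using e by (simp add: field_simps power2_eq_square)
  qed
  have le: "\<bar>v b - v a\<bar> \<le> J" if ab: "0 \<le> a" "a \<le> b" "b \<le> L" for a b
  proof -
    have sub: "{a..b} \<subseteq> {0..L}" using ab by auto
    have "(p has_integral v b - v a) {a..b}"
      using ab sub v by (intro fundamental_theorem_of_calculus)
        (auto simp: has_real_derivative_iff_has_vector_derivative[symmetric] intro!: DERIV_subset[OF v sub])
    then have "v b - v a = integral {a..b} p" by (simp add: integral_unique)
    also have "norm \<dots> \<le> integral {a..b} ?q"
    proof (rule integral_norm_bound_integral)
      show "p integrable_on {a..b}" "?q integrable_on {a..b}"
        by (intro integrable_continuous_interval continuous_on_subset[OF p sub] continuous_on_subset[OF cq sub])+
      show "norm (p x) \<le> ?q x" for x using pq[of x] by simp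
    qed
    also have "\<dots> \<le> J" unfolding J_def
    proof (rule integral_subset_le[OF sub])
      show "?q integrable_on {a..b}" "?q integrable_on {0..L}"
        by (intro integrable_continuous_interval continuous_on_subset[OF cq sub] cq)+
      show "\<forall>x\<in>{0..L}. 0 \<le> ?q x" using order_trans[OF abs_ge_zero pq] by blast
    qed
    finally show ?thesis by simp
  qed
  have le': "\<bar>v x - v s\<bar> \<le> J" if "s \<in> {0..L}" for s
    using le[of s x] le[of x s] x that by (cases "s \<le> x") (auto simp: abs_minus_commute)
  have cv: "continuous_on {0..L} v" by (rule DERIV_continuous_on[OF v])
  have "norm (integral {0..L} (\<lambda>s. v x - v s)) \<le> J * (L - 0)"
    by (rule integral_bound) (use L le' in \<open>auto intro!: continuous_intros cv\<close>)
  moreover have "integral {0..L} (\<lambda>s. v x - v s) = L * v x"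
  proof -
    have "integral {0..L} (\<lambda>s. v x - v s) = integral {0..L} (\<lambda>s. v x) - integral {0..L} v"
      by (intro integral_diff integrable_continuous_interval cv continuous_intros)
    then show ?thesis using mean L by simp
  qed
  ultimately have "L * \<bar>v x\<bar> \<le> L * J" using L by (simp add: abs_mult mult.commute)
  then have "\<bar>v x\<bar> \<le> J" using L by simp
  also have "J = (\<eta> * L + integral {0..L} (\<lambda>x. (p x)\<^sup>2) / \<eta>) / 2"
  proof -
    have i: "(\<lambda>x. (p x)\<^sup>2) integrable_on {0..L}"
      by (intro integrable_continuous_interval continuous_intros p)
    have "(?q has_integral (\<eta> * L + integral {0..L} (\<lambda>x. (p x)\<^sup>2) / \<eta>) / 2) {0..L}"
      using has_integral_const_real[of \<eta> 0 L] L
      by (intro has_integral_divide has_integral_add integrable_integral[OF i]) (auto simp: mult.commute)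
    from integral_unique[OF this] show ?thesis unfolding J_def .
  qed
  finally show ?thesis .
qed

text \<open>Tested with \<open>v = u - M\<close>, the reaction term yields a quadratic part with the
  sign of 3 M^2 - 1 \<ge> 0, a nonnegative quartic part, and the cubic part 3 lam M v^3. Only the
  last is indefinite; for small \<open>v\<close> it is dominated by \<open>B\<close> v^2, and the
  flux term absorbs it through Poincare's inequality. The borderline 3 M^2 = 1 needs no extra
  case.\<close>

lemma small_solution_constant:
  assumes L: "L > 0" and M: "3 * M\<^sup>2 \<ge> 1" and nr: "near L M lam0 \<epsilon> lam u" and sol: "is_solution L M lam u"
    and \<epsilon>: "\<epsilon> \<le> 1" "lam \<le> B0" "3 * B0 * \<bar>M\<bar> * \<epsilon> * L\<^sup>2 < 1 / 2" and x: "x \<in> {0..L}"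
  shows "u x = M"
proof -
  have C: "Ck_on 2 {0..L} u" using nr by (simp add: near_def)
  note bd = near_bounds[OF L nr]
  define p where "p = Dw {0..L} u"
  define v where "v = (\<lambda>x. u x - M)"
  define z where "z = flux L u"
  define c where "c = 1 / L * integral {0..L} (\<lambda>s. cubic_f (u s))"
  define I where "I = integral {0..L} (\<lambda>x. (p x)\<^sup>2)"
  define B where "B = 3 * B0 * \<bar>M\<bar> * \<epsilon>"
  have lam: "lam > 0" using sol by (simp add: is_solution_def)
  have e0: "\<epsilon> > 0" using bd(1)[OF x] by linarith
  have du: "(u has_real_derivative p x) (at x within {0..L})" if "x \<in> {0..L}" for x
    using Ck_on_has_derivative[OF C, of 0 x] that by (simp add: p_def)
  have dv: "(v has_real_derivative p x) (at x within {0..L})" if "x \<in> {0..L}" for x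
    using DERIV_diff[OF du[OF that] DERIV_const[of M]] by (simp add: v_def)
  have cp: "continuous_on {0..L} p" using Ck_on_continuous[OF C, of 1] by (simp add: p_def)
  have cv: "continuous_on {0..L} v" by (rule DERIV_continuous_on[OF dv])
  have cz: "continuous_on {0..L} z" unfolding z_def by (rule flux_continuous[OF C])
  have cu: "continuous_on {0..L} u" by (rule DERIV_continuous_on[OF du])
  have mean: "integral {0..L} v = 0"
  proof -
    have "integral {0..L} u = M * L" using sol L by (auto simp: is_solution_def field_simps)
    moreover have "integral {0..L} v = integral {0..L} u - integral {0..L} (\<lambda>x. M)"
      unfolding v_def by (intro integral_diff integrable_continuous_interval cu continuous_intros)
    ultimately show ?thesis using L by simp
  qed
  have zp: "(p x)\<^sup>2 / 2 \<le> z x * p x" if "x \<in> {0..L}" for x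
  proof -
    have "\<bar>p x\<bar> \<le> 1" using bd(2)[OF that] \<epsilon> by (simp add: p_def)
    then have "(p x)\<^sup>2 \<le> 1" by (simp add: abs_square_le_1)
    then have "sqrt (1 + (p x)\<^sup>2) \<le> sqrt (2\<^sup>2)" by (intro real_sqrt_le_mono) simp
    then have "sqrt (1 + (p x)\<^sup>2) \<le> 2" by simp
    then have "(p x)\<^sup>2 / 2 \<le> (p x)\<^sup>2 / sqrt (1 + (p x)\<^sup>2)"
      by (intro divide_left_mono) (auto simp: add_pos_nonneg)
    then show ?thesis by (simp add: z_def flux_def p_def power2_eq_square)
  qed
  \<comment> \<open>\<open>?f\<close> is the derivative of \<open>z * v\<close>, which vanishes at
    both ends by the Neumann conditions. \<open>?g\<close> is a lower bound whose first term
    integrates to 0 because \<open>v\<close> has mean zero.\<close>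
  let ?f = "\<lambda>x. lam * (c - cubic_f (u x)) * v x + p x * z x"
  let ?g = "\<lambda>x. lam * (c - cubic_f M) * v x + ((p x)\<^sup>2 / 2 - B * (v x)\<^sup>2)"
  have "(?f has_integral z L * v L - z 0 * v 0) {0..L}"
  proof (rule fundamental_theorem_of_calculus_interior)
    fix x assume x: "x \<in> {0<..<L}"
    have dz: "(z has_real_derivative lam * (c - cubic_f (u x))) (at x)"
    proof -
      have "deriv (flux L u) x + lam * cubic_f (u x) - lam * c = 0"
        using sol x unfolding is_solution_def c_def by simp
      then have "deriv (flux L u) x = lam * (c - cubic_f (u x))" by (simp add: algebra_simps)
      then show ?thesis using flux_differentiable[OF L C x] by (simp add: z_def)
    qed
    have "(v has_real_derivative p x) (at x)" using dv[of x] x by (simp add: at_within_Icc_at)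
    from DERIV_mult[OF dz this]
    show "((\<lambda>x. z x * v x) has_vector_derivative ?f x) (at x)"
      by (simp add: has_real_derivative_iff_has_vector_derivative)
  qed (use L in \<open>auto intro!: continuous_intros cz cv\<close>)
  moreover have "z 0 = 0" "z L = 0" using sol by (simp_all add: z_def flux_def is_solution_def)
  ultimately have f0: "(?f has_integral 0) {0..L}" by simp
  have i2: "(\<lambda>x. (p x)\<^sup>2) integrable_on {0..L}" "v integrable_on {0..L}" "(\<lambda>x. (v x)\<^sup>2) integrable_on {0..L}"
    by (auto intro!: integrable_continuous_interval continuous_intros cp cv)
  have "(?g has_integral lam * (c - cubic_f M) * integral {0..L} v + (I / 2 - B * integral {0..L} (\<lambda>x. (v x)\<^sup>2))) {0..L}"
    unfolding I_def
    by (intro has_integral_add has_integral_diff has_integral_mult_right has_integral_divide integrable_integral i2)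
  then have g: "(?g has_integral lam * (c - cubic_f M) * 0 + (I / 2 - B * integral {0..L} (\<lambda>x. (v x)\<^sup>2))) {0..L}"
    unfolding mean .
  have "lam * (c - cubic_f M) * 0 + (I / 2 - B * integral {0..L} (\<lambda>x. (v x)\<^sup>2)) \<le> 0"
  proof (rule has_integral_le[OF g f0])
    fix x assume x: "x \<in> {0..L}"
    have id: "cubic_f (u x) = cubic_f M + ((1 - 3 * M\<^sup>2) * v x - 3 * M * (v x)\<^sup>2 - (v x) ^ 3)"
      by (simp add: cubic_f_def v_def power2_eq_square power3_eq_cube algebra_simps)
    have "lam * (c - cubic_f (u x)) * v x = lam * (c - cubic_f M) * v x
        + lam * ((3 * M\<^sup>2 - 1) * (v x)\<^sup>2) + lam * ((v x)\<^sup>2 * (v x)\<^sup>2) + 3 * lam * M * v x * (v x)\<^sup>2"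
      unfolding id by (simp add: algebra_simps power2_eq_square power3_eq_cube)
    moreover have "0 \<le> lam * ((3 * M\<^sup>2 - 1) * (v x)\<^sup>2)" "0 \<le> lam * ((v x)\<^sup>2 * (v x)\<^sup>2)"
      using lam M by simp_all
    moreover have "- (B * (v x)\<^sup>2) \<le> 3 * lam * M * v x * (v x)\<^sup>2"
    proof -
      have "\<bar>3 * lam * M * v x\<bar> = 3 * lam * \<bar>M\<bar> * \<bar>v x\<bar>" using lam by (simp add: abs_mult)
      also have "\<dots> \<le> 3 * B0 * \<bar>M\<bar> * \<epsilon>"
        using lam \<epsilon> bd(1)[OF x] by (intro mult_mono) (auto simp: v_def)
      finally have "- B \<le> 3 * lam * M * v x" by (simp add: B_def abs_le_iff)
      then have "- B * (v x)\<^sup>2 \<le> 3 * lam * M * v x * (v x)\<^sup>2" by (intro mult_right_mono) auto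
      then show ?thesis by simp
    qed
    ultimately show "?g x \<le> ?f x" using zp[OF x] by (simp add: mult.commute[of "p x"])
  qed
  then have energy: "I / 2 \<le> B * integral {0..L} (\<lambda>x. (v x)\<^sup>2)" by simp
  have I0: "I \<ge> 0" unfolding I_def by (rule integral_nonneg[OF i2(1)]) simp
  have B0: "B \<ge> 0" unfolding B_def using lam \<epsilon> e0 by simp
  have poin: "\<bar>v x\<bar> \<le> (\<eta> * L + I / \<eta>) / 2" if "\<eta> > 0" "x \<in> {0..L}" for \<eta> x
    unfolding I_def by (rule poincare_mean_zero[OF L dv cp mean that(2,1)])
  have "I = 0"
  proof (rule ccontr)
    assume "I \<noteq> 0"
    then have Ip: "I > 0" using I0 by simp
    \<comment> \<open>This value balances the two terms of the Poincare bound and gives |v| \<le>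
      \<eta> L, that is v^2 \<le> I L.\<close>
    define \<eta> where "\<eta> = sqrt (I / L)"
    have \<eta>: "\<eta> > 0" "I = \<eta> * \<eta> * L" using Ip L by (auto simp: \<eta>_def)
    have "(v x)\<^sup>2 \<le> I * L" if "x \<in> {0..L}" for x
    proof -
      have "\<bar>v x\<bar> \<le> \<eta> * L" using poin[OF \<eta>(1) that] \<eta>(1) unfolding \<eta>(2) by (simp add: mult.commute)
      then have "\<bar>v x\<bar>\<^sup>2 \<le> (\<eta> * L)\<^sup>2" by (intro power_mono) auto
      then show ?thesis unfolding \<eta>(2) by (simp add: power2_eq_square mult_ac)
    qed
    then have "integral {0..L} (\<lambda>x. (v x)\<^sup>2) \<le> integral {0..L} (\<lambda>x. I * L)"
      using i2(3) by (intro integral_le) auto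
    also have "\<dots> = I * L\<^sup>2" using L by (simp add: power2_eq_square)
    finally have "I / 2 \<le> B * (I * L\<^sup>2)" using energy B0 by (meson mult_left_mono order_trans)
    also have "\<dots> = B * L\<^sup>2 * I" by simp
    also have "\<dots> < 1 / 2 * I" using \<epsilon>(3) Ip unfolding B_def by (intro mult_strict_right_mono) auto
    finally show False by simp
  qed
  \<comment> \<open>Once \<open>I = 0\<close>, the Poincare bound with \<eta> = d / L reads |v x|
    \<le> d / 2.\<close>
  have "\<bar>v x\<bar> \<le> 0 + d" if "d > 0" for d
    using poin[of "d / L" x] x that L \<open>I = 0\<close> by simp
  then have "\<bar>v x\<bar> \<le> 0" by (rule field_le_epsilon)
  then show ?thesis by (simp add: v_def)
qed

lemma no_bifurcation:
  assumes L: "L > 0" and M: "3 * M\<^sup>2 \<ge> 1" and lam0: "lam0 > 0"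
  shows "\<not> bifurcation_at L M lam0"
proof
  assume bif: "bifurcation_at L M lam0"
  define B where "B = 3 * (lam0 + 1) * \<bar>M\<bar> * L\<^sup>2"
  have B: "B \<ge> 0" using lam0 by (simp add: B_def)
  \<comment> \<open>This gives \<open>B * \<epsilon>\<close> at most B / (4 (B + 1)), hence below
    1/2, and \<open>\<epsilon> \<le> 1\<close> lets \<open>lam0 + 1\<close> bound the parameter
    \<open>lam\<close>.\<close>
  define \<epsilon> where "\<epsilon> = min 1 (1 / (4 * (B + 1)))"
  have \<epsilon>: "\<epsilon> > 0" "\<epsilon> \<le> 1" using B by (auto simp: \<epsilon>_def)
  have "B * \<epsilon> \<le> B * (1 / (4 * (B + 1)))" using B by (intro mult_left_mono) (auto simp: \<epsilon>_def)
  also have "\<dots> < 1 / 2" using B by (simp add: field_simps)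
  finally have small: "3 * (lam0 + 1) * \<bar>M\<bar> * \<epsilon> * L\<^sup>2 < 1 / 2" by (simp add: B_def mult_ac)
  obtain lam u where u: "near L M lam0 \<epsilon> lam u" "is_solution L M lam u" "\<not> u constant_on {0..L}"
    using bif \<epsilon> unfolding bifurcation_at_def by blast
  have "lam \<le> lam0 + 1" using u(1) \<epsilon> by (auto simp: near_def)
  then have "u x = M" if "x \<in> {0..L}" for x
    using small_solution_constant[OF L M u(1,2) \<epsilon>(2) _ small that] by blast
  then show False using u(3) unfolding constant_on_def by blast
qed

section \<open>Thresholds for \<open>M\<close> and \<open>L\<close>, and the conclusion\<close>

lemma abs_less_inverse_sqrt_iff:
  fixes M a :: real
  assumes "a > 0"
  shows "\<bar>M\<bar> < 1 / sqrt a \<longleftrightarrow> a * M\<^sup>2 < 1" "1 / sqrt a < \<bar>M\<bar> \<longleftrightarrow> 1 < a * M\<^sup>2"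
proof -
  have s: "sqrt a > 0" using assms by simp
  have sq: "a * M\<^sup>2 = (\<bar>M\<bar> * sqrt a)\<^sup>2" using assms by (simp add: power_mult_distrib mult.commute)
  have "\<bar>M\<bar> < 1 / sqrt a \<longleftrightarrow> \<bar>M\<bar> * sqrt a < 1" using s by (simp add: less_divide_eq)
  also have "\<dots> \<longleftrightarrow> a * M\<^sup>2 < 1"
    unfolding sq using abs_square_less_1[of "\<bar>M\<bar> * sqrt a"] s by (simp add: abs_mult)
  finally show "\<bar>M\<bar> < 1 / sqrt a \<longleftrightarrow> a * M\<^sup>2 < 1" .
  have "1 / sqrt a < \<bar>M\<bar> \<longleftrightarrow> 1 < \<bar>M\<bar> * sqrt a" using s by (simp add: divide_less_eq)
  also have "\<dots> \<longleftrightarrow> 1 < a * M\<^sup>2"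
    unfolding sq using abs_square_le_1[of "\<bar>M\<bar> * sqrt a"] s by (simp add: abs_mult not_le[symmetric])
  finally show "1 / sqrt a < \<bar>M\<bar> \<longleftrightarrow> 1 < a * M\<^sup>2" .
qed

context neumann_bifurcation
begin

lemma ex_branch: "\<exists>\<eta>1 \<rho>1 h \<eta>2 \<delta> \<Lambda>. bifurcation_branch L M k \<eta>1 \<rho>1 h \<eta>2 \<delta> \<Lambda>"
proof -
  obtain \<eta>1 \<rho>1 h where 1: "0 < \<eta>1" "0 < \<rho>1" "mbox \<eta>1 \<times> ball (0, lam0) \<rho>1 \<subseteq> Gam"
    "smooth (ball (0, lam0) \<rho>1) h" "\<forall>e\<in>ball (0, lam0) \<rho>1. h e \<in> mbox \<eta>1"
    "\<forall>m\<in>mbox \<eta>1. \<forall>e\<in>ball (0, lam0) \<rho>1. defect M (m, e) = 0 \<longleftrightarrow> m = h e"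
    using ex_mean_curve by blast
  interpret mean_curve L M k \<eta>1 \<rho>1 h
    by unfold_locales (use 1 in blast)+
  obtain \<eta>2 \<delta> \<Lambda> where 2: "0 < \<eta>2" "0 < \<delta>" "lbox \<eta>2 \<times> ball 0 \<delta> \<subseteq> D2"
    "smooth (ball 0 \<delta>) \<Lambda>" "\<Lambda> 0 = lam0" "\<forall>r\<in>ball 0 \<delta>. \<Lambda> r \<in> lbox \<eta>2"
    "\<forall>l\<in>lbox \<eta>2. \<forall>r\<in>ball 0 \<delta>. (excess (l, r) = 0 \<longleftrightarrow> l = \<Lambda> r) \<and> (excess (l, r) < 0 \<longleftrightarrow> l < \<Lambda> r)"
    using ex_lambda_curve by blast
  have "bifurcation_branch L M k \<eta>1 \<rho>1 h \<eta>2 \<delta> \<Lambda>"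
    by unfold_locales (use 2 in blast)+
  then show ?thesis by blast
qed

lemma pitchfork:
  "curvature > 0 \<Longrightarrow> supercritical_pitchfork L M k (lambda_k L M k)"
  "curvature < 0 \<Longrightarrow> subcritical_pitchfork L M k (lambda_k L M k)"
proof -
  obtain \<eta>1 \<rho>1 h \<eta>2 \<delta> \<Lambda> where "bifurcation_branch L M k \<eta>1 \<rho>1 h \<eta>2 \<delta> \<Lambda>" using ex_branch by blast
  then interpret bifurcation_branch L M k \<eta>1 \<rho>1 h \<eta>2 \<delta> \<Lambda> .
  show "curvature > 0 \<Longrightarrow> supercritical_pitchfork L M k (lambda_k L M k)"
    using branch_pitchfork branch_supercritical unfolding supercritical_pitchfork_def lam0_def by blast
  show "curvature < 0 \<Longrightarrow> subcritical_pitchfork L M k (lambda_k L M k)"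
    using branch_pitchfork branch_subcritical unfolding subcritical_pitchfork_def lam0_def by blast
qed

lemma curvature_sign:
  "(zz * K)\<^sup>2 < 2 * (1 - 5 * M\<^sup>2) \<Longrightarrow> curvature > 0"
  "2 * (1 - 5 * M\<^sup>2) < (zz * K)\<^sup>2 \<Longrightarrow> curvature < 0"
proof -
  have c: "3 * pi / (4 * K\<^sup>2 * zz) > 0" using K zz(1) by simp
  have pos: "q < 2 * (1 - m) \<Longrightarrow> 0 < 1 - m - q / 2" and neg: "2 * (1 - m) < q \<Longrightarrow> 1 - m - q / 2 < 0" for q m :: real
    by (simp_all add: field_simps)
  show "(zz * K)\<^sup>2 < 2 * (1 - 5 * M\<^sup>2) \<Longrightarrow> curvature > 0"
    unfolding curvature_def by (rule mult_pos_pos[OF c pos])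
  show "2 * (1 - 5 * M\<^sup>2) < (zz * K)\<^sup>2 \<Longrightarrow> curvature < 0"
    unfolding curvature_def by (rule mult_pos_neg[OF c neg])
qed

text \<open>With a = sqrt (2 (1 - 5 M^2)), \<open>L_star M k\<close> is \<open>L\<close> times
  \<open>zz * K\<close> divided by a. Comparing it with \<open>L\<close> thus amounts to comparing
  \<open>zz * K\<close> with a, which is the sign of \<open>curvature\<close> in squared
  form.\<close>

lemma L_star_iff:
  assumes "5 * M\<^sup>2 < 1"
  shows "L > L_star M k \<longleftrightarrow> (zz * K)\<^sup>2 < 2 * (1 - 5 * M\<^sup>2)"
    "L < L_star M k \<longleftrightarrow> 2 * (1 - 5 * M\<^sup>2) < (zz * K)\<^sup>2"
proof -
  define a where "a = sqrt 2 * sqrt (1 - 5 * M\<^sup>2)"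
  have a: "a > 0" "a\<^sup>2 = 2 * (1 - 5 * M\<^sup>2)" using assms by (auto simp: a_def power_mult_distrib)
  have "L_star M k = real k * pi * K / a" by (simp add: L_star_def a_def K_def)
  then have LL: "L_star M k = L * (zz * K) / a" using L by (simp add: zz_def)
  have z: "zz * K > 0" using zz K by simp
  have sq: "x < y \<longleftrightarrow> x\<^sup>2 < y\<^sup>2" if "0 < x" "0 < y" for x y :: real
    using that power_strict_mono[of x y 2] power2_less_imp_less[of x y] by auto
  have "L > L_star M k \<longleftrightarrow> zz * K < a" unfolding LL using a L by (simp add: divide_less_eq)
  also have "\<dots> \<longleftrightarrow> (zz * K)\<^sup>2 < a\<^sup>2" by (rule sq) (use z a(1) in auto)
  finally show "L > L_star M k \<longleftrightarrow> (zz * K)\<^sup>2 < 2 * (1 - 5 * M\<^sup>2)" unfolding a(2) .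
  have "L < L_star M k \<longleftrightarrow> a < zz * K" unfolding LL using a L by (simp add: less_divide_eq)
  also have "\<dots> \<longleftrightarrow> a\<^sup>2 < (zz * K)\<^sup>2" by (rule sq) (use z a(1) in auto)
  finally show "L < L_star M k \<longleftrightarrow> 2 * (1 - 5 * M\<^sup>2) < (zz * K)\<^sup>2" unfolding a(2) .
qed

end

theorem proposition2p1:
  fixes L M :: real and k :: nat
  assumes "L > 0" and "k \<ge> 1"
  shows "(\<bar>M\<bar> < 1 / sqrt 5 \<longrightarrow>
            (L > L_star M k \<longrightarrow> supercritical_pitchfork L M k (lambda_k L M k)) \<and>
            (L < L_star M k \<longrightarrow> subcritical_pitchfork L M k (lambda_k L M k))) \<and>
         (1 / sqrt 5 < \<bar>M\<bar> \<and> \<bar>M\<bar> < 1 / sqrt 3 \<longrightarrow>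
            subcritical_pitchfork L M k (lambda_k L M k)) \<and>
         (\<bar>M\<bar> \<ge> 1 / sqrt 3 \<longrightarrow> (\<forall>lam0>0. \<not> bifurcation_at L M lam0))"
proof (intro conjI impI allI)
  assume M: "\<bar>M\<bar> < 1 / sqrt 5"
  then have M5: "5 * M\<^sup>2 < 1" by (simp only: abs_less_inverse_sqrt_iff(1)[of 5, simplified])
  then interpret neumann_bifurcation L M k
    by unfold_locales (use assms zero_le_power2[of M] in linarith)+
  show "supercritical_pitchfork L M k (lambda_k L M k)" if "L > L_star M k"
    using pitchfork(1) curvature_sign(1) L_star_iff(1)[OF M5] that by blast
  show "subcritical_pitchfork L M k (lambda_k L M k)" if "L < L_star M k"
    using pitchfork(2) curvature_sign(2) L_star_iff(2)[OF M5] that by blast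
next
  assume M: "1 / sqrt 5 < \<bar>M\<bar> \<and> \<bar>M\<bar> < 1 / sqrt 3"
  then have M5: "1 < 5 * M\<^sup>2" and M3: "3 * M\<^sup>2 < 1"
    using abs_less_inverse_sqrt_iff(2)[of 5 M] abs_less_inverse_sqrt_iff(1)[of 3 M] by auto
  interpret neumann_bifurcation L M k
    by unfold_locales (use assms M3 in auto)
  \<comment> \<open>For 5 M^2 > 1 both terms in the bracket of \<open>curvature\<close> pull
    downwards, so its sign is negative whatever the value of \<open>L\<close>.\<close>
  have "2 * (1 - 5 * M\<^sup>2) < 0" using M5 by simp
  then have "2 * (1 - 5 * M\<^sup>2) < (zz * K)\<^sup>2" by (rule less_le_trans[OF _ zero_le_power2])
  then show "subcritical_pitchfork L M k (lambda_k L M k)"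
    by (rule pitchfork(2)[OF curvature_sign(2)])
next
  fix lam0 :: real
  assume M: "\<bar>M\<bar> \<ge> 1 / sqrt 3" and "lam0 > 0"
  then have "3 * M\<^sup>2 \<ge> 1" using abs_less_inverse_sqrt_iff(1)[of 3 M] by auto
  then show "\<not> bifurcation_at L M lam0" using no_bifurcation[OF assms(1)] \<open>lam0 > 0\<close> by blast
qed

end
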